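(* The number of non-isomorphic degree $8$ maximal arcs of proper Mathon type in $\mathrm{PG}(2,2^7)$ is equal to $201$; two of them are Singer $8$-arcs and $199$ of them are normal $8$-arcs.
   Context: Let $q=2^h$, $\mathrm{Tr}$ the absolute trace $\mathrm{GF}(q)\to\mathrm{GF}(2)$. A maximal arc of degree $d$ in $\mathrm{PG}(2,q)$ is a non-empty proper point set meeting every line in $0$ or $d$ points. For $\alpha,\beta\in\mathrm{GF}(q)$ with $\mathrm{Tr}(\alpha\beta)=1$ and $\lambda\in\mathrm{GF}(q)^*$ let $F_{\alpha,\beta,\lambda}=\{(x,y,z):\alpha x^2+xy+\beta y^2+\lambda z^2=0\}$. For $\lambda\ne\lambda'$ define $F_{\alpha,\beta,\lambda}\oplus F_{\alpha',\beta',\lambda'}=F_{\alpha'',\beta'',\lambda+\lambda'}$ with $\alpha''=(\alpha\lambda+\alpha'\lambda')/(\lambda+\lambda')$, $\beta''=(\beta\lambda+\beta'\lambda')/(\lambda+\lambda')$. If a set $\mathcal{C}$ of such conics is closed under $\oplus$ (of distinct members), the union of its conics with $(0,0,1)$ is a maximal arc of degree $|\mathcal{C}|+1$; any image of such an arc under a collineation is a maximal arc of Mathon type. It is of Denniston type if it is an image of one whose conics are all of the form $F_{\alpha,1,\lambda}$ for a fixed $\alpha$ with $\mathrm{Tr}(\alpha)=1$; it is of proper Mathon type if it is of Mathon type but not of Denniston type. Arcs are isomorphic if some element of $\mathrm{P\Gamma L}(3,q)$ maps one onto the other, and the automorphism group of an arc is its stabilizer in $\mathrm{P\Gamma L}(3,q)$.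 A Singer $8$-arc is a degree $8$ maximal arc of proper Mathon type in $\mathrm{PG}(2,2^7)$ whose automorphism group has order $14$; a normal $8$-arc is one whose automorphism group has order $2$. *)

theory Defs
  imports Main
begin

type_synonym 'a vec3 = "'a \<times> 'a \<times> 'a"

fun vsc :: "'a::field \<Rightarrow> 'a vec3 \<Rightarrow> 'a vec3" where
  "vsc c (x, y, z) = (c * x, c * y, c * z)"

fun vadd :: "'a::field vec3 \<Rightarrow> 'a vec3 \<Rightarrow> 'a vec3" where
  "vadd (x, y, z) (x', y', z') = (x + x', y + y', z + z')"

definition pclass :: "'a::field vec3 \<Rightarrow> 'a vec3 set" where
  "pclass v = {vsc c v | c. c \<noteq> 0}"

definition points :: "'a::field vec3 set set" where
  "points = {pclass v | v. v \<noteq> (0, 0, 0)}"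

definition pline :: "'a::field vec3 \<Rightarrow> 'a vec3 set set" where
  "pline w = {P \<in> points. \<forall>(x, y, z) \<in> P. fst w * x + fst (snd w) * y + snd (snd w) * z = 0}"

definition lines :: "'a::field vec3 set set set" where
  "lines = {pline w | w. w \<noteq> (0, 0, 0)}"

definition maximal_arc :: "'a::field vec3 set set \<Rightarrow> nat \<Rightarrow> bool" where
  "maximal_arc K d \<longleftrightarrow> K \<subseteq> points \<and> K \<noteq> {} \<and> K \<noteq> points \<and>
     (\<forall>L \<in> lines. card (K \<inter> L) = 0 \<or> card (K \<inter> L) = d)"

definition gtrace :: "nat \<Rightarrow> 'a::field \<Rightarrow> 'a" where
  "gtrace h x = (\<Sum>i<h. x ^ (2 ^ i))"

definition conic :: "'a::field \<Rightarrow> 'a \<Rightarrow> 'a \<Rightarrow> 'a vec3 set set" where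
  "conic \<alpha> \<beta> l = {P \<in> points. \<forall>(x, y, z) \<in> P. \<alpha> * x^2 + x * y + \<beta> * y^2 + l * z^2 = 0}"

fun oplus :: "'a::field vec3 \<Rightarrow> 'a vec3 \<Rightarrow> 'a vec3" where
  "oplus (\<alpha>, \<beta>, l) (\<alpha>', \<beta>', l') =
     ((\<alpha> * l + \<alpha>' * l') / (l + l'), (\<beta> * l + \<beta>' * l') / (l + l'), l + l')"

(* a set of conics F_{alpha,beta,lambda}, given by parameter triples, indexed by distinct lambda,
   closed under oplus of distinct members *)
definition mathon_family :: "nat \<Rightarrow> 'a::field vec3 set \<Rightarrow> bool" where
  "mathon_family h C \<longleftrightarrow> finite C \<and>
     (\<forall>(\<alpha>, \<beta>, l) \<in> C. gtrace h (\<alpha> * \<beta>) = 1 \<and> l \<noteq> 0) \<and>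
     inj_on (\<lambda>c. snd (snd c)) C \<and>
     (\<forall>c \<in> C. \<forall>c' \<in> C. c \<noteq> c' \<longrightarrow> oplus c c' \<in> C)"

definition mathon_set :: "'a::field vec3 set \<Rightarrow> 'a vec3 set set" where
  "mathon_set C = insert (pclass (0, 0, 1)) (\<Union>c \<in> C. conic (fst c) (fst (snd c)) (snd (snd c)))"

definition field_aut :: "('a::field \<Rightarrow> 'a) \<Rightarrow> bool" where
  "field_aut \<sigma> \<longleftrightarrow> bij \<sigma> \<and> (\<forall>x y. \<sigma> (x + y) = \<sigma> x + \<sigma> y \<and> \<sigma> (x * y) = \<sigma> x * \<sigma> y)"

definition semilinear :: "('a::field vec3 \<Rightarrow> 'a vec3) \<Rightarrow> bool" where
  "semilinear g \<longleftrightarrow> bij g \<and> (\<exists>\<sigma>. field_aut \<sigma> \<and>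
     (\<forall>u v. g (vadd u v) = vadd (g u) (g v)) \<and> (\<forall>c u. g (vsc c u) = vsc (\<sigma> c) (g u)))"

definition cimg :: "('a::field vec3 \<Rightarrow> 'a vec3) \<Rightarrow> 'a vec3 set set \<Rightarrow> 'a vec3 set set" where
  "cimg g K = (\<lambda>P. g ` P) ` K"

definition mathon_type :: "nat \<Rightarrow> 'a::field vec3 set set \<Rightarrow> bool" where
  "mathon_type h K \<longleftrightarrow> (\<exists>C g. mathon_family h C \<and> semilinear g \<and> K = cimg g (mathon_set C))"

definition denniston_type :: "nat \<Rightarrow> 'a::field vec3 set set \<Rightarrow> bool" where
  "denniston_type h K \<longleftrightarrow> (\<exists>C g \<alpha>. gtrace h \<alpha> = 1 \<and> mathon_family h C \<and>
      (\<forall>c \<in> C. \<exists>l. c = (\<alpha>, 1, l)) \<and> semilinear g \<and> K = cimg g (mathon_set C))"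

definition proper_mathon_type :: "nat \<Rightarrow> 'a::field vec3 set set \<Rightarrow> bool" where
  "proper_mathon_type h K \<longleftrightarrow> mathon_type h K \<and> \<not> denniston_type h K"

definition isomorphic_arcs :: "'a::field vec3 set set \<Rightarrow> 'a vec3 set set \<Rightarrow> bool" where
  "isomorphic_arcs K K' \<longleftrightarrow> (\<exists>g. semilinear g \<and> cimg g K = K')"

(* stabilizer of K in PGammaL(3,q), as a group of permutations of the points *)
definition aut_group :: "'a::field vec3 set set \<Rightarrow> ('a vec3 set \<Rightarrow> 'a vec3 set) set" where
  "aut_group K = {(\<lambda>P. if P \<in> points then g ` P else undefined) | g. semilinear g \<and> cimg g K = K}"

end

(* An arc is a family of seven conics indexed by the nonzero elements of an additive subgroup L of
   order 8, given by cubic polynomials alpha(l) = p0 + p1 l + p2 l^3 and beta(l) = r0 + r1 l + r2 l^3.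
   Shifting z by a linear form in x, y removes p1 and r1.  The trace condition then says that
   p0 x^2 + x y + r0 y^2 is anisotropic and that Tr(c l^3) is additive on L, where c is the value of
   this form at (sqrt r2, sqrt p2); the arc is of Denniston type iff c = 0.  For c ~= 0 a linear change
   of x, y followed by scaling l by the cube root of c yields the normal form alpha(l) = 1 + l^3,
   beta(l) = 1, with L totally isotropic for the alternating form Tr(x^2 y + x y^2).

   A conic inside an arc meets one of its seven conics in at least five points, hence equals it.  So an
   isomorphism between normal forms permutes conics, and comparing coefficients shows that it is
   (x, y, z) |-> (s x, s y + e s x, s z) with s a power of the Frobenius map and e in {0, 1}.  The
   classes are therefore the Frobenius orbits of totally isotropic subgroups L, and the automorphism
   group has order twice the order of the stabilizer of L.  The radical of the form is {0, 1}, so there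
   are 315 + 8 * 135 = 1395 such L.  At most two of them are Frobenius invariant and all other orbits
   have length 7, so 1395 = 2 + 7 * 199. *)

theory Submission
  imports Defs "HOL-Computational_Algebra.Polynomial"
begin



section \<open>The field with 128 elements\<close>

text \<open>Three arithmetic facts make q = 2^7 tractable. As 7 is prime, a nontrivial power of the
  Frobenius map generates all its powers, so orbits have length 1 or 7. As 127 is prime, every field
  element other than 0 and 1 generates the multiplicative group. As 3 is prime to 127, cube roots
  exist and are unique, so the normal form exists and leaves no scaling free. The trace of alpha(l)
  beta(l) contains a term of degree six in l. It is the square of a cubic term and has the same
  trace as that term; this is how a value of the quadratic form appears in front of l^3. A closed
  family may have various sizes, so that an arc of degree 8 consists of seven conics is itself
  derived, by counting on the line x = 0. The numbers 315 and 135 count the totally isotropic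
  subspaces of dimension 2 and 3 in the six-dimensional symplectic space modulo {0, 1}. The formal
  count runs over ordered bases instead, which asks only for the sizes of intersections of
  hyperplanes.\<close>

locale gf128 =
  fixes ty :: "'a::{field,finite} itself"
  assumes card_field: "card (UNIV :: 'a set) = 2 ^ 7"
begin

text \<open>Translation by 1 permutes the field, so comparing the sums over all elements gives 128 *
  1 = 0, and 128 is a power of 2.\<close>

lemma two_eq_0 [simp]: "(2::'a) = 0"
proof -
  have "(\<Sum>x\<in>UNIV. x + 1 :: 'a) = (\<Sum>x\<in>UNIV. x)"
    by (rule sum.reindex_bij_witness[where i="\<lambda>x. x - 1" and j="\<lambda>x. x + 1"]) auto
  then have "of_nat (2 ^ 7) = (0::'a)"
    by (simp add: sum.distrib card_field del: of_nat_power)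
  then have "(2::'a) ^ 7 = 0" by simp
  then show ?thesis by (metis power_eq_0_iff)
qed

lemma add_self [simp]: "(x::'a) + x = 0"
  by (metis mult_2 mult_zero_left two_eq_0)

lemma add_self_left [simp]: "(x::'a) + (x + y) = y"
  by (simp flip: add.assoc)

lemma uminus_eq [simp]: "- (x::'a) = x"
  by (metis add_self minus_unique)

lemma diff_eq [simp]: "(x::'a) - y = x + y"
  by (metis uminus_eq diff_conv_add_uminus)

lemma numeral_Bit0_eq [simp]: "(numeral (Num.Bit0 n) :: 'a) = 0"
  by (simp add: numeral_Bit0)

lemma numeral_Bit1_eq [simp]: "(numeral (Num.Bit1 n) :: 'a) = 1"
  by (simp add: numeral_Bit1)

text \<open>As a simp rule it moves the last summand of a vanishing sum to the other side; proofs
  that need the sum intact delete it.\<close>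

lemma add_eq_0_iff_eq [simp]: "(x::'a) + y = 0 \<longleftrightarrow> x = y"
  by (metis uminus_eq add_eq_0_iff)

lemma add_eq_iff: "(x::'a) + y = z \<longleftrightarrow> x = y + z"
  by (metis add.commute add_self_left)

lemma power_127: assumes "(x::'a) \<noteq> 0" shows "x ^ 127 = 1"
proof -
  have "(\<Prod>y\<in>UNIV-{0}. x * y) = (\<Prod>y\<in>UNIV-{0}. y)"
    by (rule prod.reindex_bij_witness[where i="\<lambda>y. y / x" and j="\<lambda>y. x * y"])
      (use assms in auto)
  moreover have "card (UNIV - {0::'a}) = 127"
    by (simp add: card_Diff_subset card_field)
  ultimately show ?thesis
    by (simp add: prod.distrib)
qed

lemma power_128 [simp]: "(x::'a) ^ 128 = x"
proof (cases "x = 0")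
  case False
  then have "x * x ^ 127 = x" using power_127 by simp
  then show ?thesis by (simp flip: power_Suc)
qed simp

lemma power2_add [simp]: "((x::'a) + y) ^ 2 = x ^ 2 + y ^ 2"
  by (simp add: power2_sum)

lemma power_2pow_add: "((x::'a) + y) ^ (2 ^ n) = x ^ (2 ^ n) + y ^ (2 ^ n)"
proof (induction n)
  case (Suc n)
  have "z ^ (2 ^ Suc n) = (z ^ 2 ^ n) ^ 2" for z :: 'a
    by (simp add: power_mult mult.commute flip: power_mult)
  then show ?case using Suc by simp
qed simp

lemma power2_eq_iff_char2 [simp]: "(x::'a) ^ 2 = y ^ 2 \<longleftrightarrow> x = y"
  by (simp add: power2_eq_iff)

definition sq_root :: "'a \<Rightarrow> 'a" where "sq_root x = x ^ 64"

lemma sq_root_power2 [simp]: "sq_root x ^ 2 = x" "sq_root (x ^ 2) = x"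
  by (simp_all add: sq_root_def flip: power_mult)

text \<open>3 * 85 = 255 = 127 + 128, so the power 85 inverts cubing. This later forces the scaling
  in an isomorphism of normal forms to be trivial.\<close>

lemma cube_eq_iff: "(x::'a) ^ 3 = y ^ 3 \<longleftrightarrow> x = y"
proof -
  have "(z ^ 3) ^ 85 = z" for z :: 'a
  proof -
    have "(z ^ 3) ^ 85 = z ^ 127 * z ^ 128"
      by (simp del: power_128 flip: power_mult power_add)
    then show ?thesis by (cases "z = 0") (auto simp: power_127)
  qed
  then show ?thesis by metis
qed

lemma cube_root_exists: "\<exists>y::'a. y ^ 3 = x"
proof
  have "(x ^ 85) ^ 3 = x ^ 127 * x ^ 128"
    by (simp del: power_128 flip: power_mult power_add)
  then show "(x ^ 85) ^ 3 = x" by (cases "x = 0") (auto simp: power_127)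
qed

text \<open>The order of x divides both n and the prime 127; a Bezout combination of the two
  exponents yields x itself.\<close>

lemma power_eq_1_less_127:
  assumes "(x::'a) ^ n = 1" "0 < n" "n < 127" shows "x = 1"
proof -
  have "prime (127::nat)" by code_simp
  then have "coprime n 127"
    using assms by (metis coprime_commute prime_imp_coprime nat_dvd_not_less)
  then obtain a b where ab: "a * n = b * 127 + 1"
    using bezout_nat[of n 127] assms(2) by (auto simp: mult.commute)
  have "x \<noteq> 0" using assms by (metis power_0_left zero_neq_one gr_implies_not0)
  have "1 = (x ^ n) ^ a" by (simp add: assms)
  also have "\<dots> = x ^ (b * 127 + 1)" by (simp add: ab mult.commute flip: power_mult)
  also have "\<dots> = (x ^ 127) ^ b * x" by (simp add: power_add power_mult mult.commute flip: power_mult)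
  finally show ?thesis using power_127[OF \<open>x \<noteq> 0\<close>] by simp
qed

text \<open>A nonzero fixed point satisfies x^(2^k - 1) = 1, and the exponent lies strictly between
  0 and 127.\<close>

lemma frob_fixed:
  assumes "(x::'a) ^ (2 ^ k) = x" "0 < k" "k < 7" shows "x = 0 \<or> x = 1"
proof (cases "x = 0")
  case False
  have lt: "(2::nat) ^ k < 2 ^ 7" using assms(3) by (intro power_strict_increasing) auto
  have gt: "(1::nat) < 2 ^ k" using assms(2) by (metis one_less_numeral_iff one_less_power semiring_norm(76))
  have "x ^ (2 ^ k - 1) * x = x"
    using assms(1) gt by (metis power_minus_mult less_trans zero_less_one)
  then have "x ^ (2 ^ k - 1) = 1" using False by simp
  then show ?thesis using power_eq_1_less_127[of x "2 ^ k - 1"] lt gt by auto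
qed simp

lemma generator:
  assumes "(x::'a) \<noteq> 0" "x \<noteq> 1" "y \<noteq> 0" shows "\<exists>n. y = x ^ n"
proof -
  have inj: "inj_on (\<lambda>n. x ^ n) {..<127}"
  proof (rule linorder_inj_onI)
    fix i j :: nat assume ij: "i < j" "i \<in> {..<127}" "j \<in> {..<127}"
    show "x ^ i \<noteq> x ^ j"
    proof
      assume "x ^ i = x ^ j"
      then have "x ^ i * 1 = x ^ i * x ^ (j - i)" using ij by (metis le_add_diff_inverse less_imp_le mult.right_neutral power_add)
      then have "x ^ (j - i) = 1" using assms(1) by simp
      then show False using power_eq_1_less_127[of x "j - i"] ij assms(2)
        by (metis lessThan_iff less_imp_diff_less zero_less_diff)
    qed
  qed auto
  have "(\<lambda>n. x ^ n) ` {..<127} = UNIV - {0}"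
    by (rule card_subset_eq) (use assms in \<open>auto simp: card_image[OF inj] card_Diff_subset card_field\<close>)
  then show ?thesis using assms(3) by blast
qed

section \<open>The absolute trace\<close>

abbreviation tr :: "'a \<Rightarrow> 'a" where "tr \<equiv> gtrace 7"

lemma tr_expand: "tr x = x + x ^ 2 + x ^ 4 + x ^ 8 + x ^ 16 + x ^ 32 + x ^ 64"
proof -
  have "{..<7::nat} = {0,1,2,3,4,5,6}" by auto
  then show ?thesis by (simp add: gtrace_def add.assoc)
qed

lemma tr_add: "tr (x + y) = tr x + tr y"
  by (simp add: gtrace_def power_2pow_add sum.distrib)

lemma tr_0 [simp]: "tr 0 = 0" by (simp add: tr_expand)
text \<open>The degree 7 is odd, so seven summands 1 leave 1. Hence GF(2) meets the trace-zero
  hyperplane only in 0.\<close>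

lemma tr_1 [simp]: "tr 1 = 1" by (simp add: tr_expand)

lemma tr_power2 [simp]: "tr (x ^ 2) = tr x"
  by (simp add: tr_expand add_ac flip: power_mult)

lemma tr_power2_mult: "tr (x ^ 2 * y ^ 2) = tr (x * y)"
  by (metis power_mult_distrib tr_power2)

lemma tr_values: "tr x = 0 \<or> tr x = 1"
proof -
  have "(tr x) ^ 2 = tr x"
    by (simp add: tr_expand add_ac flip: power_mult)
  then show ?thesis by (simp add: power2_eq_square)
qed

lemma tr_neq_0 [simp]: "tr x \<noteq> 0 \<longleftrightarrow> tr x = 1"
  using tr_values[of x] by auto

lemma card_additive_kernel:
  fixes f :: "'a \<Rightarrow> 'a"
  assumes "\<And>x y. f (x + y) = f x + f y" "\<And>x. f x = 0 \<or> f x = 1" "f a = 1"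
  shows "card {x. f x = 0} = 64" "card {x. f x = 1} = 64"
proof -
  have "bij_betw (\<lambda>x. x + a) {x. f x = 0} {x. f x = 1}"
    by (rule bij_betw_byWitness[where f'="\<lambda>x. x + a"])
      (auto simp: assms add.assoc)
  then have "card {x. f x = 0} = card {x. f x = 1}" by (rule bij_betw_same_card)
  moreover have "card {x. f x = 0} + card {x. f x = 1} = card (UNIV :: 'a set)"
    using assms(2) by (subst card_Un_disjoint[symmetric]) (auto intro!: arg_cong[where f=card])
  ultimately show "card {x. f x = 0} = 64" "card {x. f x = 1} = 64"
    by (simp_all add: card_field)
qed

lemma tr_nondegenerate: assumes "k \<noteq> 0" shows "\<exists>x. tr (k * x) = 1"
  by (rule exI[of _ "1 / k"]) (simp add: assms)

text \<open>The map w^2 + w preserves the trace-zero hyperplane and has kernel {0, 1}. Since 1 has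
  trace 1, the map is injective on that hyperplane and, by finiteness, onto it.\<close>

lemma artin_schreier: assumes "tr x = 0" shows "\<exists>w. w ^ 2 + w = x"
proof -
  let ?T = "{w. tr w = 0}"
  have "inj_on (\<lambda>w. w ^ 2 + w) ?T"
  proof (rule inj_onI)
    fix v w assume vw: "v \<in> ?T" "w \<in> ?T" "v ^ 2 + v = w ^ 2 + w"
    have "(v + w) * (v + w + 1) = (v ^ 2 + v) + (w ^ 2 + w)"
      by (simp add: algebra_simps power2_eq_square)
    then have "(v + w) * (v + w + 1) = 0" using vw(3) by simp
    then have "v = w \<or> v = w + 1"
      by (metis add.assoc add_eq_0_iff_eq mult_eq_0_iff)
    then show "v = w" using vw by (auto simp: tr_add)
  qed
  moreover have "(\<lambda>w. w ^ 2 + w) ` ?T \<subseteq> ?T" by (auto simp: tr_add)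
  ultimately have "(\<lambda>w. w ^ 2 + w) ` ?T = ?T" by (intro endo_inj_surj) auto
  then show ?thesis using assms by (metis (mono_tags, lifting) imageE mem_Collect_eq)
qed

end



section \<open>Isotropic subgroups and their Frobenius orbits\<close>

text \<open>A coincidence among the first seven iterates makes x a fixed point of some f^d with 0 <
  d < 7. As d is invertible modulo 7, x would then be fixed by f.\<close>

lemma orbit_card_7:
  assumes "(f ^^ 7) x = x" "f x \<noteq> x"
  shows "card (range (\<lambda>i. (f ^^ i) x)) = 7"
proof -
  have mod: "(f ^^ m) x = (f ^^ (m mod 7)) x" for m
    using funpow_mod_eq[OF assms(1)] by simp
  have "range (\<lambda>i. (f ^^ i) x) = (\<lambda>i. (f ^^ i) x) ` {..<7}"
    using mod by (auto intro: image_eqI[where x="m mod 7" for m])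
  moreover have "inj_on (\<lambda>i. (f ^^ i) x) {..<7}"
  proof (rule linorder_inj_onI)
    fix i j :: nat assume ij: "i < j" "i \<in> {..<7}" "j \<in> {..<7}"
    show "(f ^^ i) x \<noteq> (f ^^ j) x"
    proof
      assume eq: "(f ^^ i) x = (f ^^ j) x"
      define d where "d = j - i"
      \<comment> \<open>Applying f another 7 - i times brings the left-hand iterate back to x; the
        other exponent is then d modulo 7.\<close>
      have "(f ^^ (7 - i + i)) x = (f ^^ (7 - i + j)) x" by (simp add: funpow_add eq)
      then have "x = (f ^^ (7 - i + j)) x" using ij assms(1) by simp
      moreover have "(7 - i + j) mod 7 = d" unfolding d_def using ij by (auto simp: mod_if)
      ultimately have d: "(f ^^ d) x = x" by (metis mod)
      then have dm: "(f ^^ (m * d)) x = x" for m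
        by (induction m) (simp_all add: funpow_add)
      have "d \<in> {1,2,3,4,5,6}" unfolding d_def using ij by auto
      then have "\<exists>m. (m * d) mod 7 = 1"
        by (elim insertE) (auto intro: exI[of _ 1] exI[of _ 2] exI[of _ 3] exI[of _ 4] exI[of _ 5] exI[of _ 6])
      then obtain m where "(m * d) mod 7 = 1" by blast
      then show False using dm[of m] mod[of "m * d"] assms(2) by simp
    qed
  qed auto
  ultimately show ?thesis by (simp add: card_image)
qed

lemma period_7_orbit:
  assumes per: "(f ^^ 7) x = x" and y: "y \<in> range (\<lambda>i. (f ^^ i) x)"
  shows "x \<in> range (\<lambda>i. (f ^^ i) y)" "range (\<lambda>i. (f ^^ i) y) = range (\<lambda>i. (f ^^ i) x)"
proof -
  have sub: "range (\<lambda>i. (f ^^ i) v) \<subseteq> range (\<lambda>i. (f ^^ i) u)" if v: "v \<in> range (\<lambda>i. (f ^^ i) u)" for u v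
  proof -
    obtain i where "v = (f ^^ i) u" using v by blast
    then show ?thesis by (auto simp flip: funpow_add[THEN fun_cong, unfolded comp_apply])
  qed
  obtain i where i: "y = (f ^^ i) x" using y by blast
  \<comment> \<open>On points of period 7 the iterate 6 * i undoes the iterate i.\<close>
  have "(f ^^ (6 * i)) y = (f ^^ (7 * i)) x"
    unfolding i by (simp flip: funpow_add[THEN fun_cong, unfolded comp_apply])
  also have "\<dots> = x" using funpow_mod_eq[OF per, of "7 * i"] by simp
  finally show x: "x \<in> range (\<lambda>i. (f ^^ i) y)" by (metis rangeI)
  show "range (\<lambda>i. (f ^^ i) y) = range (\<lambda>i. (f ^^ i) x)" using sub[OF x] sub[OF y] by blast
qed

text \<open>Periodicity makes lying in the orbit of a point a symmetric relation, so the orbits of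
  the moved points partition them into blocks of size 7, while fixed points have singleton
  orbits.\<close>

lemma card_orbits_7:
  assumes fin: "finite Z" and closed: "f ` Z \<subseteq> Z" and per: "\<And>x. x \<in> Z \<Longrightarrow> (f ^^ 7) x = x"
  defines "orb \<equiv> \<lambda>x. range (\<lambda>i. (f ^^ i) x)"
  shows "card Z = card {x \<in> Z. f x = x} + 7 * card (orb ` {x \<in> Z. f x \<noteq> x})"
    and "card (orb ` {x \<in> Z. f x = x}) = card {x \<in> Z. f x = x}"
    and "orb ` {x \<in> Z. f x = x} \<inter> orb ` {x \<in> Z. f x \<noteq> x} = {}"
proof -
  let ?N = "{x \<in> Z. f x \<noteq> x}" and ?F = "{x \<in> Z. f x = x}"
  have pow_closed: "(f ^^ i) x \<in> Z" if "x \<in> Z" for x i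
    using that closed by (induction i) auto
  have sym: "x \<in> orb y" and orb_eq: "orb y = orb x" if "y \<in> orb x" "x \<in> Z" for x y
    using period_7_orbit[OF per] that unfolding orb_def by blast+
  have self: "x \<in> orb x" for x by (auto simp: orb_def intro: range_eqI[of _ _ 0])
  have inv: "y \<in> ?N" if "x \<in> ?N" "y \<in> orb x" for x y
  proof -
    have "y \<in> Z" using that pow_closed by (auto simp: orb_def)
    moreover have "f y \<noteq> y"
    proof
      assume fy: "f y = y"
      have "(f ^^ i) y = y" for i by (induction i) (auto simp: fy)
      then have "x = y" using sym[of y x] that by (auto simp: orb_def)
      then show False using fy that by simp
    qed
    ultimately show ?thesis by simp
  qed
  have U: "?N = \<Union> (orb ` ?N)" using inv self by blast
  have "card (\<Union> (orb ` ?N)) = (\<Sum>A\<in>orb ` ?N. card A)"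
  proof (rule card_Union_disjoint)
    show "pairwise disjnt (orb ` ?N)"
    proof (rule pairwiseI)
      fix A A' assume A: "A \<in> orb ` ?N" "A' \<in> orb ` ?N" "A \<noteq> A'"
      show "disjnt A A'"
      proof (rule ccontr)
        assume "\<not> disjnt A A'"
        then obtain y where "y \<in> A" "y \<in> A'" by (auto simp: disjnt_def)
        then have "A = orb y" "A' = orb y" using A orb_eq by auto
        then show False using A(3) by simp
      qed
    qed
    show "finite A" if "A \<in> orb ` ?N" for A
      using that fin U by (metis (no_types, lifting) Union_upper finite_subset mem_Collect_eq rev_finite_subset subsetI)
  qed
  also have "\<dots> = (\<Sum>A\<in>orb ` ?N. 7)"
    using orbit_card_7[OF per] by (intro sum.cong) (auto simp: orb_def)
  finally have "card ?N = 7 * card (orb ` ?N)" using U by simp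
  moreover have "card Z = card ?F + card ?N"
    using fin by (subst card_Un_disjoint[symmetric]) (auto intro!: arg_cong[where f=card])
  ultimately show "card Z = card ?F + 7 * card (orb ` ?N)" by simp
  have fx: "(f ^^ i) x = x" if "x \<in> ?F" for x i using that by (induction i) auto
  have "orb x = {x}" if "x \<in> ?F" for x using fx[OF that] by (auto simp: orb_def)
  then have "inj_on orb ?F" by (metis (no_types, lifting) inj_onI singleton_inject)
  then show "card (orb ` ?F) = card ?F" by (rule card_image)
  show "orb ` ?F \<inter> orb ` ?N = {}"
    using inv self \<open>\<And>x. x \<in> ?F \<Longrightarrow> orb x = {x}\<close> by (smt (verit) disjoint_iff imageE mem_Collect_eq)
qed

context gf128
begin

text \<open>The polarisation of the quadratic form \<open>Tr(x\<^sup>3)\<close> over GF(2).\<close>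

definition polar :: "'a \<Rightarrow> 'a \<Rightarrow> 'a" where
  "polar x y = tr (x ^ 2 * y + x * y ^ 2)"

lemma polar_add: "polar (x + y) z = polar x z + polar y z" "polar z (x + y) = polar z x + polar z y"
  by (simp_all add: polar_def algebra_simps flip: tr_add)

lemma polar_commute: "polar x y = polar y x"
  by (simp add: polar_def algebra_simps)

lemma polar_0 [simp]: "polar 0 x = 0" "polar x 0 = 0" "polar x x = 0" "polar 1 x = 0" "polar x 1 = 0"
  by (simp_all add: polar_def tr_add power2_eq_square[of x] mult.assoc)
    (metis add_self tr_power2 power2_eq_square)+

lemma polar_values: "polar x y = 0 \<or> polar x y = 1"
  by (simp add: polar_def tr_values)

lemma tr_cube_add: "tr ((x + y) ^ 3) = tr (x ^ 3) + tr (y ^ 3) + polar x y"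
proof -
  have "(x + y) ^ 3 = x ^ 3 + y ^ 3 + (x ^ 2 * y + x * y ^ 2)"
    by (simp add: power3_eq_cube power2_eq_square algebra_simps)
  then show ?thesis by (simp add: tr_add polar_def)
qed

text \<open>The adjoint of squaring under the trace form is the square root x^64, so
  \<open>polar x\<close> is the trace functional with coefficient x^2 + x^64. This coefficient
  vanishes iff x^4 = x, and 2 is prime to the degree 7.\<close>

lemma polar_nondegenerate:
  assumes "x \<noteq> 0" "x \<noteq> 1" shows "\<exists>y. polar x y = 1"
proof -
  have "x ^ 2 + x ^ 64 \<noteq> 0"
  proof
    assume "x ^ 2 + x ^ 64 = 0"
    then have "(x ^ 2) ^ 2 = (x ^ 64) ^ 2" by simp
    then have "x ^ (2 ^ 2) = x" by (simp flip: power_mult)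
    then show False using frob_fixed[of x 2] assms by simp
  qed
  moreover have "polar x y = tr ((x ^ 2 + x ^ 64) * y)" for y
  proof -
    have "tr (x * y ^ 2) = tr ((x ^ 64) ^ 2 * y ^ 2)" by (simp flip: power_mult)
    also have "\<dots> = tr (x ^ 64 * y)" by (rule tr_power2_mult)
    finally show ?thesis by (simp add: polar_def tr_add distrib_right)
  qed
  ultimately show ?thesis using tr_nondegenerate by metis
qed

lemma card_perp: assumes "x \<noteq> 0" "x \<noteq> 1" shows "card {y. polar x y = 0} = 64"
  using polar_nondegenerate[OF assms] card_additive_kernel(1)[of "polar x"]
  by (auto simp: polar_add polar_values)

text \<open>Modulo the radical {0, 1} the elements x and y are independent, so x, y and x + y each
  have 64 orthogonal elements. Adding the three counts gives 192 = 128 + 2 n, where n is the number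
  of common zeros.\<close>

lemma card_perp2:
  assumes "x \<noteq> 0" "x \<noteq> 1" "y \<noteq> 0" "y \<noteq> 1" "x \<noteq> y" "x \<noteq> y + 1"
  shows "card {z. polar x z = 0 \<and> polar y z = 0} = 32"
proof -
  define n where "n i j = card {z. polar x z = i \<and> polar y z = j}" for i j
  \<comment> \<open>Any set described by the two values of the form is a union of the four cells
    counted by \<open>n i j\<close>.\<close>
  have split: "card {z. P z} = n 0 0 * of_bool (Q 0 0) + n 0 1 * of_bool (Q 0 1) + n 1 0 * of_bool (Q 1 0) + n 1 1 * of_bool (Q 1 1)"
    if "\<And>z. P z \<longleftrightarrow> Q (polar x z) (polar y z)" for P and Q
  proof -
    have "card {z. P z} = (\<Sum>z\<in>UNIV. of_bool (Q (polar x z) (polar y z)))"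
      by (simp add: that sum_of_bool_eq)
    also have "\<dots> = (\<Sum>z\<in>UNIV. of_bool (polar x z = 0 \<and> polar y z = 0) * of_bool (Q 0 0)
      + of_bool (polar x z = 0 \<and> polar y z = 1) * of_bool (Q 0 1)
      + of_bool (polar x z = 1 \<and> polar y z = 0) * of_bool (Q 1 0)
      + of_bool (polar x z = 1 \<and> polar y z = 1) * of_bool (Q 1 1))"
    proof (rule sum.cong[OF refl])
      fix z
      show "of_bool (Q (polar x z) (polar y z)) = (of_bool (polar x z = 0 \<and> polar y z = 0) * of_bool (Q 0 0)
        + of_bool (polar x z = 0 \<and> polar y z = 1) * of_bool (Q 0 1)
        + of_bool (polar x z = 1 \<and> polar y z = 0) * of_bool (Q 1 0)
        + of_bool (polar x z = 1 \<and> polar y z = 1) * of_bool (Q 1 1) :: nat)"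
        using polar_values[of x z] polar_values[of y z] by auto
    qed
    finally show ?thesis
      by (simp add: n_def sum.distrib flip: sum_distrib_right)
  qed
  have "card (UNIV :: 'a set) = n 0 0 + n 0 1 + n 1 0 + n 1 1"
    using split[of "\<lambda>_. True" "\<lambda>_ _. True"] by simp
  moreover have "card {z. polar x z = 0} = n 0 0 + n 0 1"
    using split[of "\<lambda>z. polar x z = 0" "\<lambda>i j. i = 0"] by simp
  moreover have "card {z. polar y z = 0} = n 0 0 + n 1 0"
    using split[of "\<lambda>z. polar y z = 0" "\<lambda>i j. j = 0"] by simp
  moreover have "card {z. polar (x + y) z = 0} = n 0 0 + n 1 1"
    using split[of "\<lambda>z. polar (x + y) z = 0" "\<lambda>i j. i = j"] by (simp add: polar_add)
  moreover have "x + y \<noteq> 0" "x + y \<noteq> 1" using assms by (auto simp: add_eq_iff add_ac)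
  ultimately have "n 0 0 = 32" using assms by (simp add: card_field card_perp)
  then show ?thesis by (simp add: n_def)
qed

section \<open>Counting the totally isotropic subgroups of order 8\<close>

definition subgroup8 :: "'a set \<Rightarrow> bool" where
  "subgroup8 L \<longleftrightarrow> 0 \<in> L \<and> (\<forall>x\<in>L. \<forall>y\<in>L. x + y \<in> L) \<and> card L = 8"

definition isotropic :: "'a set set" where
  "isotropic = {L. subgroup8 L \<and> (\<forall>x\<in>L. \<forall>y\<in>L. polar x y = 0)}"

definition span3 :: "'a \<Rightarrow> 'a \<Rightarrow> 'a \<Rightarrow> 'a set" where
  "span3 a b c = {0, a, b, a + b, c, a + c, b + c, a + b + c}"

lemma subgroup8_span3:
  assumes "a \<noteq> 0" "b \<notin> {0, a}" "c \<notin> {0, a, b, a + b}"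
  shows "subgroup8 (span3 a b c)"
proof -
  have "card (span3 a b c) = 8"
    using assms by (simp add: span3_def card_insert_if add_eq_iff add_ac) (auto simp: add_ac)
  moreover have "x + y \<in> span3 a b c" if "x \<in> span3 a b c" "y \<in> span3 a b c" for x y
    using that unfolding span3_def by (elim insertE emptyE; simp add: add_ac)
  ultimately show ?thesis unfolding subgroup8_def by (auto simp: span3_def)
qed

lemma subgroup8_eq_span3:
  assumes "subgroup8 L" "a \<in> L" "b \<in> L" "c \<in> L" "a \<noteq> 0" "b \<notin> {0, a}" "c \<notin> {0, a, b, a + b}"
  shows "L = span3 a b c"
proof -
  have "span3 a b c \<subseteq> L" using assms(1-4) by (auto simp: subgroup8_def span3_def)
  moreover have "card (span3 a b c) = card L"
    using subgroup8_span3[OF assms(5-7)] assms(1) by (simp add: subgroup8_def)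
  ultimately show ?thesis by (metis card_subset_eq finite)
qed

lemma subgroup8_basis:
  assumes "subgroup8 L"
  obtains a b c where "L = span3 a b c" "a \<noteq> 0" "b \<notin> {0, a}" "c \<notin> {0, a, b, a + b}"
proof -
  have ex: "\<exists>x\<in>L. x \<notin> S" if "card S < 8" for S
    using assms that unfolding subgroup8_def by (metis card_mono finite leD subsetI)
  obtain a where a: "a \<in> L" "a \<noteq> 0" using ex[of "{0}"] by auto
  obtain b where b: "b \<in> L" "b \<notin> {0, a}"
    using ex[of "{0, a}"] card_length[of "[0, a]"] by auto
  obtain c where c: "c \<in> L" "c \<notin> {0, a, b, a + b}"
    using ex[of "{0, a, b, a + b}"] card_length[of "[0, a, b, a + b]"] by auto
  show ?thesis using that subgroup8_eq_span3[OF assms] a b c by metis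
qed

text \<open>Double counting of ordered bases. A subgroup has 7 * 6 * 4 = 168 of them. In all there
  are 126 * 1800 with a different from 1 and 126 * 60 = 7560 with a = 1, together 234360 = 1395 *
  168. The inner number 1800 is 2 * 60 + 60 * 28, according to whether b lies in {1, a + 1}.\<close>

lemma card_isotropic: "card isotropic = 1395"
proof -
  define bases where "bases L = (SIGMA a:L-{0}. SIGMA b:L-{0,a}. L-{0,a,b,a+b})" for L :: "'a set"
  define T where "T = (SIGMA a:UNIV-{0::'a}. SIGMA b:{b. polar a b = 0}-{0,a}.
     {c. polar a c = 0 \<and> polar b c = 0}-{0,a,b,a+b})"
  have "card (bases L) = 168" if "L \<in> isotropic" for L
  proof -
    have L: "0 \<in> L" "\<And>x y. x \<in> L \<Longrightarrow> y \<in> L \<Longrightarrow> x + y \<in> L" "card L = 8"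
      using that by (auto simp: isotropic_def subgroup8_def)
    have "card (L-{0,a,b,a+b}) = 4" if "a \<in> L-{0}" "b \<in> L-{0,a}" for a b
      using that L by (subst card_Diff_subset) (auto simp: card_insert_if add_eq_iff)
    then have "card (SIGMA b:L-{0,a}. L-{0,a,b,a+b}) = 6 * 4" if "a \<in> L-{0}" for a
      using that L by (simp add: card_Diff_subset)
    then show ?thesis
      using L by (simp add: bases_def card_Diff_subset)
  qed
  moreover have "T = (\<Union>L\<in>isotropic. bases L)"
  proof (intro equalityI subsetI)
    fix t assume "t \<in> T"
    then obtain a b c where t: "t = (a, b, c)" "a \<noteq> 0" "b \<notin> {0, a}" "c \<notin> {0, a, b, a + b}"
      "polar a b = 0" "polar a c = 0" "polar b c = 0"
      by (auto simp: T_def)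
    have "polar b a = 0" "polar c a = 0" "polar c b = 0" using t polar_commute by metis+
    then have "polar x y = 0" if "x \<in> span3 a b c" "y \<in> span3 a b c" for x y
      using that t(5-7) unfolding span3_def by (elim insertE emptyE; simp add: polar_add)
    then have "span3 a b c \<in> isotropic"
      using subgroup8_span3[OF t(2-4)] by (simp add: isotropic_def)
    moreover have "t \<in> bases (span3 a b c)"
      using t by (auto simp: bases_def span3_def)
    ultimately show "t \<in> (\<Union>L\<in>isotropic. bases L)" by blast
  next
    fix t assume "t \<in> (\<Union>L\<in>isotropic. bases L)"
    then show "t \<in> T" by (auto simp: bases_def T_def isotropic_def)
  qed
  moreover have "bases L \<inter> bases L' = {}" if "L \<in> isotropic" "L' \<in> isotropic" "L \<noteq> L'" for L L'
  proof (rule ccontr)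
    assume "bases L \<inter> bases L' \<noteq> {}"
    then obtain a b c where "(a, b, c) \<in> bases L" "(a, b, c) \<in> bases L'" by auto
    then have "L = span3 a b c" "L' = span3 a b c"
      using that subgroup8_eq_span3[of L a b c] subgroup8_eq_span3[of L' a b c]
      by (auto simp: bases_def isotropic_def)
    then show False using that by simp
  qed
  ultimately have "card T = card isotropic * 168"
    by (simp add: card_UN_disjoint)
  moreover have "card T = 234360"
  proof -
    \<comment> \<open>The four-element group generated by a and b lies inside the 64 elements
      orthogonal to x, leaving 64 - 4.\<close>
    have c60: "card ({c. polar x c = 0} - {0, a, b, a + b}) = 60"
      if "x \<noteq> 0" "x \<noteq> 1" "a \<noteq> 0" "b \<noteq> 0" "a \<noteq> b" "polar x a = 0" "polar x b = 0" for x a b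
      using that by (subst card_Diff_subset) (auto simp: card_perp polar_add card_insert_if add_eq_iff)
    have "card (SIGMA b:{b. polar a b = 0}-{0,a}. {c. polar a c = 0 \<and> polar b c = 0}-{0,a,b,a+b}) = 1800"
      if a: "a \<noteq> 0" "a \<noteq> 1" for a
    proof -
      let ?C = "\<lambda>b. card ({c. polar a c = 0 \<and> polar b c = 0}-{0,a,b,a+b})"
      \<comment> \<open>These b agree with 0 or a modulo the radical and so impose no condition on c
        beyond orthogonality to a.\<close>
      have C60: "?C b = 60" if "b \<in> {1, a + 1}" for b
      proof -
        have "{c. polar a c = 0 \<and> polar b c = 0} = {c. polar a c = 0}"
          using that by (auto simp: polar_add)
        then show ?thesis using c60[of a a b] a that by (auto simp: polar_add add_eq_iff)
      qed
      have C28: "?C b = 28" if "b \<in> {b. polar a b = 0} - {0, a, 1, a + 1}" for b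
      proof -
        have "a \<noteq> b + 1" using that by auto
        then have "card {c. polar a c = 0 \<and> polar b c = 0} = 32"
          using that a by (intro card_perp2) auto
        then show ?thesis
          using that a polar_commute[of a b]
          by (subst card_Diff_subset) (auto simp: polar_add card_insert_if add_eq_iff add_ac)
      qed
      have "sum ?C ({b. polar a b = 0} - {0, a})
        = (\<Sum>b\<in>{1, a + 1}. 60) + (\<Sum>b\<in>{b. polar a b = 0} - {0, a, 1, a + 1}. 28)"
      proof -
        have "{b. polar a b = 0} - {0, a} = {1, a + 1} \<union> ({b. polar a b = 0} - {0, a, 1, a + 1})"
          using a by (auto simp: polar_add add_eq_iff)
        then have "sum ?C ({b. polar a b = 0} - {0, a}) = sum ?C ({1, a + 1} \<union> ({b. polar a b = 0} - {0, a, 1, a + 1}))"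
          by (rule arg_cong)
        also have "\<dots> = sum ?C {1, a + 1} + sum ?C ({b. polar a b = 0} - {0, a, 1, a + 1})"
          by (rule sum.union_disjoint) auto
        also have "\<dots> = (\<Sum>b\<in>{1, a + 1}. 60) + (\<Sum>b\<in>{b. polar a b = 0} - {0, a, 1, a + 1}. 28)"
          using C60 C28 by (intro arg_cong2[where f="(+)"] sum.cong refl)
        finally show ?thesis .
      qed
      moreover have "card {1, a + 1} = 2" using a by (simp add: card_insert_if add_eq_iff)
      moreover have "card ({b. polar a b = 0} - {0, a, 1, a + 1}) = 60"
        using a c60[of a a 1] by (simp add: insert_commute add.commute)
      ultimately show ?thesis
        by simp
    qed
    \<comment> \<open>For a = 1 orthogonality to a is no restriction: there are 126 choices of b and
      then 60 of c.\<close>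
    moreover have "card (SIGMA b:{b. polar 1 b = 0}-{0,1}. {c. polar 1 c = 0 \<and> polar b c = 0}-{0,1,b,1+b}) = 7560"
      using c60[of _ 1] by (simp add: card_Diff_subset card_field)
    moreover have "UNIV - {0::'a} = insert 1 (UNIV - {0, 1})" by auto
    ultimately show ?thesis
      unfolding T_def by (simp add: card_Diff_subset card_field)
  qed
  ultimately show ?thesis by simp
qed


section \<open>The Frobenius action on elements and subgroups\<close>

lemma funpow_power2: "((\<lambda>x. x ^ 2) ^^ i) x = x ^ (2 ^ i)" for x :: 'a
  by (induction i) (simp_all add: mult.commute flip: power_mult)

lemma funpow_image_power2: "((`) (\<lambda>x. x ^ 2) ^^ i) L = (\<lambda>x. x ^ (2 ^ i)) ` L" for L :: "'a set"
  by (induction i) (simp_all add: image_image mult.commute flip: power_mult)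

lemma frob_orbit_card:
  fixes x :: 'a
  assumes "x \<noteq> 0" "x \<noteq> 1" shows "card (range (\<lambda>i. x ^ (2 ^ i))) = 7"
proof -
  have "x ^ 2 \<noteq> x" using frob_fixed[of x 1] assms by auto
  then show ?thesis using orbit_card_7[of "\<lambda>x. x ^ 2" x] by (simp add: funpow_power2)
qed

lemma frob_mod: "x ^ (2 ^ i) = x ^ (2 ^ (i mod 7))" for x :: 'a
  using funpow_mod_eq[of 7 "\<lambda>x. x ^ 2" x i] by (simp add: funpow_power2)

text \<open>Apart from 0 these are the roots of x^7 + x + 1 and of x^7 + x^3 + 1. The bounds turn an
  inclusion of a subgroup of order 8 into an equality.\<close>

lemma card_roots_le_8:
  "card {x :: 'a. x ^ 8 = x ^ 2 + x} \<le> 8" "card {x :: 'a. x ^ 8 = x ^ 4 + x} \<le> 8"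
proof -
  have "poly [:0,1,1,0,0,0,0,0,1:] x = x ^ 8 + (x ^ 2 + x)" for x :: 'a
    by (simp add: numeral_eq_Suc algebra_simps)
  then show "card {x :: 'a. x ^ 8 = x ^ 2 + x} \<le> 8"
    using card_poly_roots_bound[of "[:0,1,1,0,0,0,0,0,1::'a:]"] by simp
  have "poly [:0,1,0,0,1,0,0,0,1:] x = x ^ 8 + (x ^ 4 + x)" for x :: 'a
    by (simp add: numeral_eq_Suc algebra_simps)
  then show "card {x :: 'a. x ^ 8 = x ^ 4 + x} \<le> 8"
    using card_poly_roots_bound[of "[:0,1,0,0,1,0,0,0,1::'a:]"] by simp
qed

text \<open>Over GF(2), F^7 + 1 = (F + 1)(F^3 + F + 1)(F^3 + F^2 + 1), and the two sets are the
  kernels of the cubic factors at the Frobenius map. Concretely, the conjugates of an x in L other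
  than 0 and 1 fill L minus 0, so x^2 + x is one of the seven conjugates; each possibility is absurd
  or gives one of the two equations.\<close>

lemma frob_invariant_subgroup8:
  assumes "subgroup8 L" "(\<lambda>x. x ^ 2) ` L = L"
  shows "L = {x. x ^ 8 = x ^ 2 + x} \<or> L = {x. x ^ 8 = x ^ 4 + x}"
proof -
  have L: "0 \<in> L" "card L = 8" "\<And>x y. x \<in> L \<Longrightarrow> y \<in> L \<Longrightarrow> x + y \<in> L"
    using assms(1) by (auto simp: subgroup8_def)
  have "\<not> L \<subseteq> {0, 1}" using L(2) card_mono[of "{0,1::'a}" L] by auto
  then obtain x where x: "x \<in> L" "x \<noteq> 0" "x \<noteq> 1" by blast
  have pow: "x ^ (2 ^ i) \<in> L" for i
  proof (induction i)
    case (Suc i)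
    then have "(x ^ (2 ^ i)) ^ 2 \<in> L" using assms(2) by blast
    then show ?case by (simp add: mult.commute flip: power_mult)
  qed (use x in simp)
  have "range (\<lambda>i. x ^ (2 ^ i)) = L - {0}"
    using pow x(2) L(1,2) frob_orbit_card[OF x(2,3)]
    by (intro card_subset_eq) (auto simp: card_Diff_subset)
  then have range: "y \<in> L \<Longrightarrow> y \<noteq> 0 \<Longrightarrow> \<exists>i. y = x ^ (2 ^ i)" for y by blast
  have "x ^ 2 + x \<in> L" "x ^ 2 + x \<noteq> 0"
    using L(3) pow[of 0] pow[of 1] x by (auto simp: power2_eq_square)
  then obtain i where i: "x ^ (2 ^ i) = x ^ 2 + x" "i < 7"
    using range by (metis frob_mod mod_less_divisor zero_less_numeral)
  have dbl: "x ^ (2 * n) = a ^ 2" if "x ^ n = a" for n a using that by (simp add: power_mult mult.commute)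
  \<comment> \<open>Squaring this relation once gives x^8 = x, that is, a fixed point of the third
    Frobenius power.\<close>
  have no4: False if "x ^ 4 = x ^ 2 + x"
  proof -
    have "x ^ 8 = x ^ 4 + x ^ 2" using dbl[OF that] by (simp flip: power_mult)
    then have "x ^ (2 ^ 3) = x" using that by (simp add: add_ac)
    then show False using frob_fixed[of x 3] x by simp
  qed
  have all: "P y" if "P 0" "\<And>j. P (x ^ (2 ^ j))" "y \<in> L" for P y
    using range[OF that(3)] that(1,2) by (cases "y = 0") auto
  have "i \<in> {0,1,2,3,4,5,6}" using i(2) by auto
  then consider "x = x ^ 2 + x" | "x ^ 2 = x ^ 2 + x" | "x ^ 4 = x ^ 2 + x" | "x ^ 8 = x ^ 2 + x"
    | "x ^ 16 = x ^ 2 + x" | "x ^ 32 = x ^ 2 + x" | "x ^ 64 = x ^ 2 + x"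
    using i(1) by auto
  then show ?thesis
  proof cases
    case 4
    have "L \<subseteq> {x. x ^ 8 = x ^ 2 + x}"
    proof
      fix y assume "y \<in> L"
      then show "y \<in> {x. x ^ 8 = x ^ 2 + x}"
      proof (rule all[rotated 2])
        fix j
        have "(x ^ 8) ^ (2 ^ j) = (x ^ 2) ^ (2 ^ j) + x ^ (2 ^ j)" by (simp add: 4 power_2pow_add)
        then show "x ^ (2 ^ j) \<in> {x. x ^ 8 = x ^ 2 + x}" by (simp add: mult.commute flip: power_mult)
      qed simp
    qed
    then show ?thesis using card_roots_le_8(1) L(2) by (metis card_seteq finite)
  next
    case 5
    \<comment> \<open>Squaring is repeated until the exponent 128 is reached, where x^128 = x closes
      the circle.\<close>
    have "x ^ 32 = x ^ 4 + x ^ 2" using dbl[OF 5] by (simp flip: power_mult)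
    from dbl[OF this] have "x ^ 64 = x ^ 8 + x ^ 4" by (simp flip: power_mult)
    from dbl[OF this] have "x = x ^ 16 + x ^ 8" by (simp flip: power_mult)
    then have "x ^ 8 = x ^ 2" using 5 by (simp add: add_eq_iff add_ac)
    then have "(x ^ 4) ^ 2 = x ^ 2" by (simp flip: power_mult)
    then have "x ^ 4 = x" by (rule power2_eq_iff_char2[THEN iffD1])
    then have "x ^ (2 ^ 2) = x" by simp
    then show ?thesis using frob_fixed[of x 2] x by simp
  next
    case 6
    from dbl[OF 6] have "x ^ 64 = x ^ 4 + x ^ 2" by (simp flip: power_mult)
    from dbl[OF this] have x8: "x = x ^ 8 + x ^ 4" by (simp flip: power_mult)
    have "L \<subseteq> {x. x ^ 8 = x ^ 4 + x}"
    proof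
      fix y assume "y \<in> L"
      then show "y \<in> {x. x ^ 8 = x ^ 4 + x}"
      proof (rule all[rotated 2])
        fix j
        have "(x ^ 8) ^ (2 ^ j) = (x ^ 4 + x) ^ (2 ^ j)" using x8 by (metis add_eq_iff add.commute)
        then have "(x ^ 8) ^ (2 ^ j) = (x ^ 4) ^ (2 ^ j) + x ^ (2 ^ j)" by (simp add: power_2pow_add)
        then show "x ^ (2 ^ j) \<in> {x. x ^ 8 = x ^ 4 + x}" by (simp add: mult.commute flip: power_mult)
      qed simp
    qed
    then show ?thesis using card_roots_le_8(2) L(2) by (metis card_seteq finite)
  next
    case 7
    from dbl[OF 7] have "x = x ^ 4 + x ^ 2" by (simp flip: power_mult)
    then have "x ^ 4 = x ^ 2 + x" by (metis add_eq_iff add.commute)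
    then show ?thesis using no4 by simp
  qed (use x no4 in \<open>auto simp: add_eq_iff\<close>)
qed

section \<open>Field automorphisms are Frobenius powers\<close>

lemma field_aut_frob: "field_aut (\<lambda>x::'a. x ^ (2 ^ i))"
proof -
  have "inj (\<lambda>x::'a. x ^ (2 ^ i))"
  proof (rule injI)
    fix x y :: 'a assume "x ^ (2 ^ i) = y ^ (2 ^ i)"
    then have "(x ^ (2 ^ i)) ^ (2 ^ (6 * i)) = (y ^ (2 ^ i)) ^ (2 ^ (6 * i))" by simp
    then have "x ^ (2 ^ (7 * i)) = y ^ (2 ^ (7 * i))"
      by (simp flip: power_mult power_add)
    then show "x = y" using frob_mod[of x "7 * i"] frob_mod[of y "7 * i"] by simp
  qed
  then show ?thesis
    by (simp add: field_aut_def bij_def finite_UNIV_inj_surj power_2pow_add power_mult_distrib)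
qed

lemma field_aut_simps:
  assumes "field_aut (\<sigma> :: 'a \<Rightarrow> 'a)"
  shows "\<sigma> 0 = 0" "\<sigma> 1 = 1" "\<sigma> (x + y) = \<sigma> x + \<sigma> y" "\<sigma> (x * y) = \<sigma> x * \<sigma> y" "\<sigma> (x ^ n) = \<sigma> x ^ n"
    "\<sigma> x = \<sigma> y \<longleftrightarrow> x = y" "\<sigma> x = 0 \<longleftrightarrow> x = 0" "\<sigma> (x / y) = \<sigma> x / \<sigma> y"
proof -
  show a: "\<sigma> (x + y) = \<sigma> x + \<sigma> y" and m: "\<sigma> (x * y) = \<sigma> x * \<sigma> y" for x y
    using assms by (auto simp: field_aut_def)
  show i: "\<sigma> x = \<sigma> y \<longleftrightarrow> x = y" for x y
    using assms by (auto simp: field_aut_def bij_def inj_eq)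
  show z: "\<sigma> 0 = 0" using a[of 0 0] by simp
  then show z': "\<sigma> x = 0 \<longleftrightarrow> x = 0" for x using i[of x 0] by simp
  show o: "\<sigma> 1 = 1" using m[of 1 1] z'[of 1] by simp
  show "\<sigma> (x ^ n) = \<sigma> x ^ n" by (induction n) (simp_all add: o m)
  show "\<sigma> (x / y) = \<sigma> x / \<sigma> y"
  proof (cases "y = 0")
    case False
    then show ?thesis using m[of "x / y" y] z'[of y] by (simp add: field_simps)
  qed (simp add: z)
qed

lemma field_aut_sum:
  assumes "field_aut (\<sigma> :: 'a \<Rightarrow> 'a)" shows "\<sigma> (sum f S) = (\<Sum>x\<in>S. \<sigma> (f x))"
  using sum_comp_morphism[of \<sigma> f S] assms by (simp add: field_aut_simps comp_def)

text \<open>An automorphism permutes the roots of a polynomial over GF(2). If such a polynomial has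
  degree at most 7 and root x, the seven conjugates of x exhaust its roots, so x goes to a
  conjugate; and x generates the multiplicative group, so this image determines the
  automorphism.\<close>

lemma field_aut_iff: "field_aut (\<sigma> :: 'a \<Rightarrow> 'a) \<longleftrightarrow> (\<exists>i<7. \<sigma> = (\<lambda>x. x ^ (2 ^ i)))"
proof
  assume \<sigma>: "field_aut \<sigma>"
  have "\<not> UNIV \<subseteq> {0, 1::'a}" using card_field card_mono[of "{0,1::'a}" UNIV] by auto
  then obtain x :: 'a where x: "x \<noteq> 0" "x \<noteq> 1" by blast
  \<comment> \<open>Pigeonhole: the powers of x up to x^7 have 2^8 = 256 subset sums, but the field
    has 128 elements. Two equal sums give the polynomial p.\<close>
  have "\<not> inj_on (\<lambda>S. \<Sum>i\<in>S. x ^ i) (Pow {..7::nat})"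
  proof
    assume "inj_on (\<lambda>S. \<Sum>i\<in>S. x ^ i) (Pow {..7::nat})"
    then have "card (Pow {..7::nat}) \<le> card (UNIV :: 'a set)"
      by (rule card_inj_on_le) auto
    then show False by (simp add: card_Pow card_field)
  qed
  then obtain S S' where S: "S \<subseteq> {..7::nat}" "S' \<subseteq> {..7}" "S \<noteq> S'"
      "(\<Sum>i\<in>S. x ^ i) = (\<Sum>i\<in>S'. x ^ i)"
    by (auto simp: inj_on_def)
  define p where "p = (\<Sum>i\<in>S. monom (1::'a) i) - (\<Sum>i\<in>S'. monom 1 i)"
  have fin: "finite S" "finite S'" using S finite_subset by blast+
  have coeff: "coeff (\<Sum>i\<in>T. monom (1::'a) i) n = of_bool (n \<in> T)" if "finite T" for T n
    using that by (simp add: coeff_sum coeff_monom sum.delta)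
  have "p \<noteq> 0"
  proof
    assume "p = 0"
    then have "coeff (\<Sum>i\<in>S. monom (1::'a) i) n = coeff (\<Sum>i\<in>S'. monom 1 i) n" for n
      by (simp add: p_def)
    then have "n \<in> S \<longleftrightarrow> n \<in> S'" for n using coeff fin by (simp add: of_bool_eq_iff)
    then show False using S(3) by blast
  qed
  have deg: "degree p \<le> 7" unfolding p_def using S
    by (intro degree_diff_le degree_sum_le fin) (auto simp: degree_monom_eq)
  have root: "poly p (\<tau> x) = 0" if "field_aut \<tau>" for \<tau>
  proof -
    have "\<tau> (\<Sum>i\<in>S. x ^ i) = \<tau> (\<Sum>i\<in>S'. x ^ i)" by (simp only: S(4))
    then show ?thesis using that
      by (simp add: p_def poly_sum poly_monom field_aut_sum field_aut_simps)
  qed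
  have "range (\<lambda>i. x ^ (2 ^ i)) = {z. poly p z = 0}"
    using root[OF field_aut_frob] card_poly_roots_bound[OF \<open>p \<noteq> 0\<close>] deg frob_orbit_card[OF x]
    by (intro card_seteq) auto
  then obtain i where "\<sigma> x = x ^ (2 ^ i)" using root[OF \<sigma>] by blast
  then have ix: "\<sigma> x = x ^ (2 ^ (i mod 7))" by (metis frob_mod)
  have "\<sigma> y = y ^ (2 ^ (i mod 7))" for y
  proof (cases "y = 0")
    case False
    then obtain n where "y = x ^ n" using generator[OF x] by blast
    then show ?thesis using \<sigma> ix by (simp add: field_aut_simps mult.commute flip: power_mult)
  qed (use \<sigma> in \<open>simp add: field_aut_simps\<close>)
  then show "\<exists>i<7. \<sigma> = (\<lambda>x. x ^ (2 ^ i))"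
    by (intro exI[of _ "i mod 7"]) auto
qed (auto simp: field_aut_frob)

end



section \<open>Collineations\<close>

fun qform :: "'a::field vec3 \<Rightarrow> 'a vec3 \<Rightarrow> 'a" where
  "qform (\<alpha>, \<beta>, l) (x, y, z) = \<alpha> * x ^ 2 + x * y + \<beta> * y ^ 2 + l * z ^ 2"

fun vdot :: "'a::field vec3 \<Rightarrow> 'a vec3 \<Rightarrow> 'a" where
  "vdot (a, b, c) (x, y, z) = a * x + b * y + c * z"

lemma vsc_vsc [simp]: "vsc c (vsc d v) = vsc (c * d) v"
  by (cases v) (simp add: mult.assoc)

lemma vsc_1 [simp]: "vsc 1 v = v"
  by (cases v) simp

lemma vsc_eq_0_iff: "vsc c v = (0, 0, 0) \<longleftrightarrow> c = 0 \<or> v = (0, 0, 0)"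
  by (cases v) auto

lemma qform_vsc: "qform c (vsc k v) = k ^ 2 * qform c v"
  by (cases c; cases v) (simp add: algebra_simps power2_eq_square)

lemma vdot_vsc: "vdot w (vsc k v) = k * vdot w v"
  by (cases w; cases v) (simp add: algebra_simps)

lemma mem_pclass: "u \<in> pclass v \<longleftrightarrow> (\<exists>c. c \<noteq> 0 \<and> u = vsc c v)"
  by (auto simp: pclass_def)

lemma pclass_vsc: assumes "k \<noteq> 0" shows "pclass (vsc k v) = pclass v"
proof (intro set_eqI iffI)
  fix u assume "u \<in> pclass (vsc k v)"
  then show "u \<in> pclass v" using assms by (auto simp: mem_pclass intro: exI[of _ "_ * k"])
next
  fix u assume "u \<in> pclass v"
  then obtain c where "c \<noteq> 0" "u = vsc c v" by (auto simp: mem_pclass)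
  then show "u \<in> pclass (vsc k v)"
    using assms unfolding mem_pclass by (intro exI[of _ "c / k"]) simp
qed

lemma pclass_eq_iff: "pclass u = pclass v \<longleftrightarrow> (\<exists>k. k \<noteq> 0 \<and> u = vsc k v)"
proof
  assume "pclass u = pclass v"
  moreover have "u \<in> pclass u" unfolding mem_pclass by (rule exI[of _ 1]) simp
  ultimately show "\<exists>k. k \<noteq> 0 \<and> u = vsc k v" by (simp add: mem_pclass)
qed (auto simp: pclass_vsc)

lemma pclass_mem_points [simp]: "pclass v \<in> points \<longleftrightarrow> v \<noteq> (0, 0, 0)"
proof
  assume "pclass v \<in> points"
  then obtain u where u: "pclass u = pclass v" "u \<noteq> (0, 0, 0)" unfolding points_def by blast
  then obtain k where "u = vsc k v" unfolding pclass_eq_iff by blast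
  then show "v \<noteq> (0, 0, 0)" using u(2) by (simp only: vsc_eq_0_iff) simp
qed (auto simp only: points_def)

lemma pointsE:
  assumes "P \<in> points" obtains v where "P = pclass v" "v \<noteq> (0, 0, 0)"
  using assms by (auto simp: points_def)

lemma ball_pclass:
  assumes "\<And>k v. k \<noteq> 0 \<Longrightarrow> Q (vsc k v) \<longleftrightarrow> Q v"
  shows "(\<forall>u\<in>pclass v. Q u) \<longleftrightarrow> Q v"
proof
  have "v \<in> pclass v" unfolding mem_pclass by (rule exI[of _ 1]) simp
  then show "Q v" if "\<forall>u\<in>pclass v. Q u" using that by blast
  show "\<forall>u\<in>pclass v. Q u" if "Q v" 
  proof
    fix u assume "u \<in> pclass v"
    then obtain k where "k \<noteq> 0" "u = vsc k v" unfolding mem_pclass by blast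
    then show "Q u" using assms[of k v] that by simp
  qed
qed

lemma pclass_mem_conic [simp]:
  "pclass v \<in> conic \<alpha> \<beta> l \<longleftrightarrow> v \<noteq> (0, 0, 0) \<and> qform (\<alpha>, \<beta>, l) v = 0"
proof -
  have "(\<forall>u\<in>pclass v. qform (\<alpha>, \<beta>, l) u = 0) \<longleftrightarrow> qform (\<alpha>, \<beta>, l) v = 0"
    by (rule ball_pclass) (simp add: qform_vsc)
  moreover have "(case u of (x, y, z) \<Rightarrow> \<alpha> * x^2 + x * y + \<beta> * y^2 + l * z^2 = 0) \<longleftrightarrow> qform (\<alpha>, \<beta>, l) u = 0" for u
    by (cases u) simp
  ultimately show ?thesis by (simp add: conic_def)
qed

lemma pclass_mem_pline [simp]:
  "pclass v \<in> pline w \<longleftrightarrow> v \<noteq> (0, 0, 0) \<and> vdot w v = 0"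
proof -
  have "(\<forall>u\<in>pclass v. vdot w u = 0) \<longleftrightarrow> vdot w v = 0"
    by (rule ball_pclass) (simp add: vdot_vsc)
  moreover have "(case u of (x, y, z) \<Rightarrow> fst w * x + fst (snd w) * y + snd (snd w) * z = 0) \<longleftrightarrow> vdot w u = 0" for u
    by (cases u; cases w) simp
  ultimately show ?thesis by (simp add: pline_def)
qed

lemma conic_subset_points: "conic \<alpha> \<beta> l \<subseteq> points"
  by (auto simp: conic_def)

lemma pline_subset_points: "pline w \<subseteq> points"
  by (auto simp: pline_def)

lemma mathon_set_subset_points: "mathon_set C \<subseteq> points"
  using conic_subset_points by (auto simp: mathon_set_def)

lemma pclass_mem_mathon_set:
  "pclass v \<in> mathon_set C \<longleftrightarrow> pclass v = pclass (0, 0, 1) \<or> (v \<noteq> (0, 0, 0) \<and> (\<exists>c\<in>C. qform c v = 0))"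
  by (auto simp: mathon_set_def)

lemma points_set_eqI:
  assumes "A \<subseteq> points" "B \<subseteq> points" "\<And>v. v \<noteq> (0, 0, 0) \<Longrightarrow> pclass v \<in> A \<longleftrightarrow> pclass v \<in> B"
  shows "A = B"
proof -
  have "P \<in> A \<longleftrightarrow> P \<in> B" if "P \<in> points" for P
    by (rule pointsE[OF that]) (metis assms(3))
  then show ?thesis using assms(1,2) by blast
qed

lemma vec3_decompose: "(x, y, z) = vadd (vsc x (1, 0, 0)) (vadd (vsc y (0, 1, 0)) (vsc z (0, 0, 1)))"
  by simp

context gf128
begin

section \<open>Semilinear maps as matrices\<close>

definition mat_map :: "('a \<Rightarrow> 'a) \<Rightarrow> 'a vec3 \<Rightarrow> 'a vec3 \<Rightarrow> 'a vec3 \<Rightarrow> 'a vec3 \<Rightarrow> 'a vec3" where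
  "mat_map \<sigma> r1 r2 r3 v = (case v of (x, y, z) \<Rightarrow>
     let u = (\<sigma> x, \<sigma> y, \<sigma> z) in (vdot r1 u, vdot r2 u, vdot r3 u))"

lemma semilinear_matrix:
  assumes "semilinear (g :: 'a vec3 \<Rightarrow> 'a vec3)"
  obtains \<sigma> r1 r2 r3 where "field_aut \<sigma>" "g = mat_map \<sigma> r1 r2 r3"
proof -
  obtain \<sigma> where \<sigma>: "field_aut \<sigma>" and add: "\<And>u v. g (vadd u v) = vadd (g u) (g v)"
    and sc: "\<And>c u. g (vsc c u) = vsc (\<sigma> c) (g u)"
    using assms by (auto simp: semilinear_def)
  obtain a1 a2 a3 where a: "g (1, 0, 0) = (a1, a2, a3)" by (cases "g (1, 0, 0)")
  obtain b1 b2 b3 where b: "g (0, 1, 0) = (b1, b2, b3)" by (cases "g (0, 1, 0)")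
  obtain c1 c2 c3 where c: "g (0, 0, 1) = (c1, c2, c3)" by (cases "g (0, 0, 1)")
  have "g v = mat_map \<sigma> (a1, b1, c1) (a2, b2, c2) (a3, b3, c3) v" for v
  proof (cases v)
    case (fields x y z)
    have "g (x, y, z) = vadd (vsc (\<sigma> x) (g (1, 0, 0))) (vadd (vsc (\<sigma> y) (g (0, 1, 0))) (vsc (\<sigma> z) (g (0, 0, 1))))"
      by (subst vec3_decompose) (simp only: add sc)
    then show ?thesis unfolding a b c fields by (simp add: mat_map_def algebra_simps)
  qed
  then show ?thesis using that[OF \<sigma>] by blast
qed

lemma semilinear_mat_map:
  assumes \<sigma>: "field_aut \<sigma>" and ker: "\<And>v. mat_map \<sigma> r1 r2 r3 v = (0, 0, 0) \<Longrightarrow> v = (0, 0, 0)"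
  shows "semilinear (mat_map \<sigma> r1 r2 r3)"
proof -
  let ?g = "mat_map \<sigma> r1 r2 r3"
  have add: "?g (vadd u v) = vadd (?g u) (?g v)" for u v
    by (cases u; cases v; cases r1; cases r2; cases r3)
      (simp add: mat_map_def field_aut_simps[OF \<sigma>] algebra_simps)
  have sc: "?g (vsc c u) = vsc (\<sigma> c) (?g u)" for c u
    by (cases u; cases r1; cases r2; cases r3)
      (simp add: mat_map_def field_aut_simps[OF \<sigma>] algebra_simps)
  have "inj ?g"
  proof (rule injI)
    fix u v assume "?g u = ?g v"
    then have "?g (vadd u v) = (0, 0, 0)" unfolding add by (cases "?g v") simp
    then have "vadd u v = (0, 0, 0)" by (rule ker)
    then show "u = v" by (cases u; cases v) simp
  qed
  then have "bij ?g" by (simp add: bij_def finite_UNIV_inj_surj)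
  then show ?thesis using \<sigma> add sc unfolding semilinear_def by blast
qed

lemma semilinear_0_iff:
  assumes "semilinear (g :: 'a vec3 \<Rightarrow> 'a vec3)" shows "g v = (0, 0, 0) \<longleftrightarrow> v = (0, 0, 0)"
proof -
  have "g (0, 0, 0) = (0, 0, 0)"
    using assms by (metis field_aut_simps(1) semilinear_def vsc_eq_0_iff)
  moreover have "inj g" using assms by (simp add: semilinear_def bij_def)
  ultimately show ?thesis by (metis injD)
qed

lemma semilinear_image_pclass:
  assumes "semilinear (g :: 'a vec3 \<Rightarrow> 'a vec3)" shows "g ` pclass v = pclass (g v)"
proof -
  obtain \<sigma> where \<sigma>: "field_aut \<sigma>" and sc: "\<And>c u. g (vsc c u) = vsc (\<sigma> c) (g u)"
    using assms by (auto simp: semilinear_def)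
  show ?thesis
  proof (intro equalityI subsetI)
    fix u assume "u \<in> g ` pclass v"
    then obtain c where "c \<noteq> 0" "u = vsc (\<sigma> c) (g v)" by (auto simp: mem_pclass sc)
    then show "u \<in> pclass (g v)" using field_aut_simps(7)[OF \<sigma>] by (auto simp: mem_pclass)
  next
    fix u assume "u \<in> pclass (g v)"
    then obtain c where c: "c \<noteq> 0" "u = vsc c (g v)" by (auto simp: mem_pclass)
    obtain d where d: "c = \<sigma> d" using \<sigma> by (metis field_aut_def bij_pointE)
    then have "d \<noteq> 0" "u = g (vsc d v)" using c field_aut_simps(1)[OF \<sigma>] sc by auto
    then show "u \<in> g ` pclass v" unfolding mem_pclass by (intro image_eqI) (auto simp: mem_pclass)
  qed
qed

lemma semilinear_id: "semilinear (id :: 'a vec3 \<Rightarrow> 'a vec3)"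
  unfolding semilinear_def by (auto simp: field_aut_def intro!: exI[of _ id])

lemma semilinear_comp:
  assumes "semilinear (g :: 'a vec3 \<Rightarrow> 'a vec3)" "semilinear h" shows "semilinear (g \<circ> h)"
proof -
  obtain \<sigma> where \<sigma>: "field_aut \<sigma>" "\<And>u v. g (vadd u v) = vadd (g u) (g v)"
    "\<And>c u. g (vsc c u) = vsc (\<sigma> c) (g u)" "bij g"
    using assms(1) unfolding semilinear_def by blast
  obtain \<tau> where \<tau>: "field_aut \<tau>" "\<And>u v. h (vadd u v) = vadd (h u) (h v)"
    "\<And>c u. h (vsc c u) = vsc (\<tau> c) (h u)" "bij h"
    using assms(2) unfolding semilinear_def by blast
  have "field_aut (\<sigma> \<circ> \<tau>)" using \<sigma>(1) \<tau>(1) by (simp add: field_aut_def bij_comp)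
  then show ?thesis
    unfolding semilinear_def
    by (intro conjI exI[of _ "\<sigma> \<circ> \<tau>"] allI bij_comp \<sigma> \<tau>) (simp_all del: vadd.simps vsc.simps split_paired_All add: \<sigma> \<tau>)
qed

lemma semilinear_inv:
  assumes "semilinear (g :: 'a vec3 \<Rightarrow> 'a vec3)" shows "semilinear (inv g)"
proof -
  obtain \<sigma> where \<sigma>: "field_aut \<sigma>" and add: "\<And>u v. g (vadd u v) = vadd (g u) (g v)"
    and sc: "\<And>c u. g (vsc c u) = vsc (\<sigma> c) (g u)" and bij: "bij g"
    using assms by (auto simp: semilinear_def)
  have \<sigma>b: "bij \<sigma>" using \<sigma> by (simp add: field_aut_def)
  have gi: "g (inv g u) = u" for u using bij by (simp add: bij_is_surj surj_f_inv_f)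
  have ig: "inv g (g u) = u" for u using bij by (simp add: bij_is_inj inv_f_f)
  have si: "\<sigma> (inv \<sigma> u) = u" for u using \<sigma>b by (simp add: bij_is_surj surj_f_inv_f)
  have is': "inv \<sigma> (\<sigma> u) = u" for u using \<sigma>b by (simp add: bij_is_inj inv_f_f)
  have "field_aut (inv \<sigma>)"
    unfolding field_aut_def using bij_imp_bij_inv[OF \<sigma>b]
    by (metis field_aut_simps(3,4)[OF \<sigma>] si is')
  moreover have "inv g (vadd u v) = vadd (inv g u) (inv g v)" for u v by (metis add gi ig)
  moreover have "inv g (vsc c u) = vsc (inv \<sigma> c) (inv g u)" for c u by (metis sc gi ig si)
  ultimately show ?thesis using bij_imp_bij_inv[OF bij] unfolding semilinear_def by blast
qed

section \<open>Transport of lines, arcs and automorphism groups\<close>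

lemma cimg_comp: "cimg (g \<circ> h) K = cimg g (cimg h K)"
  by (simp add: cimg_def image_image comp_def)

lemma cimg_inv: assumes "semilinear (g :: 'a vec3 \<Rightarrow> 'a vec3)"
  shows "cimg (inv g) (cimg g K) = K" "cimg g (cimg (inv g) K) = K"
proof -
  have "bij g" using assms by (simp add: semilinear_def)
  then have "inv g \<circ> g = id" "g \<circ> inv g = id"
    by (simp_all add: bij_is_inj bij_is_surj flip: surj_iff)
  then have "cimg (inv g \<circ> g) K = K" "cimg (g \<circ> inv g) K = K" by (simp_all add: cimg_def)
  then show "cimg (inv g) (cimg g K) = K" "cimg g (cimg (inv g) K) = K"
    by (simp_all only: cimg_comp)
qed

lemma inj_cimg: assumes "semilinear (g :: 'a vec3 \<Rightarrow> 'a vec3)" shows "inj ((`) g)"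
  using assms by (simp add: semilinear_def bij_def inj_image_eq_iff inj_def)

lemma cimg_subset_points:
  assumes "semilinear (g :: 'a vec3 \<Rightarrow> 'a vec3)" "K \<subseteq> points" shows "cimg g K \<subseteq> points"
proof
  fix P assume "P \<in> cimg g K"
  then obtain Q where "Q \<in> K" "P = g ` Q" by (auto simp: cimg_def)
  then show "P \<in> points"
    using assms by (metis pointsE subsetD pclass_mem_points semilinear_0_iff semilinear_image_pclass)
qed

lemma pclass_mem_cimg:
  assumes "semilinear (g :: 'a vec3 \<Rightarrow> 'a vec3)"
  shows "pclass (g v) \<in> cimg g K \<longleftrightarrow> pclass v \<in> K"
  using inj_cimg[OF assms] unfolding cimg_def semilinear_image_pclass[OF assms, symmetric]
  by (simp add: inj_image_mem_iff)

lemma cimg_points: assumes "semilinear (g :: 'a vec3 \<Rightarrow> 'a vec3)" shows "cimg g points = points"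
proof
  show "cimg g points \<subseteq> points" using assms by (rule cimg_subset_points) simp
  have "cimg (inv g) points \<subseteq> points" using semilinear_inv[OF assms] by (rule cimg_subset_points) simp
  then have "cimg g (cimg (inv g) points) \<subseteq> cimg g points" unfolding cimg_def by (rule image_mono)
  then show "points \<subseteq> cimg g points" by (simp add: cimg_inv[OF assms])
qed

text \<open>The functional w composed with \<open>inv g\<close> is linear in the
  \<open>\<sigma>\<close>-images of the coordinates. Pulling its coefficients back through the
  bijection \<open>\<sigma>\<close> gives a linear functional with the required zero set.\<close>

lemma cimg_line:
  assumes "semilinear (g :: 'a vec3 \<Rightarrow> 'a vec3)" "L \<in> lines" shows "cimg g L \<in> lines"
proof -
  obtain w where w: "L = pline w" "w \<noteq> (0, 0, 0)" using assms(2) by (auto simp: lines_def)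
  have inv: "semilinear (inv g)" using assms by (simp add: semilinear_inv)
  obtain \<sigma> r1 r2 r3 where \<sigma>: "field_aut \<sigma>" and m: "inv g = mat_map \<sigma> r1 r2 r3"
    using semilinear_matrix[OF inv] by blast
  obtain a1 b1 c1 where r1: "r1 = (a1, b1, c1)" by (cases r1)
  obtain a2 b2 c2 where r2: "r2 = (a2, b2, c2)" by (cases r2)
  obtain a3 b3 c3 where r3: "r3 = (a3, b3, c3)" by (cases r3)
  obtain w1 w2 w3 where w': "w = (w1, w2, w3)" by (cases w)
  have surj: "\<exists>d. \<sigma> d = c" for c using \<sigma> by (metis field_aut_def bij_pointE)
  obtain d1 where d1: "\<sigma> d1 = w1 * a1 + w2 * a2 + w3 * a3" using surj by blast
  obtain d2 where d2: "\<sigma> d2 = w1 * b1 + w2 * b2 + w3 * b3" using surj by blast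
  obtain d3 where d3: "\<sigma> d3 = w1 * c1 + w2 * c2 + w3 * c3" using surj by blast
  have dot: "vdot w (inv g u) = \<sigma> (vdot (d1, d2, d3) u)" for u
    unfolding m r1 r2 r3 w'
    by (cases u) (simp add: mat_map_def field_aut_simps[OF \<sigma>] d1 d2 d3 algebra_simps)
  have gi: "g (inv g u) = u" "inv g (g u) = u" for u
    using assms(1) by (simp_all add: semilinear_def bij_def surj_f_inv_f inv_f_f)
  have "(d1, d2, d3) \<noteq> (0, 0, 0)"
  proof
    assume "(d1, d2, d3) = (0, 0, 0)"
    then have "vdot w (inv g u) = 0" for u unfolding dot
      by (cases u) (simp add: field_aut_simps[OF \<sigma>])
    then have *: "vdot w v = 0" for v using gi(2) by metis
    show False using *[of "(1,0,0)"] *[of "(0,1,0)"] *[of "(0,0,1)"] w(2) w' by simp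
  qed
  moreover have "cimg g L = pline (d1, d2, d3)"
  proof (rule points_set_eqI)
    show "cimg g L \<subseteq> points" unfolding w by (intro cimg_subset_points assms pline_subset_points)
    show "pline (d1, d2, d3) \<subseteq> points" by (rule pline_subset_points)
    fix v :: "'a vec3" assume v: "v \<noteq> (0, 0, 0)"
    have "pclass v \<in> cimg g L \<longleftrightarrow> pclass (inv g v) \<in> L"
      using pclass_mem_cimg[OF assms(1), of "inv g v"] by (simp add: gi)
    also have "\<dots> \<longleftrightarrow> vdot (d1, d2, d3) v = 0"
      unfolding w by (simp del: vdot.simps add: dot semilinear_0_iff[OF inv] v field_aut_simps[OF \<sigma>])
    finally show "pclass v \<in> cimg g L \<longleftrightarrow> pclass v \<in> pline (d1, d2, d3)"
      by (simp del: vdot.simps add: v)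
  qed
  ultimately show ?thesis by (auto simp: lines_def)
qed

lemma maximal_arc_cimg:
  assumes g: "semilinear (g :: 'a vec3 \<Rightarrow> 'a vec3)" and K: "maximal_arc K d"
  shows "maximal_arc (cimg g K) d"
proof -
  have card: "card (cimg g K \<inter> L) = card (K \<inter> cimg (inv g) L)" for L
  proof -
    have "cimg g (K \<inter> cimg (inv g) L) = cimg g K \<inter> cimg g (cimg (inv g) L)"
      unfolding cimg_def by (rule image_Int[OF inj_cimg[OF g]])
    then have "cimg g K \<inter> L = cimg g (K \<inter> cimg (inv g) L)" by (simp add: cimg_inv[OF g])
    moreover have "card (cimg g X) = card X" for X
      unfolding cimg_def by (rule card_image) (rule inj_on_subset[OF inj_cimg[OF g] subset_UNIV])
    ultimately show ?thesis by simp
  qed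
  have "card (cimg g K \<inter> L) = 0 \<or> card (cimg g K \<inter> L) = d" if "L \<in> lines" for L
    unfolding card using K cimg_line[OF semilinear_inv[OF g] that] by (simp only: maximal_arc_def)
  moreover have "cimg g K \<noteq> points"
    using K cimg_inv(1)[OF g] cimg_points[OF semilinear_inv[OF g]] unfolding maximal_arc_def by metis
  moreover have "cimg g K \<subseteq> points" "cimg g K \<noteq> {}"
    using K cimg_subset_points[OF g] by (simp_all add: maximal_arc_def cimg_def)
  ultimately show ?thesis unfolding maximal_arc_def by blast
qed

lemma isomorphic_arcs_refl: "isomorphic_arcs K (K :: 'a vec3 set set)"
  unfolding isomorphic_arcs_def by (rule exI[of _ id]) (simp add: semilinear_id cimg_def)

lemma isomorphic_arcs_sym:
  assumes "isomorphic_arcs K (K' :: 'a vec3 set set)" shows "isomorphic_arcs K' K"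
proof -
  obtain g where g: "semilinear g" "cimg g K = K'" using assms by (auto simp: isomorphic_arcs_def)
  have "cimg (inv g) K' = K" using cimg_inv(1)[OF g(1), of K] g(2) by simp
  then show ?thesis unfolding isomorphic_arcs_def using semilinear_inv[OF g(1)] by blast
qed

lemma isomorphic_arcs_trans:
  assumes "isomorphic_arcs K (K' :: 'a vec3 set set)" "isomorphic_arcs K' K''"
  shows "isomorphic_arcs K K''"
proof -
  obtain g where g: "semilinear g" "cimg g K = K'" using assms(1) by (auto simp: isomorphic_arcs_def)
  obtain h where h: "semilinear h" "cimg h K' = K''" using assms(2) by (auto simp: isomorphic_arcs_def)
  have "cimg (h \<circ> g) K = K''" by (simp add: cimg_comp g h)
  then show ?thesis unfolding isomorphic_arcs_def using semilinear_comp[OF h(1) g(1)] by blast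
qed

lemma mathon_type_iff:
  "mathon_type h (K :: 'a vec3 set set) \<longleftrightarrow> (\<exists>C. mathon_family h C \<and> isomorphic_arcs (mathon_set C) K)"
  unfolding mathon_type_def isomorphic_arcs_def by blast

lemma denniston_type_iff:
  "denniston_type h (K :: 'a vec3 set set) \<longleftrightarrow> (\<exists>C \<alpha>. gtrace h \<alpha> = 1 \<and> mathon_family h C \<and>
     (\<forall>c\<in>C. \<exists>l. c = (\<alpha>, 1, l)) \<and> isomorphic_arcs (mathon_set C) K)"
  unfolding denniston_type_def isomorphic_arcs_def by blast

lemma denniston_type_iso:
  assumes "isomorphic_arcs K (K' :: 'a vec3 set set)" "denniston_type h K" shows "denniston_type h K'"
  using assms isomorphic_arcs_trans unfolding denniston_type_iff by blast

lemma maximal_arc_iso: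
  assumes "isomorphic_arcs K (K' :: 'a vec3 set set)" "maximal_arc K d" shows "maximal_arc K' d"
  using assms maximal_arc_cimg unfolding isomorphic_arcs_def by blast

text \<open>Conjugation by h carries one group to the other. The inequality so obtained, applied to
  \<open>inv h\<close>, gives its converse.\<close>

lemma card_aut_group_cimg:
  assumes h: "semilinear (h :: 'a vec3 \<Rightarrow> 'a vec3)"
  shows "card (aut_group (cimg h K)) = card (aut_group K)"
proof -
  have le: "card (aut_group (cimg h K)) \<le> card (aut_group K)" if h: "semilinear h" for K and h :: "'a vec3 \<Rightarrow> 'a vec3"
  proof -
    \<comment> \<open>Conjugation by h, with the value outside \<open>points\<close> reset to
      \<open>undefined\<close>, the default in \<open>aut_group\<close>.\<close>
    define F where "F \<phi> = (\<lambda>P. if P \<in> points then h ` (\<phi> (inv h ` P)) else undefined)"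
      for \<phi> :: "'a vec3 set \<Rightarrow> 'a vec3 set"
    have "aut_group (cimg h K) \<subseteq> F ` aut_group K"
    proof
      fix \<phi> assume "\<phi> \<in> aut_group (cimg h K)"
      then obtain g where g: "semilinear g" "cimg g (cimg h K) = cimg h K"
        and \<phi>: "\<phi> = (\<lambda>P. if P \<in> points then g ` P else undefined)"
        unfolding aut_group_def by blast
      define g' where "g' = inv h \<circ> g \<circ> h"
      have "semilinear g'" unfolding g'_def using g h by (intro semilinear_comp semilinear_inv)
      moreover have "cimg g' K = K" unfolding g'_def by (simp add: cimg_comp g(2) cimg_inv[OF h])
      ultimately have "(\<lambda>P. if P \<in> points then g' ` P else undefined) \<in> aut_group K"
        unfolding aut_group_def by blast
      moreover have "\<phi> = F (\<lambda>P. if P \<in> points then g' ` P else undefined)"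
      proof
        fix P
        have hi: "h (inv h u) = u" for u using h by (simp add: semilinear_def bij_def surj_f_inv_f)
        have "P \<in> points \<Longrightarrow> inv h ` P \<in> points"
          using cimg_points[OF semilinear_inv[OF h]] unfolding cimg_def by blast
        then show "\<phi> P = F (\<lambda>P. if P \<in> points then g' ` P else undefined) P"
          by (auto simp: \<phi> F_def g'_def image_image hi)
      qed
      ultimately show "\<phi> \<in> F ` aut_group K" by blast
    qed
    moreover have "finite (aut_group K)"
    proof -
      have "aut_group K \<subseteq> (\<lambda>g P. if P \<in> points then g ` P else undefined) ` UNIV"
        unfolding aut_group_def by blast
      then show ?thesis by (rule finite_subset) simp
    qed
    then have "card (F ` aut_group K) \<le> card (aut_group K)" by (rule card_image_le)
    ultimately show ?thesis
      using card_mono[of "F ` aut_group K" "aut_group (cimg h K)"] by (simp add: \<open>finite (aut_group K)\<close>)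
  qed
  show ?thesis using le[OF h, of K] le[OF semilinear_inv[OF h], of "cimg h K"]
    by (simp add: cimg_inv[OF h])
qed


section \<open>Isomorphisms map conics to conics\<close>

text \<open>These represent the collineations fixing (0, 0, 1); the last entry 1 uses up the freedom
  of a scalar factor.\<close>

definition block_map where
  "block_map \<sigma> m11 m12 m21 m22 m31 m32 = mat_map \<sigma> (m11, m12, 0) (m21, m22, 0) (m31, m32, 1 :: 'a)"

lemma block_map_apply:
  "block_map \<sigma> m11 m12 m21 m22 m31 m32 (x, y, z)
   = (m11 * \<sigma> x + m12 * \<sigma> y, m21 * \<sigma> x + m22 * \<sigma> y, m31 * \<sigma> x + m32 * \<sigma> y + \<sigma> z)"
  by (simp add: block_map_def mat_map_def)

text \<open>The coefficientwise form of the statement that pulling back the form of c' gives the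
  determinant times the \<open>\<sigma>\<close>-image of the form of c. The factor is dictated by
  the coefficient 1 of xy. Products with z cause no condition, because squaring is additive.\<close>

definition conic_rel :: "('a \<Rightarrow> 'a) \<Rightarrow> 'a \<Rightarrow> 'a \<Rightarrow> 'a \<Rightarrow> 'a \<Rightarrow> 'a \<Rightarrow> 'a \<Rightarrow> 'a vec3 \<Rightarrow> 'a vec3 \<Rightarrow> bool" where
  "conic_rel \<sigma> m11 m12 m21 m22 m31 m32 c c' \<longleftrightarrow> (case c of (\<alpha>, \<beta>, l) \<Rightarrow> case c' of (\<alpha>', \<beta>', l') \<Rightarrow>
     l' = (m11 * m22 + m12 * m21) * \<sigma> l \<and>
     \<alpha>' * m11 ^ 2 + m11 * m21 + \<beta>' * m21 ^ 2 + l' * m31 ^ 2 = (m11 * m22 + m12 * m21) * \<sigma> \<alpha> \<and>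
     \<alpha>' * m12 ^ 2 + m12 * m22 + \<beta>' * m22 ^ 2 + l' * m32 ^ 2 = (m11 * m22 + m12 * m21) * \<sigma> \<beta>)"

lemma semilinear_block_map:
  assumes \<sigma>: "field_aut \<sigma>" and D: "m11 * m22 + m12 * m21 \<noteq> 0"
  shows "semilinear (block_map \<sigma> m11 m12 m21 m22 m31 m32)"
  unfolding block_map_def
proof (rule semilinear_mat_map[OF \<sigma>])
  fix v assume "mat_map \<sigma> (m11, m12, 0) (m21, m22, 0) (m31, m32, 1) v = (0, 0, 0)"
  moreover obtain x y z where v: "v = (x, y, z)" by (cases v)
  ultimately have 0: "m11 * \<sigma> x + m12 * \<sigma> y = 0" "m21 * \<sigma> x + m22 * \<sigma> y = 0" "m31 * \<sigma> x + m32 * \<sigma> y + \<sigma> z = 0"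
    by (simp_all add: mat_map_def)
  have "(m11 * m22 + m12 * m21) * \<sigma> x = m22 * (m11 * \<sigma> x + m12 * \<sigma> y) + m12 * (m21 * \<sigma> x + m22 * \<sigma> y)"
    by (simp add: algebra_simps)
  then have x: "\<sigma> x = 0" using D unfolding 0 by simp
  have "(m11 * m22 + m12 * m21) * \<sigma> y = m21 * (m11 * \<sigma> x + m12 * \<sigma> y) + m11 * (m21 * \<sigma> x + m22 * \<sigma> y)"
    by (simp add: algebra_simps)
  then have y: "\<sigma> y = 0" using D unfolding 0 by simp
  show "v = (0, 0, 0)" using x y 0(3) v by (simp add: field_aut_simps[OF \<sigma>])
qed

lemma qform_block_map:
  assumes \<sigma>: "field_aut \<sigma>" and rel: "conic_rel \<sigma> m11 m12 m21 m22 m31 m32 c c'"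
  shows "qform c' (block_map \<sigma> m11 m12 m21 m22 m31 m32 v) = (m11 * m22 + m12 * m21) * \<sigma> (qform c v)"
proof -
  obtain x y z where v: "v = (x, y, z)" by (cases v)
  obtain \<alpha> \<beta> l where c: "c = (\<alpha>, \<beta>, l)" by (cases c)
  obtain \<alpha>' \<beta>' l' where c': "c' = (\<alpha>', \<beta>', l')" by (cases c')
  note r = rel[unfolded conic_rel_def c c' prod.case]
  have "qform c' (block_map \<sigma> m11 m12 m21 m22 m31 m32 v)
    = (\<alpha>' * m11 ^ 2 + m11 * m21 + \<beta>' * m21 ^ 2 + l' * m31 ^ 2) * \<sigma> x ^ 2
    + (\<alpha>' * m12 ^ 2 + m12 * m22 + \<beta>' * m22 ^ 2 + l' * m32 ^ 2) * \<sigma> y ^ 2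
    + (m11 * m22 + m12 * m21) * (\<sigma> x * \<sigma> y) + l' * \<sigma> z ^ 2"
    by (simp add: v c' block_map_apply power_mult_distrib) (simp add: algebra_simps power2_eq_square)
  also have "\<dots> = (m11 * m22 + m12 * m21) * (\<sigma> \<alpha> * \<sigma> x ^ 2 + \<sigma> \<beta> * \<sigma> y ^ 2 + \<sigma> x * \<sigma> y + \<sigma> l * \<sigma> z ^ 2)"
    unfolding r[THEN conjunct2, THEN conjunct1] r[THEN conjunct2, THEN conjunct2] unfolding r[THEN conjunct1]
    by (simp add: distrib_left mult.assoc)
  also have "\<sigma> \<alpha> * \<sigma> x ^ 2 + \<sigma> \<beta> * \<sigma> y ^ 2 + \<sigma> x * \<sigma> y + \<sigma> l * \<sigma> z ^ 2 = \<sigma> (qform c v)"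
    by (simp add: v c field_aut_simps[OF \<sigma>] add_ac)
  finally show ?thesis .
qed

lemma cimg_block_map_mathon_set:
  assumes \<sigma>: "field_aut \<sigma>" and D: "m11 * m22 + m12 * m21 \<noteq> 0"
    and rel: "\<And>c. c \<in> C \<Longrightarrow> \<exists>c'\<in>C'. conic_rel \<sigma> m11 m12 m21 m22 m31 m32 c c'"
      "\<And>c'. c' \<in> C' \<Longrightarrow> \<exists>c\<in>C. conic_rel \<sigma> m11 m12 m21 m22 m31 m32 c c'"
  shows "cimg (block_map \<sigma> m11 m12 m21 m22 m31 m32) (mathon_set C) = mathon_set C'"
proof (rule points_set_eqI)
  let ?g = "block_map \<sigma> m11 m12 m21 m22 m31 m32"
  have g: "semilinear ?g" by (rule semilinear_block_map[OF \<sigma> D])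
  show "cimg ?g (mathon_set C) \<subseteq> points"
    by (intro cimg_subset_points g mathon_set_subset_points)
  show "mathon_set C' \<subseteq> points" by (rule mathon_set_subset_points)
  fix u :: "'a vec3" assume "u \<noteq> (0, 0, 0)"
  obtain v where v: "u = ?g v" using g by (metis semilinear_def bij_pointE)
  have "?g (0, 0, 1) = (0, 0, 1)" by (simp add: block_map_apply field_aut_simps[OF \<sigma>])
  then have N: "pclass (?g v) = pclass (0, 0, 1) \<longleftrightarrow> pclass v = pclass (0, 0, 1)"
    by (metis injD inj_cimg[OF g] semilinear_image_pclass[OF g])
  have "qform c' (?g v) = 0 \<longleftrightarrow> qform c v = 0" if "conic_rel \<sigma> m11 m12 m21 m22 m31 m32 c c'" for c c'
    using D by (simp add: qform_block_map[OF \<sigma> that] field_aut_simps[OF \<sigma>])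
  then have "(\<exists>c\<in>C. qform c v = 0) \<longleftrightarrow> (\<exists>c'\<in>C'. qform c' (?g v) = 0)"
    using rel by metis
  then show "pclass u \<in> cimg ?g (mathon_set C) \<longleftrightarrow> pclass u \<in> mathon_set C'"
    by (simp only: v pclass_mem_cimg[OF g] pclass_mem_mathon_set N semilinear_0_iff[OF g])
qed

text \<open>Five zeros are one more than the degree allows. It is applied to pulled-back conics and
  also to compare coefficients of polynomials in the index of a conic, where seven values are
  available.\<close>

lemma quartic_zero:
  fixes c0 :: 'a
  assumes "5 \<le> card S" "\<And>u. u \<in> S \<Longrightarrow> c0 + c1 * u + c2 * u ^ 2 + c3 * u ^ 3 + c4 * u ^ 4 = 0"
  shows "c0 = 0" "c1 = 0" "c2 = 0" "c3 = 0" "c4 = 0"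
proof -
  let ?p = "[:c0, c1, c2, c3, c4:]"
  have "poly ?p u = c0 + c1 * u + c2 * u ^ 2 + c3 * u ^ 3 + c4 * u ^ 4" for u
    by (simp add: numeral_eq_Suc algebra_simps)
  then have "S \<subseteq> {u. poly ?p u = 0}" using assms(2) by (metis (mono_tags, lifting) mem_Collect_eq subsetI)
  then have "card S \<le> card {u. poly ?p u = 0}" by (intro card_mono) auto
  moreover have "degree ?p \<le> 4" by simp
  ultimately have "?p = 0" using card_poly_roots_bound[of ?p] assms(1) by linarith
  then show "c0 = 0" "c1 = 0" "c2 = 0" "c3 = 0" "c4 = 0" by auto
qed

text \<open>By the pigeonhole principle at least five points of the conic are mapped to a single conic of
  \<open>C'\<close>. Pulling back the latter along the parametrisation \<open>(1, t, z t)\<close> and squaring gives a quartic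
  in \<open>\<sigma> t\<close> that must vanish identically.\<close>

lemma conic_image:
  assumes \<sigma>: "field_aut \<sigma>"
    and g: "semilinear g" "g = mat_map \<sigma> (m11, m12, m13) (m21, m22, m23) (m31, m32, m33)"
    and l: "l \<noteq> 0" and C': "finite C'" "card C' \<le> 7"
    and img: "\<And>v. v \<noteq> (0, 0, 0) \<Longrightarrow> qform (\<alpha>, \<beta>, l) v = 0 \<Longrightarrow> pclass (g v) \<in> mathon_set C'"
  shows "m11 * m22 + m12 * m21 \<noteq> 0 \<and> m13 = 0 \<and> m23 = 0 \<and>
    (\<exists>\<alpha>' \<beta>' l'. (\<alpha>', \<beta>', l') \<in> C' \<and>
      l' * m33 ^ 2 = (m11 * m22 + m12 * m21) * \<sigma> l \<and>
      \<alpha>' * m11 ^ 2 + m11 * m21 + \<beta>' * m21 ^ 2 + l' * m31 ^ 2 = (m11 * m22 + m12 * m21) * \<sigma> \<alpha> \<and>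
      \<alpha>' * m12 ^ 2 + m12 * m22 + \<beta>' * m22 ^ 2 + l' * m32 ^ 2 = (m11 * m22 + m12 * m21) * \<sigma> \<beta>)"
proof -
  \<comment> \<open>Square roots are unique, so every t gives exactly one point (1, t, z t) of the
    conic: 128 points in all.\<close>
  define z where "z t = sq_root ((\<alpha> + t + \<beta> * t ^ 2) / l)" for t
  have z2: "z t ^ 2 = (\<alpha> + t + \<beta> * t ^ 2) / l" for t by (simp add: z_def)
  have on: "qform (\<alpha>, \<beta>, l) (1, t, z t) = 0" for t using l by (simp add: z2)
  define T where "T c = {t. qform c (g (1, t, z t)) = 0}" for c
  define T0 where "T0 = {t. pclass (g (1, t, z t)) = pclass (0, 0, 1)}"
  \<comment> \<open>Otherwise at most 7 * 4 parameters would be mapped to conics and at most one to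
    (0, 0, 1), far fewer than 128.\<close>
  have "\<exists>c\<in>C'. 5 \<le> card (T c)"
  proof (rule ccontr)
    assume "\<not> (\<exists>c\<in>C'. 5 \<le> card (T c))"
    then have T4: "card (T c) \<le> 4" if "c \<in> C'" for c using that by force
    have "t = t'" if t: "t \<in> T0" "t' \<in> T0" for t t'
    proof -
      have "g ` pclass (1, t, z t) = g ` pclass (1, t', z t')"
        using t by (simp add: T0_def semilinear_image_pclass[OF g(1)])
      then have "pclass (1, t, z t) = pclass (1, t', z t')" by (metis injD inj_cimg[OF g(1)])
      then show ?thesis by (auto simp: pclass_eq_iff)
    qed
    then have "card T0 \<le> 1" by (metis card_le_Suc0_iff_eq finite One_nat_def)
    moreover have "card (\<Union>(T ` C')) \<le> (\<Sum>c\<in>C'. card (T c))" by (rule card_UN_le[OF C'(1)])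
    moreover have "(\<Sum>c\<in>C'. card (T c)) \<le> 7 * 4"
      using sum_mono[of C' "\<lambda>c. card (T c)" "\<lambda>_. 4"] T4 C'(2) by simp
    moreover have "UNIV = T0 \<union> \<Union>(T ` C')"
      using img[OF _ on] by (auto simp: T_def T0_def pclass_mem_mathon_set simp del: qform.simps)
    then have "card (UNIV :: 'a set) \<le> card T0 + card (\<Union>(T ` C'))" by (metis card_Un_le)
    ultimately show False by (simp add: card_field)
  qed
  then obtain c where c: "c \<in> C'" "5 \<le> card (T c)" by blast
  obtain \<alpha>' \<beta>' l' where c': "c = (\<alpha>', \<beta>', l')" by (cases c)
  \<comment> \<open>A, B, C are the coefficients of the squares and D, E, F those of xy, xz, yz in
    the pulled-back form. In characteristic 2 the latter three are the minors of the first two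
    rows.\<close>
  define A where "A = \<alpha>' * m11 ^ 2 + m11 * m21 + \<beta>' * m21 ^ 2 + l' * m31 ^ 2"
  define B where "B = \<alpha>' * m12 ^ 2 + m12 * m22 + \<beta>' * m22 ^ 2 + l' * m32 ^ 2"
  define C where "C = \<alpha>' * m13 ^ 2 + m13 * m23 + \<beta>' * m23 ^ 2 + l' * m33 ^ 2"
  define D where "D = m11 * m22 + m12 * m21"
  define E where "E = m11 * m23 + m13 * m21"
  define F where "F = m12 * m23 + m13 * m22"
  define a where "a = \<sigma> \<alpha> / \<sigma> l"
  define b where "b = \<sigma> \<beta> / \<sigma> l"
  define k where "k = 1 / \<sigma> l"
  have \<sigma>l: "\<sigma> l \<noteq> 0" using l by (simp add: field_aut_simps[OF \<sigma>])
  have quartic: "(A ^ 2 + C ^ 2 * a ^ 2 + E ^ 2 * a) + E ^ 2 * k * u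
      + (C ^ 2 * k ^ 2 + D ^ 2 + E ^ 2 * b + F ^ 2 * a) * u ^ 2 + F ^ 2 * k * u ^ 3
      + (B ^ 2 + C ^ 2 * b ^ 2 + F ^ 2 * b) * u ^ 4 = 0" if u: "u \<in> \<sigma> ` T c" for u
  proof -
    obtain t where t: "qform c (g (1, t, z t)) = 0" "u = \<sigma> t" using u by (auto simp: T_def)
    define w where "w = \<sigma> (z t)"
    have "w ^ 2 = (\<sigma> \<alpha> + u + \<sigma> \<beta> * u ^ 2) / \<sigma> l"
      unfolding w_def t(2) field_aut_simps(5)[OF \<sigma>, symmetric] z2 by (simp add: field_aut_simps[OF \<sigma>])
    then have w2: "w ^ 2 = a + k * u + b * u ^ 2"
      by (simp add: a_def b_def k_def add_divide_distrib)
    have "qform c (g (1, t, z t)) = A + B * u ^ 2 + C * w ^ 2 + D * u + (E + F * u) * w"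
      unfolding c' g(2) mat_map_def A_def B_def C_def D_def E_def F_def w_def t(2)
      by (simp add: field_aut_simps[OF \<sigma>] power_mult_distrib) (simp add: algebra_simps power2_eq_square)
    \<comment> \<open>Only the term (E + F u) w contains w to the first power; isolating it and
      squaring leaves a polynomial in u, as w^2 is one.\<close>
    then have "(A + B * u ^ 2 + C * w ^ 2 + D * u) ^ 2 = ((E + F * u) * w) ^ 2"
      using t(1) by (simp del: power2_add)
    then have "A ^ 2 + B ^ 2 * (u ^ 2) ^ 2 + C ^ 2 * (a + k * u + b * u ^ 2) ^ 2 + D ^ 2 * u ^ 2
       = (E ^ 2 + F ^ 2 * u ^ 2) * (a + k * u + b * u ^ 2)"
      by (simp only: power2_add power_mult_distrib w2)
    then have "(A ^ 2 + B ^ 2 * (u ^ 2) ^ 2 + C ^ 2 * (a + k * u + b * u ^ 2) ^ 2 + D ^ 2 * u ^ 2)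
       + (E ^ 2 + F ^ 2 * u ^ 2) * (a + k * u + b * u ^ 2) = 0"
      by (simp only: add_eq_0_iff_eq)
    then show ?thesis
      by (simp add: power_mult_distrib algebra_simps numeral_eq_Suc del: add_eq_0_iff_eq)
  qed
  have "5 \<le> card (\<sigma> ` T c)"
    using c(2) card_image[of \<sigma> "T c"] by (simp add: inj_on_def field_aut_simps[OF \<sigma>])
  note q = quartic_zero[OF this quartic]
  have E: "E = 0" and F: "F = 0" using q(2,4) \<sigma>l by (simp_all add: k_def)
  have "A ^ 2 = (C * a) ^ 2" "(C * k) ^ 2 = D ^ 2" "B ^ 2 = (C * b) ^ 2"
    using q(1,3,5) by (simp_all add: E F power_mult_distrib)
  then have ABC: "A = C * a" "C * k = D" "B = C * b" by (simp_all only: power2_eq_iff_char2)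
  then have ABC': "C = D * \<sigma> l" "A = D * \<sigma> \<alpha>" "B = D * \<sigma> \<beta>"
    using \<sigma>l by (auto simp: k_def a_def b_def field_simps)
  have D: "D \<noteq> 0"
  proof
    assume "D = 0"
    obtain v v' where v: "g v = (1, 0, 0)" "g v' = (0, 1, 0)"
      using g(1) by (metis semilinear_def bij_pointE)
    obtain x y z x' y' z' where xyz: "v = (x, y, z)" "v' = (x', y', z')" by (cases v; cases v')
    define u1 u2 u3 w1 w2 w3 where "u1 = \<sigma> x" "u2 = \<sigma> y" "u3 = \<sigma> z" "w1 = \<sigma> x'" "w2 = \<sigma> y'" "w3 = \<sigma> z'"
    note u = this
    have 1: "m11 * u1 + m12 * u2 + m13 * u3 = 1" "m21 * u1 + m22 * u2 + m23 * u3 = 0"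
      "m11 * w1 + m12 * w2 + m13 * w3 = 0" "m21 * w1 + m22 * w2 + m23 * w3 = 1"
      using v unfolding g(2) xyz mat_map_def by (simp_all add: u)
    \<comment> \<open>Cauchy-Binet for the first two rows: were all minors zero, the images (1, 0,
      0) and (0, 1, 0) could not both occur.\<close>
    have "(m11 * u1 + m12 * u2 + m13 * u3) * (m21 * w1 + m22 * w2 + m23 * w3)
        + (m21 * u1 + m22 * u2 + m23 * u3) * (m11 * w1 + m12 * w2 + m13 * w3)
      = D * (u1 * w2 + u2 * w1) + E * (u1 * w3 + u3 * w1) + F * (u2 * w3 + u3 * w2)"
      unfolding D_def E_def F_def by (simp add: algebra_simps)
    then show False unfolding 1 by (simp add: \<open>D = 0\<close> E F)
  qed
  \<comment> \<open>Each identity expands a 3 x 3 determinant with a repeated row.\<close>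
  have "D * m13 = m11 * F + m12 * E" "D * m23 = m21 * F + m22 * E"
    unfolding D_def E_def F_def by (simp_all add: algebra_simps)
  then have m: "m13 = 0" "m23 = 0" using D E F by simp_all
  show ?thesis
    using c(1) c' D m ABC' unfolding A_def B_def C_def D_def by auto
qed

text \<open>Each conic forces m13 = m23 = 0 for one and the same matrix, so (0, 0, 1) is fixed and
  m33 is nonzero. Division by m33 brings the matrix into the shape of \<open>block_map\<close>, and
  k is m33.\<close>

theorem isomorphism_structure:
  assumes g: "semilinear g" and C': "finite C'" "card C' \<le> 7" and C: "C \<noteq> {}" "\<And>\<alpha> \<beta> l. (\<alpha>, \<beta>, l) \<in> C \<Longrightarrow> l \<noteq> 0"
    and img: "cimg g (mathon_set C) \<subseteq> mathon_set C'"
  obtains \<sigma> m11 m12 m21 m22 m31 m32 k where "field_aut \<sigma>" "m11 * m22 + m12 * m21 \<noteq> 0" "k \<noteq> 0"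
    "g = (\<lambda>v. vsc k (block_map \<sigma> m11 m12 m21 m22 m31 m32 v))"
    "\<And>c. c \<in> C \<Longrightarrow> \<exists>c'\<in>C'. conic_rel \<sigma> m11 m12 m21 m22 m31 m32 c c'"
proof -
  obtain \<sigma> r1 r2 r3 where \<sigma>: "field_aut \<sigma>" and gr: "g = mat_map \<sigma> r1 r2 r3"
    using semilinear_matrix[OF g] by blast
  obtain m11 m12 m13 where r1: "r1 = (m11, m12, m13)" by (cases r1)
  obtain m21 m22 m23 where r2: "r2 = (m21, m22, m23)" by (cases r2)
  obtain m31 m32 m33 where r3: "r3 = (m31, m32, m33)" by (cases r3)
  note gm = gr[unfolded r1 r2 r3]
  have img': "pclass (g v) \<in> mathon_set C'" if "c \<in> C" "v \<noteq> (0, 0, 0)" "qform c v = 0" for c v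
  proof -
    have "pclass v \<in> mathon_set C" using that unfolding pclass_mem_mathon_set by blast
    then show ?thesis using img pclass_mem_cimg[OF g] by blast
  qed
  have im: "m11 * m22 + m12 * m21 \<noteq> 0 \<and> m13 = 0 \<and> m23 = 0 \<and>
    (\<exists>\<alpha>' \<beta>' l'. (\<alpha>', \<beta>', l') \<in> C' \<and>
      l' * m33 ^ 2 = (m11 * m22 + m12 * m21) * \<sigma> l \<and>
      \<alpha>' * m11 ^ 2 + m11 * m21 + \<beta>' * m21 ^ 2 + l' * m31 ^ 2 = (m11 * m22 + m12 * m21) * \<sigma> \<alpha> \<and>
      \<alpha>' * m12 ^ 2 + m12 * m22 + \<beta>' * m22 ^ 2 + l' * m32 ^ 2 = (m11 * m22 + m12 * m21) * \<sigma> \<beta>)"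
    if "(\<alpha>, \<beta>, l) \<in> C" for \<alpha> \<beta> l
    using conic_image[OF \<sigma> g gm C(2)[OF that] C' img'[OF that]] by blast
  obtain \<alpha>0 \<beta>0 l0 where "(\<alpha>0, \<beta>0, l0) \<in> C" using C(1) by (metis all_not_in_conv surj_pair)
  then have D: "m11 * m22 + m12 * m21 \<noteq> 0" and m0: "m13 = 0" "m23 = 0" using im by blast+
  have "g (0, 0, 1) = (0, 0, m33)" by (simp add: gm m0 mat_map_def field_aut_simps[OF \<sigma>])
  then have m33: "m33 \<noteq> 0" using semilinear_0_iff[OF g, of "(0, 0, 1)"] by auto
  have det: "(m11 / m33) * (m22 / m33) + (m12 / m33) * (m21 / m33) = (m11 * m22 + m12 * m21) / m33 ^ 2"
    by (simp add: add_divide_distrib power2_eq_square)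
  show ?thesis
  proof (rule that[OF \<sigma> _ m33])
    show "(m11 / m33) * (m22 / m33) + (m12 / m33) * (m21 / m33) \<noteq> 0" unfolding det using D m33 by simp
    show "g = (\<lambda>v. vsc m33 (block_map \<sigma> (m11 / m33) (m12 / m33) (m21 / m33) (m22 / m33) (m31 / m33) (m32 / m33) v))"
    proof
      fix v :: "'a vec3"
      show "g v = vsc m33 (block_map \<sigma> (m11 / m33) (m12 / m33) (m21 / m33) (m22 / m33) (m31 / m33) (m32 / m33) v)"
        using m33 by (cases v) (simp add: gm m0 mat_map_def block_map_apply distrib_left)
    qed
    fix c assume c: "c \<in> C"
    obtain \<alpha> \<beta> l where c': "c = (\<alpha>, \<beta>, l)" by (cases c)
    obtain \<alpha>' \<beta>' l' where 1: "(\<alpha>', \<beta>', l') \<in> C'" and eqs: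
      "l' * m33 ^ 2 = (m11 * m22 + m12 * m21) * \<sigma> l"
      "\<alpha>' * m11 ^ 2 + m11 * m21 + \<beta>' * m21 ^ 2 + l' * m31 ^ 2 = (m11 * m22 + m12 * m21) * \<sigma> \<alpha>"
      "\<alpha>' * m12 ^ 2 + m12 * m22 + \<beta>' * m22 ^ 2 + l' * m32 ^ 2 = (m11 * m22 + m12 * m21) * \<sigma> \<beta>"
      using im c c' by blast
    have "l' = (m11 * m22 + m12 * m21) / m33 ^ 2 * \<sigma> l" using eqs(1) m33 by (simp add: field_simps)
    moreover have "\<alpha>' * (m11 / m33) ^ 2 + m11 / m33 * (m21 / m33) + \<beta>' * (m21 / m33) ^ 2 + l' * (m31 / m33) ^ 2
       = (m11 * m22 + m12 * m21) / m33 ^ 2 * \<sigma> \<alpha>"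
      using arg_cong[OF eqs(2), of "\<lambda>x. x / m33 ^ 2"]
      by (simp add: add_divide_distrib distrib_right power_divide power2_eq_square[of m33])
    moreover have "\<alpha>' * (m12 / m33) ^ 2 + m12 / m33 * (m22 / m33) + \<beta>' * (m22 / m33) ^ 2 + l' * (m32 / m33) ^ 2
       = (m11 * m22 + m12 * m21) / m33 ^ 2 * \<sigma> \<beta>"
      using arg_cong[OF eqs(3), of "\<lambda>x. x / m33 ^ 2"]
      by (simp add: add_divide_distrib distrib_right power_divide power2_eq_square[of m33])
    ultimately show "\<exists>c'\<in>C'. conic_rel \<sigma> (m11 / m33) (m12 / m33) (m21 / m33) (m22 / m33) (m31 / m33) (m32 / m33) c c'"
      by (intro bexI[OF _ 1]) (simp only: conic_rel_def c' prod.case det simp_thms)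
  qed
qed


section \<open>Arcs in normal form\<close>

text \<open>In general \<open>z = 0\<close> is not an external line of a normal arc, so \<open>normal_family L\<close> need not be a
  \<open>mathon_family\<close>; a suitable shift of \<open>z\<close> turns it into one.\<close>

definition normal_family :: "'a set \<Rightarrow> 'a vec3 set" where
  "normal_family L = (\<lambda>l. (1 + l ^ 3, 1, l)) ` (L - {0})"

definition normal_arc :: "'a set \<Rightarrow> 'a vec3 set set" where
  "normal_arc L = mathon_set (normal_family L)"

lemma card_subgroup8_minus_0: assumes "subgroup8 L" shows "card (L - {0}) = 7"
  using assms by (simp add: subgroup8_def)

lemma card_normal_family: assumes "subgroup8 L" shows "card (normal_family L) = 7"
  unfolding normal_family_def using card_subgroup8_minus_0[OF assms]
  by (subst card_image) (auto simp: inj_on_def)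

lemma normal_family_nonempty: assumes "subgroup8 L" shows "normal_family L \<noteq> {}"
  using card_normal_family[OF assms] by auto

text \<open>For e = 1 the substitution y + x for y leaves x y + y^2 unchanged, so with beta = 1 it
  preserves every conic. This involution is the source of the factor 2 in the group orders.\<close>

lemma cimg_normal_arc:
  assumes \<sigma>: "field_aut \<sigma>" and e: "e = 0 \<or> e = 1"
  shows "cimg (block_map \<sigma> 1 0 e 1 0 0) (normal_arc L) = normal_arc (\<sigma> ` L)"
  unfolding normal_arc_def
proof (rule cimg_block_map_mathon_set[OF \<sigma>])
  have rel: "conic_rel \<sigma> 1 0 e 1 0 0 (1 + l ^ 3, 1, l) (1 + \<sigma> l ^ 3, 1, \<sigma> l)" for l
    using e by (auto simp: conic_rel_def field_aut_simps[OF \<sigma>])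
  show "\<exists>c'\<in>normal_family (\<sigma> ` L). conic_rel \<sigma> 1 0 e 1 0 0 c c'" if "c \<in> normal_family L" for c
    using that rel by (fastforce simp: normal_family_def field_aut_simps[OF \<sigma>])
  show "\<exists>c\<in>normal_family L. conic_rel \<sigma> 1 0 e 1 0 0 c c'" if "c' \<in> normal_family (\<sigma> ` L)" for c'
    using that rel by (fastforce simp: normal_family_def field_aut_simps[OF \<sigma>])
qed simp

lemma field_aut_image_subgroup8:
  assumes "field_aut \<sigma>" "subgroup8 L" shows "card (\<sigma> ` (L - {0})) = 7"
  using card_subgroup8_minus_0[OF assms(2)]
  by (subst card_image) (auto simp: inj_on_def field_aut_simps[OF assms(1)])

text \<open>The relations between conics are cubic polynomials in u = \<open>\<sigma>\<close> l with
  seven zeros, so they vanish coefficientwise. The linear terms kill m31 and m32, the cubic terms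
  give m12 = 0 and D^2 m11^2 = 1, and the constant terms give m22^2 = D and a quadratic equation for
  m21.\<close>

lemma normal_arc_isomorphism:
  assumes L: "subgroup8 L" "subgroup8 L'" and g: "semilinear g" "cimg g (normal_arc L) = normal_arc L'"
  obtains \<sigma> e k where "field_aut \<sigma>" "\<sigma> ` L = L'" "e = 0 \<or> e = 1" "k \<noteq> 0"
    "g = (\<lambda>v. vsc k (block_map \<sigma> 1 0 e 1 0 0 v))"
proof -
  obtain \<sigma> m11 m12 m21 m22 m31 m32 k where \<sigma>: "field_aut \<sigma>" and D: "m11 * m22 + m12 * m21 \<noteq> 0"
    and k: "k \<noteq> 0" and gk: "g = (\<lambda>v. vsc k (block_map \<sigma> m11 m12 m21 m22 m31 m32 v))"
    and rel: "\<And>c. c \<in> normal_family L \<Longrightarrow> \<exists>c'\<in>normal_family L'. conic_rel \<sigma> m11 m12 m21 m22 m31 m32 c c'"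
  proof (rule isomorphism_structure[OF g(1)])
    show "finite (normal_family L')" by simp
    show "card (normal_family L') \<le> 7" "normal_family L \<noteq> {}"
      using card_normal_family L normal_family_nonempty by auto
    show "l \<noteq> 0" if "(\<alpha>, \<beta>, l) \<in> normal_family L" for \<alpha> \<beta> l using that by (auto simp: normal_family_def)
    show "cimg g (mathon_set (normal_family L)) \<subseteq> mathon_set (normal_family L')"
      using g(2) by (simp add: normal_arc_def)
  qed blast
  define D where "D = m11 * m22 + m12 * m21"
  have D0: "D \<noteq> 0" using D by (simp add: D_def)
  have eqs: "D * u \<in> L' - {0} \<and>
     (1 + (D * u) ^ 3) * m11 ^ 2 + m11 * m21 + m21 ^ 2 + D * u * m31 ^ 2 = D * (1 + u ^ 3) \<and>
     (1 + (D * u) ^ 3) * m12 ^ 2 + m12 * m22 + m22 ^ 2 + D * u * m32 ^ 2 = D" if u: "u \<in> \<sigma> ` (L - {0})" for u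
  proof -
    obtain l where l: "l \<in> L - {0}" "u = \<sigma> l" using u by blast
    then have "(1 + l ^ 3, 1, l) \<in> normal_family L" by (auto simp: normal_family_def)
    then obtain c where c: "c \<in> normal_family L'" "conic_rel \<sigma> m11 m12 m21 m22 m31 m32 (1 + l ^ 3, 1, l) c"
      using rel by blast
    then obtain l' where "l' \<in> L' - {0}" "c = (1 + l' ^ 3, 1, l')"
      unfolding normal_family_def by blast
    then show ?thesis using c(2)
      by (auto simp: conic_rel_def l(2) field_aut_simps[OF \<sigma>] simp flip: D_def)
  qed
  have card: "5 \<le> card (\<sigma> ` (L - {0}))" using field_aut_image_subgroup8[OF \<sigma> L(1)] by simp
  have "(m11 ^ 2 + m11 * m21 + m21 ^ 2 + D) + D * m31 ^ 2 * u + 0 * u ^ 2 + (D ^ 3 * m11 ^ 2 + D) * u ^ 3 + 0 * u ^ 4 = 0"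
    if "u \<in> \<sigma> ` (L - {0})" for u
  proof -
    have "(1 + (D * u) ^ 3) * m11 ^ 2 + m11 * m21 + m21 ^ 2 + D * u * m31 ^ 2 + D * (1 + u ^ 3) = 0"
      using eqs[OF that] by simp
    then show ?thesis by (simp add: algebra_simps power_mult_distrib del: add_eq_0_iff_eq)
  qed
  note q1 = quartic_zero[OF card this]
  have "(m12 ^ 2 + m12 * m22 + m22 ^ 2 + D) + D * m32 ^ 2 * u + 0 * u ^ 2 + (D ^ 3 * m12 ^ 2) * u ^ 3 + 0 * u ^ 4 = 0"
    if "u \<in> \<sigma> ` (L - {0})" for u
  proof -
    have "(1 + (D * u) ^ 3) * m12 ^ 2 + m12 * m22 + m22 ^ 2 + D * u * m32 ^ 2 + D = 0"
      using eqs[OF that] by simp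
    then show ?thesis by (simp add: algebra_simps power_mult_distrib del: add_eq_0_iff_eq)
  qed
  note q2 = quartic_zero[OF card this]
  have m: "m31 = 0" "m32 = 0" "m12 = 0" using q1(2) q2(2,4) D0 by simp_all
  then have "m22 ^ 2 = D" using q2(1) by simp
  moreover have "D = m11 * m22" by (simp add: D_def m)
  ultimately have m22: "m22 = m11" using D0 by (simp add: power2_eq_square)
  then have D: "D = m11 ^ 2" using \<open>D = m11 * m22\<close> by (simp add: power2_eq_square)
  have "D * (D ^ 2 * m11 ^ 2) = D * 1" using q1(4) by (simp add: power3_eq_cube power2_eq_square mult.assoc)
  then have "D ^ 2 * m11 ^ 2 = 1" using D0 by (simp only: mult_cancel_left) simp
  \<comment> \<open>With D = m11^2 the condition reads m11^6 = 1; square roots and cube roots are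
    unique.\<close>
  then have "(m11 ^ 3) ^ 2 = 1 ^ 2" by (simp add: D flip: power_mult power_add)
  then have "m11 ^ 3 = 1 ^ 3" by (simp only: power2_eq_iff_char2) simp
  then have m11: "m11 = 1" by (simp only: cube_eq_iff)
  have "m21 * (m21 + 1) = 0" using q1(1) by (simp add: m11 D power2_eq_square algebra_simps)
  then have m21: "m21 = 0 \<or> m21 = 1" by (metis add_eq_0_iff_eq mult_eq_0_iff)
  have "\<sigma> ` (L - {0}) \<subseteq> L'" using eqs D m11 by auto
  moreover have "\<sigma> 0 \<in> L'" using L(2) by (simp add: field_aut_simps[OF \<sigma>] subgroup8_def)
  ultimately have "\<sigma> ` L \<subseteq> L'" by blast
  moreover have "card (\<sigma> ` L) = card L'"
    using L by (subst card_image) (auto simp: inj_on_def field_aut_simps[OF \<sigma>] subgroup8_def)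
  ultimately have "\<sigma> ` L = L'" by (intro card_subset_eq) auto
  then show ?thesis using that[OF \<sigma> _ m21 k] gk by (simp add: m m11 m22)
qed

lemma isomorphic_normal_arcs_iff:
  assumes "subgroup8 L" "subgroup8 L'"
  shows "isomorphic_arcs (normal_arc L) (normal_arc L') \<longleftrightarrow> (\<exists>\<sigma>. field_aut \<sigma> \<and> L' = \<sigma> ` L)"
proof
  assume "isomorphic_arcs (normal_arc L) (normal_arc L')"
  then obtain g where "semilinear g" "cimg g (normal_arc L) = normal_arc L'"
    by (auto simp: isomorphic_arcs_def)
  then show "\<exists>\<sigma>. field_aut \<sigma> \<and> L' = \<sigma> ` L" using normal_arc_isomorphism[OF assms] by metis
next
  assume "\<exists>\<sigma>. field_aut \<sigma> \<and> L' = \<sigma> ` L"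
  then obtain \<sigma> where \<sigma>: "field_aut \<sigma>" "L' = \<sigma> ` L" by blast
  have "semilinear (block_map \<sigma> 1 0 0 1 0 0)" by (rule semilinear_block_map[OF \<sigma>(1)]) simp
  then show "isomorphic_arcs (normal_arc L) (normal_arc L')"
    using cimg_normal_arc[OF \<sigma>(1), of 0 L] \<sigma>(2) unfolding isomorphic_arcs_def by blast
qed

text \<open>For conics with constant alpha one side of the coefficient relation has degree at most 1
  in u, while the other is D (1 + u^3). Hence D = 0, against invertibility.\<close>

lemma normal_arc_not_denniston_form:
  assumes L: "subgroup8 L" and g: "semilinear g" and C: "finite C" "card C \<le> 7" "\<forall>c\<in>C. \<exists>l. c = (\<alpha>, 1, l)"
  shows "cimg g (normal_arc L) \<noteq> mathon_set C"
proof
  assume img: "cimg g (normal_arc L) = mathon_set C"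
  obtain \<sigma> m11 m12 m21 m22 m31 m32 k where \<sigma>: "field_aut \<sigma>" and D: "m11 * m22 + m12 * m21 \<noteq> 0"
    and rel: "\<And>c. c \<in> normal_family L \<Longrightarrow> \<exists>c'\<in>C. conic_rel \<sigma> m11 m12 m21 m22 m31 m32 c c'"
  proof (rule isomorphism_structure[OF g C(1,2)])
    show "normal_family L \<noteq> {}" using L by (rule normal_family_nonempty)
    show "l \<noteq> 0" if "(\<alpha>, \<beta>, l) \<in> normal_family L" for \<alpha> \<beta> l using that by (auto simp: normal_family_def)
    show "cimg g (mathon_set (normal_family L)) \<subseteq> mathon_set C"
      using img by (simp add: normal_arc_def)
  qed blast
  define D where "D = m11 * m22 + m12 * m21"
  have "(\<alpha> * m11 ^ 2 + m11 * m21 + m21 ^ 2 + D) + D * m31 ^ 2 * u + 0 * u ^ 2 + D * u ^ 3 + 0 * u ^ 4 = 0"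
    if u: "u \<in> \<sigma> ` (L - {0})" for u
  proof -
    obtain l where l: "l \<in> L - {0}" "u = \<sigma> l" using u by blast
    then have "(1 + l ^ 3, 1, l) \<in> normal_family L" by (auto simp: normal_family_def)
    then obtain c where "c \<in> C" "conic_rel \<sigma> m11 m12 m21 m22 m31 m32 (1 + l ^ 3, 1, l) c"
      using rel by blast
    moreover from this obtain l' where "c = (\<alpha>, 1, l')" using C(3) by blast
    ultimately have "\<alpha> * m11 ^ 2 + m11 * m21 + m21 ^ 2 + D * u * m31 ^ 2 = D * (1 + u ^ 3)"
      by (auto simp: conic_rel_def l(2) field_aut_simps[OF \<sigma>] simp flip: D_def)
    then have "\<alpha> * m11 ^ 2 + m11 * m21 + m21 ^ 2 + D * u * m31 ^ 2 + D * (1 + u ^ 3) = 0"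
      by simp
    then show ?thesis by (simp add: algebra_simps del: add_eq_0_iff_eq)
  qed
  then have "5 \<le> card (\<sigma> ` (L - {0})) \<Longrightarrow> D = 0" by (rule quartic_zero(4)[rotated])
  then show False using field_aut_image_subgroup8[OF \<sigma> L] D by (simp add: D_def)
qed

text \<open>The seven automorphisms are the Frobenius powers, and the orbit of L has length 1 or 7,
  so either all of them or only the identity stabilize L.\<close>

lemma card_field_aut_stabilizer:
  "card {\<sigma>. field_aut \<sigma> \<and> \<sigma> ` L = L} = (if (\<lambda>x. x ^ 2) ` L = L then 7 else 1)" for L :: "'a set"
proof -
  have auts: "{\<sigma> :: 'a \<Rightarrow> 'a. field_aut \<sigma> \<and> \<sigma> ` L = L}
      = (\<lambda>i x. x ^ (2 ^ i)) ` {i. i < 7 \<and> ((`) (\<lambda>x. x ^ 2) ^^ i) L = L}"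
    by (auto simp: field_aut_iff funpow_image_power2)
  have "\<not> UNIV \<subseteq> {0, 1::'a}" using card_field card_mono[of "{0,1::'a}" UNIV] by auto
  then obtain x :: 'a where x: "x \<noteq> 0" "x \<noteq> 1" by blast
  have "range (\<lambda>i. x ^ (2 ^ i)) = (\<lambda>i. x ^ (2 ^ i)) ` {..<7}"
    using frob_mod[of x] by (auto intro: image_eqI[where x="i mod 7" for i])
  then have "inj_on (\<lambda>i. x ^ (2 ^ i)) {..<7::nat}"
    using frob_orbit_card[OF x] by (intro eq_card_imp_inj_on) auto
  then have inj: "inj_on (\<lambda>i (x::'a). x ^ (2 ^ i)) {..<7::nat}"
    by (auto simp: inj_on_def dest: fun_cong[of _ _ x])
  let ?f = "(`) (\<lambda>x::'a. x ^ 2)"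
  have "{i. i < 7 \<and> (?f ^^ i) L = L} = (if ?f L = L then {..<7} else {0})"
  proof (cases "?f L = L")
    case True
    then have "(?f ^^ i) L = L" for i by (induction i) auto
    then show ?thesis using True by auto
  next
    case False
    have per: "(?f ^^ 7) L = L" unfolding funpow_image_power2 by simp
    have mod: "(?f ^^ m) L = (?f ^^ (m mod 7)) L" for m
      using funpow_mod_eq[OF per] by simp
    have "range (\<lambda>i. (?f ^^ i) L) = (\<lambda>i. (?f ^^ i) L) ` {..<7}"
      using mod by (auto intro: image_eqI[where x="m mod 7" for m])
    then have "inj_on (\<lambda>i. (?f ^^ i) L) {..<7}"
      using orbit_card_7[OF per False] by (intro eq_card_imp_inj_on) auto
    then have "i = 0" if "i < 7" "(?f ^^ i) L = L" for i
      using that by (auto simp: inj_on_def dest: bspec[of _ _ 0])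
    then show ?thesis using False by auto
  qed
  then show ?thesis
    unfolding auts using inj by (subst card_image) (auto intro: inj_on_subset)
qed

text \<open>Scalars act trivially on points, so an automorphism amounts to a field automorphism
  stabilizing L and a bit e; distinct pairs act differently.\<close>

lemma card_aut_group_normal_arc:
  assumes L: "subgroup8 L"
  shows "card (aut_group (normal_arc L)) = (if (\<lambda>x. x ^ 2) ` L = L then 14 else 2)"
proof -
  define F where "F = (\<lambda>(\<sigma>, e) P. if P \<in> points then block_map \<sigma> 1 0 e 1 0 0 ` P else undefined)"
  let ?S = "{\<sigma> :: 'a \<Rightarrow> 'a. field_aut \<sigma> \<and> \<sigma> ` L = L}"
  have semi: "semilinear (block_map \<sigma> 1 0 e 1 0 0)" if "field_aut \<sigma>" for \<sigma> and e :: 'a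
    by (rule semilinear_block_map[OF that]) simp
  have "aut_group (normal_arc L) = F ` (?S \<times> {0, 1})"
  proof (intro equalityI subsetI)
    fix \<phi> assume "\<phi> \<in> aut_group (normal_arc L)"
    then obtain g where g: "semilinear g" "cimg g (normal_arc L) = normal_arc L"
      and \<phi>: "\<phi> = (\<lambda>P. if P \<in> points then g ` P else undefined)"
      unfolding aut_group_def by blast
    obtain \<sigma> e k where \<sigma>: "field_aut \<sigma>" "\<sigma> ` L = L" "e = 0 \<or> e = 1" "k \<noteq> 0"
      "g = (\<lambda>v. vsc k (block_map \<sigma> 1 0 e 1 0 0 v))"
      using normal_arc_isomorphism[OF L L g] by blast
    have "g ` P = block_map \<sigma> 1 0 e 1 0 0 ` P" if P: "P \<in> points" for P
    proof -
      obtain v where v: "P = pclass v" using P by (rule pointsE)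
      have "g ` P = pclass (vsc k (block_map \<sigma> 1 0 e 1 0 0 v))"
        unfolding v semilinear_image_pclass[OF g(1)] unfolding \<sigma>(5) ..
      then show ?thesis
        unfolding v semilinear_image_pclass[OF semi[OF \<sigma>(1)]] by (simp add: pclass_vsc \<sigma>(4))
    qed
    then have "\<phi> = F (\<sigma>, e)" 
      unfolding \<phi> F_def prod.case by (intro ext) simp
    then show "\<phi> \<in> F ` (?S \<times> {0, 1})" using \<sigma> by auto
  next
    fix \<phi> assume "\<phi> \<in> F ` (?S \<times> {0, 1})"
    then obtain \<sigma> e where \<sigma>: "field_aut \<sigma>" "\<sigma> ` L = L" "e = 0 \<or> e = 1" "\<phi> = F (\<sigma>, e)" by auto
    have "cimg (block_map \<sigma> 1 0 e 1 0 0) (normal_arc L) = normal_arc L"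
      using cimg_normal_arc[OF \<sigma>(1,3), of L] \<sigma>(2) by simp
    then show "\<phi> \<in> aut_group (normal_arc L)"
      unfolding \<sigma>(4) F_def prod.case aut_group_def using semi[OF \<sigma>(1)] by blast
  qed
  moreover have "inj_on F (?S \<times> {0, 1})"
  proof (rule inj_onI; clarify)
    fix \<sigma> e \<sigma>' e' assume \<sigma>: "field_aut \<sigma>" "field_aut \<sigma>'" and eq: "F (\<sigma>, e) = F (\<sigma>', e')"
    \<comment> \<open>The point (1, t, 0) goes to (1, \<open>\<sigma>\<close> t + e, 0), and the
      leading 1 fixes the scalar; t = 0 recovers e.\<close>
    have *: "\<sigma> t + e = \<sigma>' t + e'" for t
    proof -
      have "F (\<sigma>, e) (pclass (1, t, 0)) = F (\<sigma>', e') (pclass (1, t, 0))" by (simp only: eq)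
      then have "pclass (block_map \<sigma> 1 0 e 1 0 0 (1, t, 0)) = pclass (block_map \<sigma>' 1 0 e' 1 0 0 (1, t, 0))"
        by (simp add: F_def semilinear_image_pclass[OF semi[OF \<sigma>(1)]] semilinear_image_pclass[OF semi[OF \<sigma>(2)]])
      then obtain k where "block_map \<sigma> 1 0 e 1 0 0 (1, t, 0) = vsc k (block_map \<sigma>' 1 0 e' 1 0 0 (1, t, 0))"
        unfolding pclass_eq_iff by blast
      then show ?thesis
        by (simp add: block_map_apply field_aut_simps[OF \<sigma>(1)] field_aut_simps[OF \<sigma>(2)] add_ac)
    qed
    then have "e = e'" using *[of 0] by (simp add: field_aut_simps[OF \<sigma>(1)] field_aut_simps[OF \<sigma>(2)])
    then show "\<sigma> = \<sigma>' \<and> e = e'" using * by auto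
  qed
  ultimately show ?thesis
    by (simp add: card_image card_cartesian_product card_field_aut_stabilizer)
qed


section \<open>Normal arcs are maximal arcs of proper Mathon type\<close>

lemma isotropicD:
  assumes "L \<in> isotropic"
  shows "subgroup8 L" "\<And>x y. x \<in> L \<Longrightarrow> y \<in> L \<Longrightarrow> polar x y = 0"
    "\<And>x y. x \<in> L \<Longrightarrow> y \<in> L \<Longrightarrow> tr ((x + y) ^ 3) = tr (x ^ 3) + tr (y ^ 3)"
  using assms by (simp_all add: isotropic_def tr_cube_add)

lemma subgroup8D:
  assumes "subgroup8 L"
  shows "0 \<in> L" "\<And>x y. x \<in> L \<Longrightarrow> y \<in> L \<Longrightarrow> x + y \<in> L" "card L = 8"
  using assms by (auto simp: subgroup8_def)

lemma card_additive_support: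
  assumes L: "subgroup8 L" and add: "\<And>x y. x \<in> L \<Longrightarrow> y \<in> L \<Longrightarrow> \<phi> (x + y) = \<phi> x + \<phi> y"
    and val: "\<And>x. \<phi> x = 0 \<or> \<phi> x = (1 :: 'a)"
  shows "card {x \<in> L. \<phi> x = 1} = 0 \<or> card {x \<in> L. \<phi> x = 1} = 4"
proof (cases "\<exists>a\<in>L. \<phi> a = 1")
  case True
  then obtain a where a: "a \<in> L" "\<phi> a = 1" by blast
  have "bij_betw (\<lambda>x. x + a) {x \<in> L. \<phi> x = 0} {x \<in> L. \<phi> x = 1}"
    by (rule bij_betw_byWitness[where f'="\<lambda>x. x + a"]) (use a add subgroup8D(2)[OF L] in \<open>auto simp: add.assoc\<close>)
  then have "card {x \<in> L. \<phi> x = 0} = card {x \<in> L. \<phi> x = 1}" by (rule bij_betw_same_card)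
  moreover have "card {x \<in> L. \<phi> x = 0} + card {x \<in> L. \<phi> x = 1} = card L"
    using val by (subst card_Un_disjoint[symmetric]) (auto intro!: arg_cong[where f=card])
  ultimately show ?thesis using subgroup8D(3)[OF L] by simp
next
  case False
  then have "{x \<in> L. \<phi> x = 1} = {}" by blast
  then show ?thesis by (simp only: card.empty simp_thms)
qed

text \<open>Eliminating z^2 leaves x^2 + x y + y^2 = x^2 (l^2 l' + l l'^2). After division by x^2
  the trace of the left side is 1 and that of the right side is \<open>polar l l'\<close>, which
  isotropy makes 0.\<close>

lemma normal_conics_disjoint:
  assumes L: "L \<in> isotropic" and l: "l \<in> L" "l' \<in> L" "l \<noteq> 0" "l \<noteq> l'" and v: "v \<noteq> (0, 0, 0)"
    and q: "qform (1 + l ^ 3, 1, l) v = 0" "qform (1 + l' ^ 3, 1, l') v = 0"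
  shows False
proof -
  obtain x y z where xyz: "v = (x, y, z)" by (cases v)
  have 1: "(1 + l ^ 3) * x ^ 2 + x * y + y ^ 2 + l * z ^ 2 = 0" "(1 + l' ^ 3) * x ^ 2 + x * y + y ^ 2 + l' * z ^ 2 = 0"
    using q by (simp_all add: xyz del: add_eq_0_iff_eq)
  have "(l + l') * (x ^ 2 + x * y + y ^ 2 + x ^ 2 * (l ^ 2 * l' + l * l' ^ 2))
    = l' * ((1 + l ^ 3) * x ^ 2 + x * y + y ^ 2 + l * z ^ 2) + l * ((1 + l' ^ 3) * x ^ 2 + x * y + y ^ 2 + l' * z ^ 2)"
    by (simp add: algebra_simps power2_eq_square power3_eq_cube)
  then have 2: "x ^ 2 + x * y + y ^ 2 + x ^ 2 * (l ^ 2 * l' + l * l' ^ 2) = 0" unfolding 1 using l by simp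
  show False
  proof (cases "x = 0")
    case True
    then have "y = 0" using 2 by simp
    then show False using True 1(1) l v xyz by simp
  next
    case False
    have "x ^ 2 * (1 + y / x + (y / x) ^ 2 + (l ^ 2 * l' + l * l' ^ 2)) = 0"
      using 2 False by (simp add: distrib_left power_divide power2_eq_square[of x] del: add_eq_0_iff_eq)
    then have "1 + y / x + (y / x) ^ 2 + (l ^ 2 * l' + l * l' ^ 2) = 0" using False by simp
    then have "tr (1 + y / x + (y / x) ^ 2 + (l ^ 2 * l' + l * l' ^ 2)) = 0" by (simp only: tr_0)
    then have "1 + polar l l' = 0" by (simp only: tr_add tr_power2 tr_1 polar_def add.assoc add_self_left)
    then show False using isotropicD(2)[OF L l(1,2)] by simp
  qed
qed

text \<open>Substituting z = a x + b y leaves a binary form A x^2 + x y + B y^2. Its zeros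
  correspond to those of an Artin-Schreier equation with constant A B, which has two solutions or
  none according to the trace.\<close>

lemma card_conic_inter_line:
  assumes l: "l \<noteq> 0"
  shows "card (conic \<alpha> \<beta> l \<inter> pline (a, b, 1)) = (if tr ((\<alpha> + l * a ^ 2) * (\<beta> + l * b ^ 2)) = 0 then 2 else 0)"
proof -
  define A where "A = \<alpha> + l * a ^ 2"
  define B where "B = \<beta> + l * b ^ 2"
  let ?S = "conic \<alpha> \<beta> l \<inter> pline (a, b, 1)"
  have mem: "pclass (x, y, z) \<in> ?S \<longleftrightarrow> (x, y, z) \<noteq> (0, 0, 0) \<and> z = a * x + b * y \<and> A * x ^ 2 + x * y + B * y ^ 2 = 0" for x y z
  proof -
    have "qform (\<alpha>, \<beta>, l) (x, y, a * x + b * y) = A * x ^ 2 + x * y + B * y ^ 2"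
      by (simp add: A_def B_def power_mult_distrib) (simp add: algebra_simps)
    moreover have "vdot (a, b, 1) (x, y, z) = 0 \<longleftrightarrow> z = a * x + b * y" by auto
    ultimately show ?thesis by (auto simp del: qform.simps vdot.simps)
  qed
  have pts: "P \<in> T" if "\<And>x y z. pclass (x, y, z) \<in> ?S \<Longrightarrow> pclass (x, y, z) \<in> T" "P \<in> ?S" for P T
    using that conic_subset_points by (metis IntD1 pointsE subsetD prod_cases3)
  \<comment> \<open>Points of the section are scaled to x = 1; only (0, 1, b) escapes, and it lies
    on the conic exactly when B = 0.\<close>
  have aff: "P \<in> T" if T: "\<And>s. A + s + B * s ^ 2 = 0 \<Longrightarrow> pclass (1, s, a + b * s) \<in> T"
    and P: "P \<in> ?S" and T0: "B = 0 \<Longrightarrow> pclass (0, 1, b) \<in> T" for P T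
  proof (rule pts[OF _ P])
    fix x y z assume "pclass (x, y, z) \<in> ?S"
    then have m: "(x, y, z) \<noteq> (0, 0, 0)" "z = a * x + b * y" "A * x ^ 2 + x * y + B * y ^ 2 = 0" using mem by blast+
    show "pclass (x, y, z) \<in> T"
    proof (cases "x = 0")
      case True
      then have y: "y \<noteq> 0" "B = 0" using m by auto
      have "(x, y, z) = vsc y (0, 1, b)" using m(2) True by simp
      then show ?thesis using T0[OF y(2)] pclass_vsc[OF y(1)] by (simp only:)
    next
      case False
      have "x ^ 2 * (A + y / x + B * (y / x) ^ 2) = A * x ^ 2 + x * y + B * y ^ 2"
        using False by (simp add: distrib_left power_divide power2_eq_square[of x])
      then have "A + y / x + B * (y / x) ^ 2 = 0" using m(3) False by simp
      then have "pclass (1, y / x, a + b * (y / x)) \<in> T" by (rule T)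
      moreover have "(x, y, z) = vsc x (1, y / x, a + b * (y / x))"
        using m(2) False by (simp add: distrib_left)
      ultimately show ?thesis using False by (simp only: pclass_vsc not_False_eq_True)
    qed
  qed
  show ?thesis
  \<comment> \<open>For B = 0 the form is x (A x + y) with two zeros, in agreement with tr 0 = 0.
    Otherwise w = B s turns the root condition into w^2 + w = A B.\<close>
  proof (cases "B = 0")
    case True
    have "?S = {pclass (0, 1, b), pclass (1, A, a + b * A)}"
    proof (intro equalityI subsetI)
      fix P assume "P \<in> ?S"
      then show "P \<in> {pclass (0, 1, b), pclass (1, A, a + b * A)}"
        by (rule aff[rotated]) (auto simp: True)
    next
      fix P assume "P \<in> {pclass (0, 1, b), pclass (1, A, a + b * A)}"
      then show "P \<in> ?S" using mem[of 0 1 b] mem[of 1 A "a + b * A"] True by (auto simp del: Int_iff)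
    qed
    moreover have "pclass (0, 1, b) \<noteq> pclass (1, A, a + b * A)" by (auto simp: pclass_eq_iff)
    ultimately show ?thesis using True by (simp flip: B_def)
  next
    case B: False
    have root: "A + s + B * s ^ 2 = 0 \<longleftrightarrow> (B * s) ^ 2 + B * s = A * B" for s
    proof -
      have "B * (A + s + B * s ^ 2) = A * B + ((B * s) ^ 2 + B * s)"
        by (simp add: algebra_simps power2_eq_square)
      then show ?thesis using B by (metis add_eq_0_iff_eq mult_eq_0_iff)
    qed
    show ?thesis
    proof (cases "tr (A * B) = 0")
      case True
      then obtain w where w: "w ^ 2 + w = A * B" using artin_schreier by blast
      let ?p = "\<lambda>w. pclass (1, w / B, a + b * (w / B))"
      have "?S = {?p w, ?p (w + 1)}"
      proof (intro equalityI subsetI)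
        fix P assume "P \<in> ?S"
        then show "P \<in> {?p w, ?p (w + 1)}"
        proof (rule aff[rotated])
          fix s assume "A + s + B * s ^ 2 = 0"
          then have "(B * s) ^ 2 + B * s = w ^ 2 + w" using root w by simp
          moreover have "(B * s + w) * (B * s + (w + 1)) = ((B * s) ^ 2 + B * s) + (w ^ 2 + w)"
            by (simp add: algebra_simps power2_eq_square)
          ultimately have "B * s = w \<or> B * s = w + 1" by (metis add_self add_eq_0_iff_eq mult_eq_0_iff)
          then have "s = w / B \<or> s = (w + 1) / B" using B by (metis nonzero_mult_div_cancel_left)
          then show "pclass (1, s, a + b * s) \<in> {?p w, ?p (w + 1)}" by blast
        qed (use B in simp)
      next
        have "?p u \<in> ?S" if "u ^ 2 + u = A * B" for u
        proof -
          have "A + u / B + B * (u / B) ^ 2 = 0" unfolding root using B that by simp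
          then show ?thesis unfolding mem by simp
        qed
        moreover have "(w + 1) ^ 2 + (w + 1) = A * B" using w by (simp add: algebra_simps)
        ultimately show "P \<in> ?S" if "P \<in> {?p w, ?p (w + 1)}" for P using w that by blast
      qed
      moreover have "?p w \<noteq> ?p (w + 1)" using B by (auto simp: pclass_eq_iff)
      ultimately show ?thesis using True by (simp flip: A_def B_def)
    next
      case False
      have "P \<in> {}" if "P \<in> ?S" for P
      proof (rule aff[OF _ that])
        fix s assume "A + s + B * s ^ 2 = 0"
        then have "tr (A * B) = tr ((B * s) ^ 2 + B * s)" using root by simp
        then have "tr (A * B) = 0" by (simp only: tr_add tr_power2 add_self)
        then show "pclass (1, s, a + b * s) \<in> {}" using False by simp
      qed (use B in simp)
      then have "?S = {}" by blast
      then show ?thesis using False by (simp flip: A_def B_def)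
    qed
  qed
qed

lemma pline_vsc: assumes "k \<noteq> 0" shows "pline (vsc k w) = pline w"
proof (rule points_set_eqI)
  show "pclass v \<in> pline (vsc k w) \<longleftrightarrow> pclass v \<in> pline w" for v
  proof -
    have "vdot (vsc k w) v = k * vdot w v" by (cases w; cases v) (simp add: algebra_simps)
    then show ?thesis using assms by simp
  qed
qed (rule pline_subset_points)+

lemma normal_arc_eq: "normal_arc L = insert (pclass (0, 0, 1)) (\<Union>l\<in>L-{0}. conic (1 + l ^ 3) 1 l)"
  by (auto simp: normal_arc_def mathon_set_def normal_family_def)

text \<open>The line meets the conic of index l, in two points, iff \<open>\<phi> l = 1\<close>. The
  trace replaces squares by their roots, and isotropy makes tr (l^3) additive on L; so
  \<open>\<phi>\<close> is additive on L and takes the value 1 at 0 or 4 indices.\<close>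

lemma normal_arc_secant:
  assumes L: "L \<in> isotropic"
  shows "card (normal_arc L \<inter> pline (a, b, 1)) \<in> {0, 8}"
proof -
  note sub = isotropicD(1)[OF L]
  define \<phi> where "\<phi> l = tr (l ^ 3) + tr (l * a ^ 2) + tr (l * b ^ 2) + tr (l ^ 2 * b) + tr (l * a * b)" for l
  have tr_eq: "tr ((1 + l ^ 3 + l * a ^ 2) * (1 + l * b ^ 2)) = 1 + \<phi> l" for l
  proof -
    have "(1 + l ^ 3 + l * a ^ 2) * (1 + l * b ^ 2)
      = 1 + l ^ 3 + l * a ^ 2 + l * b ^ 2 + (l ^ 2 * b) ^ 2 + (l * a * b) ^ 2"
      by (simp add: algebra_simps power2_eq_square power3_eq_cube)
    then show ?thesis by (simp only: tr_add tr_power2 tr_1 \<phi>_def add.assoc)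
  qed
  have "\<phi> (x + y) = \<phi> x + \<phi> y" if "x \<in> L" "y \<in> L" for x y
    unfolding \<phi>_def using isotropicD(3)[OF L that] by (simp add: distrib_right tr_add add_ac)
  moreover have "\<phi> x = 0 \<or> \<phi> x = 1" for x
    using tr_eq[of x] tr_values[of "(1 + x ^ 3 + x * a ^ 2) * (1 + x * b ^ 2)"] by (auto simp: add_eq_iff)
  ultimately have card: "card {x \<in> L. \<phi> x = 1} = 0 \<or> card {x \<in> L. \<phi> x = 1} = 4"
    by (rule card_additive_support[OF sub])
  have "pclass (0, 0, 1) \<notin> pline (a, b, 1)" by simp
  then have "normal_arc L \<inter> pline (a, b, 1) = (\<Union>l\<in>L-{0}. conic (1 + l ^ 3) 1 l \<inter> pline (a, b, 1))"
    unfolding normal_arc_eq by blast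
  also have "card \<dots> = (\<Sum>l\<in>L-{0}. card (conic (1 + l ^ 3) 1 l \<inter> pline (a, b, 1)))"
  proof (rule card_UN_disjoint)
    show "\<forall>i\<in>L - {0}. \<forall>j\<in>L - {0}. i \<noteq> j \<longrightarrow>
        conic (1 + i ^ 3) 1 i \<inter> pline (a, b, 1) \<inter> (conic (1 + j ^ 3) 1 j \<inter> pline (a, b, 1)) = {}"
    proof (intro ballI impI, rule ccontr)
      fix i j assume ij: "i \<in> L - {0}" "j \<in> L - {0}" "i \<noteq> j"
        and "conic (1 + i ^ 3) 1 i \<inter> pline (a, b, 1) \<inter> (conic (1 + j ^ 3) 1 j \<inter> pline (a, b, 1)) \<noteq> {}"
      then obtain P where P: "P \<in> conic (1 + i ^ 3) 1 i" "P \<in> conic (1 + j ^ 3) 1 j" by blast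
      then obtain v where v: "P = pclass v" "v \<noteq> (0, 0, 0)" using conic_subset_points by (metis pointsE subsetD)
      then show False using normal_conics_disjoint[OF L, of i j v] ij P
        by (simp del: qform.simps)
    qed
  qed auto
  also have "\<dots> = (\<Sum>l\<in>L-{0}. if 1 + \<phi> l = 0 then 2 else 0)"
    by (intro sum.cong refl) (simp add: card_conic_inter_line tr_eq del: add_eq_0_iff_eq)
  also have "\<dots> = 2 * card {l \<in> L - {0}. 1 + \<phi> l = 0}"
    by (simp add: sum.If_cases Int_def)
  \<comment> \<open>Index 0 carries no conic, but \<open>\<phi> 0 = 0\<close>, so including it
    changes nothing.\<close>
  also have "{l \<in> L - {0}. 1 + \<phi> l = 0} = {l \<in> L. \<phi> l = 1}"
    by (auto simp: \<phi>_def)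
  finally show ?thesis using card by auto
qed

text \<open>These are the lines through (0, 0, 1), the common nucleus of the conics. By uniqueness
  of square roots each meets every conic exactly once, and disjointness keeps the seven points
  apart: 7 + 1 = 8.\<close>

lemma normal_arc_tangent:
  assumes L: "L \<in> isotropic" and w: "(w1, w2) \<noteq> (0, 0)"
  shows "card (normal_arc L \<inter> pline (w1, w2, 0)) = 8"
proof -
  note sub = isotropicD(1)[OF L]
  define z where "z l = sq_root (((1 + l ^ 3) * w2 ^ 2 + w2 * w1 + w1 ^ 2) / l)" for l
  have z: "qform (1 + l ^ 3, 1, l) (w2, w1, u) = 0 \<longleftrightarrow> u = z l" if "l \<noteq> 0" for l u
  proof -
    have "u = z l \<longleftrightarrow> u ^ 2 = (z l) ^ 2" by simp
    also have "\<dots> \<longleftrightarrow> l * u ^ 2 = (1 + l ^ 3) * w2 ^ 2 + w2 * w1 + w1 ^ 2"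
      using that by (simp add: z_def field_simps del: power2_eq_iff_char2)
    also have "\<dots> \<longleftrightarrow> qform (1 + l ^ 3, 1, l) (w2, w1, u) = 0"
      by simp metis
    finally show ?thesis by simp
  qed
  have eq: "normal_arc L \<inter> pline (w1, w2, 0) = insert (pclass (0, 0, 1)) ((\<lambda>l. pclass (w2, w1, z l)) ` (L - {0}))"
    (is "?A = ?B")
  proof (rule points_set_eqI)
    show "?A \<subseteq> points" using pline_subset_points by blast
    show "?B \<subseteq> points" using w by auto
    fix v :: "'a vec3" assume v: "v \<noteq> (0, 0, 0)"
    obtain x y u where xyz: "v = (x, y, u)" by (cases v)
    show "pclass v \<in> ?A \<longleftrightarrow> pclass v \<in> ?B"
    proof
      assume "pclass v \<in> ?A"
      then have "pclass v \<in> pline (w1, w2, 0)" "pclass v \<in> normal_arc L" by blast+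
      then have dot: "w1 * x + w2 * y = 0" and m: "pclass v = pclass (0, 0, 1) \<or> (\<exists>l\<in>L-{0}. qform (1 + l ^ 3, 1, l) v = 0)"
        by (simp add: xyz, auto simp: normal_arc_eq simp del: qform.simps)
      show "pclass v \<in> ?B"
      proof (cases "pclass v = pclass (0, 0, 1)")
        case False
        then obtain l where l: "l \<in> L - {0}" "qform (1 + l ^ 3, 1, l) v = 0" using m by blast
        obtain t where t: "x = t * w2" "y = t * w1"
        proof (cases "w1 = 0")
          case True
          then have "w2 \<noteq> 0" "y = 0" using w dot by auto
          then show ?thesis using that[of "x / w2"] True by simp
        next
          case False
          then show ?thesis using that[of "y / w1"] dot by (simp add: field_simps)
        qed
        have "t \<noteq> 0"
        proof
          assume "t = 0"
          then have "v = vsc u (0, 0, 1)" by (simp add: xyz t)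
          moreover have "u \<noteq> 0" using v \<open>t = 0\<close> by (simp add: xyz t)
          ultimately show False using False by (simp only: pclass_vsc not_False_eq_True)
        qed
        then have vs: "v = vsc t (w2, w1, u / t)" by (simp add: xyz t)
        have "qform (1 + l ^ 3, 1, l) (w2, w1, u / t) = 0"
          using l(2) \<open>t \<noteq> 0\<close> unfolding vs qform_vsc by (simp del: qform.simps)
        then have "u / t = z l" using z l(1) by blast
        then have "pclass v = pclass (w2, w1, z l)" using vs \<open>t \<noteq> 0\<close> by (simp only: pclass_vsc not_False_eq_True)
        then show ?thesis using l(1) by blast
      qed simp
    next
      assume "pclass v \<in> ?B"
      moreover have "pclass (0, 0, 1) \<in> ?A" by (simp add: normal_arc_eq)
      moreover have "pclass (w2, w1, z l) \<in> ?A" if "l \<in> L - {0}" for l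
        using that w z[of l "z l"] by (auto simp: normal_arc_eq mult.commute simp del: qform.simps)
      ultimately show "pclass v \<in> ?A" by (elim insertE imageE) (metis, metis)
    qed
  qed
  have "inj_on (\<lambda>l. pclass (w2, w1, z l)) (L - {0})"
  proof (rule inj_onI, rule ccontr)
    fix i j assume ij: "i \<in> L - {0}" "j \<in> L - {0}" "pclass (w2, w1, z i) = pclass (w2, w1, z j)" "i \<noteq> j"
    obtain k where k: "k \<noteq> 0" "(w2, w1, z i) = vsc k (w2, w1, z j)" using ij(3) by (auto simp: pclass_eq_iff)
    have "qform (1 + j ^ 3, 1, j) (w2, w1, z i) = 0"
      unfolding k(2) qform_vsc using z[of j "z j"] ij(2) by (simp del: qform.simps)
    moreover have "qform (1 + i ^ 3, 1, i) (w2, w1, z i) = 0" using z[of i "z i"] ij(1) by blast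
    ultimately show False using normal_conics_disjoint[OF L, of i j "(w2, w1, z i)"] ij w by auto
  qed
  then have "card ((\<lambda>l. pclass (w2, w1, z l)) ` (L - {0})) = 7"
    using card_subgroup8_minus_0[OF sub] by (simp add: card_image)
  moreover have "pclass (0, 0, 1) \<notin> (\<lambda>l. pclass (w2, w1, z l)) ` (L - {0})"
    using w by (auto simp: pclass_eq_iff)
  ultimately show ?thesis unfolding eq by simp
qed

theorem maximal_arc_normal_arc:
  assumes L: "L \<in> isotropic" shows "maximal_arc (normal_arc L) 8"
proof -
  have "card (normal_arc L \<inter> M) = 0 \<or> card (normal_arc L \<inter> M) = 8" if M: "M \<in> lines" for M
  proof -
    obtain w where w: "M = pline w" "w \<noteq> (0, 0, 0)" using M by (auto simp: lines_def)
    obtain w1 w2 w3 where w': "w = (w1, w2, w3)" by (cases w)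
    show ?thesis
    proof (cases "w3 = 0")
      case True
      then show ?thesis using normal_arc_tangent[OF L, of w1 w2] w w' by auto
    next
      case False
      have "w = vsc w3 (w1 / w3, w2 / w3, 1)" using False by (simp add: w')
      then have "M = pline (w1 / w3, w2 / w3, 1)" using w(1) pline_vsc[OF False] by metis
      then show ?thesis using normal_arc_secant[OF L, of "w1 / w3" "w2 / w3"] by auto
    qed
  qed
  moreover have "normal_arc L \<noteq> points"
  proof -
    have "pclass (0, 1, 0) \<noteq> pclass (0, 0, 1 :: 'a)" by (auto simp: pclass_eq_iff)
    then have "pclass (0, 1, 0 :: 'a) \<notin> normal_arc L" by (simp add: normal_arc_eq)
    moreover have "pclass (0, 1, 0 :: 'a) \<in> points" by simp
    ultimately show ?thesis by blast
  qed
  moreover have "normal_arc L \<noteq> {}" by (simp add: normal_arc_eq)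
  ultimately show ?thesis
    unfolding maximal_arc_def by (simp add: normal_arc_def mathon_set_subset_points)
qed

text \<open>Averaging: if every \<open>s\<close> failed, then each would fail for exactly four \<open>l\<close>, but every
  nonzero \<open>l\<close> fails for only half of the \<open>s\<close>, and \<open>7 * 64 < 4 * 128\<close>.\<close>

lemma trace_cube_functional:
  assumes L: "L \<in> isotropic"
  obtains s where "\<And>l. l \<in> L \<Longrightarrow> tr (l ^ 3) = tr (s * l)"
proof -
  note sub = isotropicD(1)[OF L]
  define bad where "bad s = {l \<in> L. tr (l ^ 3) + tr (s * l) = 1}" for s
  have bad: "card (bad s) = 0 \<or> card (bad s) = 4" for s
    unfolding bad_def
  proof (rule card_additive_support[OF sub])
    show "tr ((x + y) ^ 3) + tr (s * (x + y)) = tr (x ^ 3) + tr (s * x) + (tr (y ^ 3) + tr (s * y))"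
      if "x \<in> L" "y \<in> L" for x y
      using isotropicD(3)[OF L that] by (simp add: distrib_left tr_add add_ac)
    show "tr (x ^ 3) + tr (s * x) = 0 \<or> tr (x ^ 3) + tr (s * x) = 1" for x
      using tr_values[of "x ^ 3 + s * x"] by (simp add: tr_add del: add_eq_0_iff_eq)
  qed
  have "card {s. tr (l ^ 3) + tr (s * l) = 1} = 64" if l: "l \<noteq> 0" for l
  proof -
    obtain a where a: "tr (a * l) = 1" using tr_nondegenerate[OF l] by (metis mult.commute)
    have "{s. tr (l ^ 3) + tr (s * l) = 1} = (if tr (l ^ 3) = 0 then {s. tr (s * l) = 1} else {s. tr (s * l) = 0})"
      using tr_values[of "l ^ 3"] by (auto simp: add_eq_iff)
    moreover have "card {s. tr (s * l) = 0} = 64" "card {s. tr (s * l) = 1} = 64"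
      using card_additive_kernel[of "\<lambda>s. tr (s * l)" a] a
      by (simp_all add: distrib_right tr_add tr_values)
    ultimately show ?thesis by simp
  qed
  then have "(\<Sum>l\<in>L-{0}. card {s. tr (l ^ 3) + tr (s * l) = 1}) = 7 * 64"
    using card_subgroup8_minus_0[OF sub] by simp
  moreover have "(\<Sum>s\<in>UNIV. card (bad s)) = (\<Sum>l\<in>L-{0}. card {s. tr (l ^ 3) + tr (s * l) = 1})"
  proof -
    have "bad s = {l \<in> L - {0}. tr (l ^ 3) + tr (s * l) = 1}" for s by (auto simp: bad_def)
    then have "(\<Sum>s\<in>UNIV. card (bad s)) = (\<Sum>s\<in>UNIV. \<Sum>l\<in>L-{0}. if tr (l ^ 3) + tr (s * l) = 1 then 1 else 0)"
      by (simp add: sum.If_cases Int_def)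
    also have "\<dots> = (\<Sum>l\<in>L-{0}. \<Sum>s\<in>UNIV. if tr (l ^ 3) + tr (s * l) = 1 then 1 else 0)"
      by (rule sum.swap)
    finally show ?thesis by (simp add: sum.If_cases)
  qed
  moreover have "(\<Sum>s\<in>(UNIV::'a set). card (bad s)) = 128 * 4" if "\<And>s. card (bad s) \<noteq> 0"
    using bad that by (simp add: card_field)
  ultimately obtain s where "card (bad s) = 0" by auto
  then have "bad s = {}" by simp
  then have "tr (l ^ 3) = tr (s * l)" if "l \<in> L" for l
    using that tr_values[of "l ^ 3 + s * l"] unfolding bad_def tr_add by fastforce
  then show ?thesis by (rule that)
qed

text \<open>Adding s l to alpha(l) corrects the trace of alpha beta to 1 and keeps l alpha(l)
  additive, hence the family closed. Adding \<open>sq_root s\<close> times x to z maps this family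
  back to the normal form.\<close>

theorem mathon_type_normal_arc:
  assumes L: "L \<in> isotropic" shows "mathon_type 7 (normal_arc L)"
proof -
  note sub = isotropicD(1)[OF L]
  obtain s where s: "\<And>l. l \<in> L \<Longrightarrow> tr (l ^ 3) = tr (s * l)" using trace_cube_functional[OF L] by blast
  define C where "C = (\<lambda>l. (1 + s * l + l ^ 3, 1 :: 'a, l)) ` (L - {0})"
  have "mathon_family 7 C"
    unfolding mathon_family_def
  proof (intro conjI ballI impI)
    show "finite C" by simp
    show "inj_on (\<lambda>c. snd (snd c)) C" by (auto simp: inj_on_def C_def)
    show "case c of (\<alpha>, \<beta>, l) \<Rightarrow> tr (\<alpha> * \<beta>) = 1 \<and> l \<noteq> 0" if "c \<in> C" for c
      using that s by (auto simp: C_def tr_add)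
    fix c c' assume "c \<in> C" "c' \<in> C" "c \<noteq> c'"
    then obtain l l' where l: "l \<in> L - {0}" "l' \<in> L - {0}" "l \<noteq> l'"
      "c = (1 + s * l + l ^ 3, 1, l)" "c' = (1 + s * l' + l' ^ 3, 1, l')"
      by (auto simp: C_def)
    have "(1 + s * l + l ^ 3) * l + (1 + s * l' + l' ^ 3) * l' = (1 + s * (l + l') + (l + l') ^ 3) * (l + l')"
      by (simp add: algebra_simps power3_eq_cube)
    moreover have ne: "l + l' \<noteq> 0" using l(3) by simp
    ultimately have "oplus c c' = (1 + s * (l + l') + (l + l') ^ 3, 1, l + l')"
      unfolding l oplus.simps by (simp del: add_eq_0_iff_eq)
    moreover have "l + l' \<in> L - {0}" using l ne subgroup8D(2)[OF sub] by blast
    ultimately show "oplus c c' \<in> C" unfolding C_def by blast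
  qed
  moreover have "field_aut (id :: 'a \<Rightarrow> 'a)" by (simp add: field_aut_def)
  moreover from this have "cimg (block_map id 1 0 0 1 (sq_root s) 0) (mathon_set C) = normal_arc L"
    unfolding normal_arc_def
  proof (rule cimg_block_map_mathon_set)
    have rel: "conic_rel id 1 0 0 1 (sq_root s) 0 (1 + s * l + l ^ 3, 1, l) (1 + l ^ 3, 1, l)" for l
      by (simp add: conic_rel_def add_ac mult.commute)
    show "\<exists>c'\<in>normal_family L. conic_rel id 1 0 0 1 (sq_root s) 0 c c'" if "c \<in> C" for c
      using that rel unfolding C_def normal_family_def by blast
    show "\<exists>c\<in>C. conic_rel id 1 0 0 1 (sq_root s) 0 c c'" if "c' \<in> normal_family L" for c'
      using that rel unfolding C_def normal_family_def by blast
  qed simp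
  moreover have "semilinear (block_map id 1 0 0 1 (sq_root s) 0)"
    by (rule semilinear_block_map) (simp_all add: field_aut_def)
  ultimately show ?thesis unfolding mathon_type_def by metis
qed

text \<open>The line x = 0 contains (0, 0, 1) and one point of each conic, determined by beta / l.
  If two conics had the same ratio k, their sum would have beta'' = k (l + l') and alpha'' beta'' =
  alpha beta + alpha' beta', of trace 1 + 1 = 0 instead of 1. So the line carries one point more
  than there are conics.\<close>

lemma card_mathon_family:
  assumes C: "mathon_family 7 (C :: 'a vec3 set)" and K: "maximal_arc (mathon_set C) 8"
  shows "card C = 7"
proof -
  have fam: "tr (\<alpha> * \<beta>) = 1" "l \<noteq> 0" if "(\<alpha>, \<beta>, l) \<in> C" for \<alpha> \<beta> l
    using C that unfolding mathon_family_def by blast+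
  define F where "F c = (case c of (\<alpha>, \<beta>, l) \<Rightarrow> pclass (0, 1, sq_root (\<beta> / l)))" for c :: "'a vec3"
  have eq: "mathon_set C \<inter> pline (1, 0, 0) = insert (pclass (0, 0, 1)) (F ` C)" (is "?A = ?B")
  proof (rule points_set_eqI)
    show "?A \<subseteq> points" using pline_subset_points by blast
    show "?B \<subseteq> points" by (auto simp: F_def)
    fix v :: "'a vec3" assume v: "v \<noteq> (0, 0, 0)"
    obtain x y z where xyz: "v = (x, y, z)" by (cases v)
    have sq: "\<beta> * y ^ 2 + l * z ^ 2 = 0 \<longleftrightarrow> z = y * sq_root (\<beta> / l)" if "l \<noteq> 0" for \<beta> l
    proof -
      have "z = y * sq_root (\<beta> / l) \<longleftrightarrow> z ^ 2 = (y * sq_root (\<beta> / l)) ^ 2" by (simp only: power2_eq_iff_char2)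
      then show ?thesis using that by (auto simp: power_mult_distrib field_simps)
    qed
    show "pclass v \<in> ?A \<longleftrightarrow> pclass v \<in> ?B"
    proof
      assume "pclass v \<in> ?A"
      then have x: "x = 0" and m: "pclass v = pclass (0, 0, 1) \<or> (\<exists>c\<in>C. qform c v = 0)"
        by (auto simp: xyz pclass_mem_mathon_set simp del: qform.simps)
      show "pclass v \<in> ?B"
      proof (cases "pclass v = pclass (0, 0, 1)")
        case False
        then obtain \<alpha> \<beta> l where c: "(\<alpha>, \<beta>, l) \<in> C" "qform (\<alpha>, \<beta>, l) v = 0" using m by (metis prod_cases3)
        then have z: "z = y * sq_root (\<beta> / l)" using sq[OF fam(2)[OF c(1)]] by (simp add: xyz x)
        then have "v = vsc y (0, 1, sq_root (\<beta> / l))" "y \<noteq> 0" using v by (auto simp: xyz x)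
        then have "pclass v = F (\<alpha>, \<beta>, l)" unfolding F_def prod.case by (simp only: pclass_vsc not_False_eq_True)
        then show ?thesis using c(1) by blast
      qed simp
    next
      assume "pclass v \<in> ?B"
      moreover have "pclass (0, 0, 1) \<in> ?A" by (simp add: pclass_mem_mathon_set)
      moreover have "F c \<in> ?A" if c: "c \<in> C" for c
      proof -
        obtain \<alpha> \<beta> l where c': "c = (\<alpha>, \<beta>, l)" by (cases c)
        have "qform c (0, 1, sq_root (\<beta> / l)) = 0" using fam(2) c unfolding c' by simp
        then show ?thesis using c unfolding c' F_def prod.case by (auto simp: pclass_mem_mathon_set simp del: qform.simps)
      qed
      ultimately show "pclass v \<in> ?A" by (elim insertE imageE) (metis, metis)
    qed
  qed
  have "inj_on F C"
  proof (rule inj_onI, rule ccontr)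
    fix c c' assume c: "c \<in> C" "c' \<in> C" "F c = F c'" "c \<noteq> c'"
    obtain \<alpha> \<beta> l where c1: "c = (\<alpha>, \<beta>, l)" by (cases c)
    obtain \<alpha>' \<beta>' l' where c2: "c' = (\<alpha>', \<beta>', l')" by (cases c')
    have ne: "l \<noteq> l'" using C c c1 c2 unfolding mathon_family_def inj_on_def by (metis snd_conv)
    have "sq_root (\<beta> / l) = sq_root (\<beta>' / l')" using c(3) by (auto simp: c1 c2 F_def pclass_eq_iff)
    then have "\<beta> / l = \<beta>' / l'" by (metis sq_root_power2(1))
    define k where "k = \<beta> / l"
    have "l \<noteq> 0" "l' \<noteq> 0" using fam(2) c c1 c2 by blast+
    then have k: "\<beta> = k * l" "\<beta>' = k * l'"
      unfolding k_def by simp (simp add: \<open>\<beta> / l = \<beta>' / l'\<close> \<open>l' \<noteq> 0\<close>)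
    have "oplus c c' \<in> C" using C c unfolding mathon_family_def by blast
    then have "tr ((\<alpha> * l + \<alpha>' * l') / (l + l') * ((\<beta> * l + \<beta>' * l') / (l + l'))) = 1"
      unfolding c1 c2 oplus.simps by (rule fam(1))
    moreover have "(\<beta> * l + \<beta>' * l') / (l + l') = k * (l + l')"
    proof -
      have "\<beta> * l + \<beta>' * l' = k * (l + l') * (l + l')" unfolding k by (simp add: algebra_simps)
      then show ?thesis using ne by simp
    qed
    moreover have "(\<alpha> * l + \<alpha>' * l') / (l + l') * (k * (l + l')) = \<alpha> * \<beta> + \<alpha>' * \<beta>'"
    proof -
      have "(\<alpha> * l + \<alpha>' * l') / (l + l') * (k * (l + l')) = k * (\<alpha> * l + \<alpha>' * l')"
        using ne by simp
      then show ?thesis unfolding k by (simp add: algebra_simps)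
    qed
    ultimately have "tr (\<alpha> * \<beta> + \<alpha>' * \<beta>') = 1" by (simp only:)
    then show False using fam(1) c c1 c2 by (simp add: tr_add)
  qed
  then have "card (F ` C) = card C" by (rule card_image)
  moreover have "pclass (0, 0, 1) \<notin> F ` C" by (auto simp: F_def pclass_eq_iff)
  ultimately have "card (mathon_set C \<inter> pline (1, 0, 0)) = Suc (card C)" unfolding eq by simp
  moreover have "pline (1, 0, 0 :: 'a) \<in> lines" 
    unfolding lines_def by (intro CollectI exI[of _ "(1, 0, 0)"]) simp
  ultimately show ?thesis using K unfolding maximal_arc_def by fastforce
qed

text \<open>An isomorphic Denniston arc again has degree 8, hence seven conics, few enough for the
  coefficient comparison.\<close>

theorem proper_mathon_type_normal_arc:
  assumes L: "L \<in> isotropic" shows "proper_mathon_type 7 (normal_arc L)"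
  unfolding proper_mathon_type_def
proof (intro conjI notI)
  show "mathon_type 7 (normal_arc L)" by (rule mathon_type_normal_arc[OF L])
  assume "denniston_type 7 (normal_arc L)"
  then obtain C \<alpha> where C: "mathon_family 7 C" "\<forall>c\<in>C. \<exists>l. c = (\<alpha>, 1, l)"
    and iso: "isomorphic_arcs (normal_arc L) (mathon_set C)"
    unfolding denniston_type_iff by (metis isomorphic_arcs_sym)
  have "maximal_arc (mathon_set C) 8"
    using maximal_arc_iso[OF iso maximal_arc_normal_arc[OF L]] .
  then have "card C = 7" by (rule card_mathon_family[OF C(1)])
  moreover obtain g where "semilinear g" "cimg g (normal_arc L) = mathon_set C"
    using iso by (auto simp: isomorphic_arcs_def)
  moreover have "finite C" by simp
  ultimately show False using normal_arc_not_denniston_form[OF isotropicD(1)[OF L]] C(2) by (metis order_refl)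
qed


section \<open>Reduction to normal form\<close>

lemma power3_add: "((x::'a) + y) ^ 3 = x ^ 3 + x ^ 2 * y + x * y ^ 2 + y ^ 3"
  by (simp add: numeral_eq_Suc algebra_simps)

lemma power4_add: "((x::'a) + y) ^ 4 = x ^ 4 + y ^ 4"
  using power_2pow_add[of x y 2] by simp

text \<open>Newton interpolation with additive polynomials: l, Q and R have degrees 1, 2, 4, Q
  vanishes on {0, a} and R on {0, a, b, a + b}. Matching F at a, b, c is therefore a triangular
  system.\<close>

lemma additive_interpolation:
  assumes L: "subgroup8 L" and add: "\<And>x y. x \<in> L \<Longrightarrow> y \<in> L \<Longrightarrow> F (x + y) = F x + (F y :: 'a)"
  obtains p0 p1 p2 where "\<And>l. l \<in> L \<Longrightarrow> F l = p0 * l + p1 * l ^ 2 + p2 * l ^ 4"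
proof -
  obtain a b c where span: "L = span3 a b c" and ind: "a \<noteq> 0" "b \<notin> {0, a}" "c \<notin> {0, a, b, a + b}"
    using subgroup8_basis[OF L] by blast
  define Q where "Q l = l ^ 2 + a * l" for l
  have Q_add: "Q (x + y) = Q x + Q y" for x y by (simp add: Q_def distrib_left add_ac)
  have Q_0: "Q l = 0 \<longleftrightarrow> l = 0 \<or> l = a" for l
  proof -
    have "Q l = l * (l + a)" by (simp add: Q_def algebra_simps power2_eq_square)
    then show ?thesis by simp
  qed
  define R where "R l = Q l ^ 2 + Q b * Q l" for l
  have R_add: "R (x + y) = R x + R y" for x y by (simp add: R_def Q_add distrib_left add_ac)
  have R_c: "R c \<noteq> 0"
  proof -
    have "R c = Q c * Q (c + b)" by (simp add: R_def Q_add algebra_simps power2_eq_square)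
    then show ?thesis using ind by (auto simp: Q_0 add_eq_iff)
  qed
  have Q: "Q a = 0" "Q b \<noteq> 0" and R: "R a = 0" "R b = 0"
    using ind by (auto simp: Q_0 R_def power2_eq_square)
  define t0 where "t0 = F a / a"
  define t1 where "t1 = (F b + t0 * b) / Q b"
  define t2 where "t2 = (F c + t0 * c + t1 * Q c) / R c"
  define G where "G l = t0 * l + t1 * Q l + t2 * R l" for l
  have G_add: "G (x + y) = G x + G y" for x y by (simp add: G_def Q_add R_add distrib_left add_ac)
  have abc: "G a = F a" "G b = F b" "G c = F c"
    using ind(1) Q R R_c by (simp_all add: G_def t0_def t1_def t2_def add_ac)
  have mem: "0 \<in> L" "a \<in> L" "b \<in> L" "c \<in> L" "a + b \<in> L" by (auto simp: span span3_def)
  have "F 0 = 0" using add[OF mem(1,1)] by simp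
  moreover have "G 0 = 0" using G_add[of 0 0] by simp
  ultimately have FG: "F l = G l" if "l \<in> L" for l
    using that unfolding span span3_def
    by (elim insertE emptyE; simp add: add mem G_add abc)
  have "G l = (t0 + t1 * a + t2 * Q b * a) * l + (t1 + t2 * (a ^ 2 + Q b)) * l ^ 2 + t2 * l ^ 4" for l
    by (simp add: G_def R_def) (simp add: Q_def algebra_simps power_mult_distrib flip: power_mult)
  then have "F l = (t0 + t1 * a + t2 * Q b * a) * l + (t1 + t2 * (a ^ 2 + Q b)) * l ^ 2 + t2 * l ^ 4"
    if "l \<in> L" for l
    using FG[OF that] by (rule trans[rotated])
  then show ?thesis by (rule that)
qed

text \<open>Closure under \<open>oplus\<close> makes \<open>l * \<alpha>(l)\<close> and \<open>l * \<beta>(l)\<close> additive, whence the missing quadratic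
  terms.\<close>

definition cubic_family :: "'a set \<Rightarrow> 'a vec3 \<Rightarrow> 'a vec3 \<Rightarrow> 'a vec3 set" where
  "cubic_family L p r = (\<lambda>l. (vdot p (1, l, l ^ 3), vdot r (1, l, l ^ 3), l)) ` (L - {0})"

lemma mathon_family_cubic:
  assumes C: "mathon_family 7 C" "card C = 7"
  obtains L p r where "subgroup8 L" "C = cubic_family L p r"
proof -
  define lam :: "'a vec3 \<Rightarrow> 'a" where "lam c = snd (snd c)" for c
  define L where "L = insert 0 (lam ` C)"
  define A where "A l = fst (inv_into C lam l)" for l
  define B where "B l = fst (snd (inv_into C lam l))" for l
  have inj: "inj_on lam C" using C(1) by (simp add: mathon_family_def lam_def[abs_def])
  have nz: "l \<noteq> 0" if "(\<alpha>, \<beta>, l) \<in> C" for \<alpha> \<beta> l using C(1) that unfolding mathon_family_def by blast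
  have eq: "\<alpha> = A l" "\<beta> = B l" if "(\<alpha>, \<beta>, l) \<in> C" for \<alpha> \<beta> l
    using inv_into_f_f[OF inj that] by (simp_all add: A_def B_def lam_def)
  have mem: "(A l, B l, l) \<in> C" if l: "l \<in> L - {0}" for l
  proof -
    obtain \<alpha> \<beta> where "(\<alpha>, \<beta>, l) \<in> C" using l by (auto simp: L_def lam_def)
    then show ?thesis using eq by metis
  qed
  have C_eq: "C = (\<lambda>l. (A l, B l, l)) ` (L - {0})"
  proof (intro equalityI subsetI)
    fix c assume c: "c \<in> C"
    obtain \<alpha> \<beta> l where c': "c = (\<alpha>, \<beta>, l)" by (cases c)
    have "l \<in> L - {0}" using c nz unfolding c' L_def by (force simp: lam_def)
    then show "c \<in> (\<lambda>l. (A l, B l, l)) ` (L - {0})" using eq c c' by blast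
  qed (use mem in blast)
  have closed: "(A (l + l'), B (l + l'), l + l') \<in> C \<and> (l + l') * A (l + l') = l * A l + l' * A l' \<and>
      (l + l') * B (l + l') = l * B l + l' * B l'"
    if l: "l \<in> L - {0}" "l' \<in> L - {0}" "l \<noteq> l'" for l l'
  proof -
    have "oplus (A l, B l, l) (A l', B l', l') \<in> C"
      using C(1) mem[OF l(1)] mem[OF l(2)] l(3) unfolding mathon_family_def by blast
    then have "((A l * l + A l' * l') / (l + l'), (B l * l + B l' * l') / (l + l'), l + l') \<in> C" by simp
    moreover from eq[OF this] have "A (l + l') = (A l * l + A l' * l') / (l + l')"
      "B (l + l') = (B l * l + B l' * l') / (l + l')" by simp_all
    ultimately show ?thesis using l(3) by (simp add: mult.commute)
  qed
  have sum: "l + l' \<in> L" if "l \<in> L" "l' \<in> L" for l l'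
  proof (cases "l = 0 \<or> l' = 0 \<or> l = l'")
    case False
    then have "(A (l + l'), B (l + l'), l + l') \<in> C" using closed that by blast
    then show ?thesis unfolding L_def lam_def by force
  qed (use that in \<open>auto simp: L_def\<close>)
  have "0 \<notin> lam ` C" using nz by (auto simp: lam_def)
  then have "card L = 8" using C(2) card_image[OF inj] by (simp add: L_def)
  then have L: "subgroup8 L" using sum by (auto simp: subgroup8_def L_def)
  \<comment> \<open>The factor l makes the arbitrary values of \<open>A\<close> and \<open>B\<close>
    at 0 harmless, and for l = l' both sides are 0; so additivity also covers the pairs to which
    \<open>oplus\<close> is not applied.\<close>
  have "(l + l') * A (l + l') = l * A l + l' * A l'" "(l + l') * B (l + l') = l * B l + l' * B l'"
    if "l \<in> L" "l' \<in> L" for l l'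
    using closed[of l l'] that by (cases "l = 0 \<or> l' = 0 \<or> l = l'"; auto)+
  note AB = this
  obtain p0 p1 p2 where p: "\<And>l. l \<in> L \<Longrightarrow> l * A l = p0 * l + p1 * l ^ 2 + p2 * l ^ 4"
    using additive_interpolation[OF L, of "\<lambda>l. l * A l"] AB(1) by blast
  obtain r0 r1 r2 where r: "\<And>l. l \<in> L \<Longrightarrow> l * B l = r0 * l + r1 * l ^ 2 + r2 * l ^ 4"
    using additive_interpolation[OF L, of "\<lambda>l. l * B l"] AB(2) by blast
  \<comment> \<open>Dividing the exponents 1, 2, 4 of an additive polynomial by one power of l
    leaves 0, 1, 3.\<close>
  have div: "x = q0 + q1 * l + q2 * l ^ 3" if "l * x = q0 * l + q1 * l ^ 2 + q2 * l ^ 4" "l \<noteq> 0" for l x q0 q1 q2 :: 'a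
  proof -
    have "l * x = l * (q0 + q1 * l + q2 * l ^ 3)" using that(1) by (simp add: algebra_simps numeral_eq_Suc)
    then show ?thesis using that(2) by simp
  qed
  have "C = cubic_family L (p0, p1, p2) (r0, r1, r2)"
    unfolding C_eq cubic_family_def using div[OF p] div[OF r] by (intro image_cong refl) simp
  then show ?thesis by (rule that[OF L])
qed

text \<open>A quadratic function sums to zero over a three-dimensional space over GF(2), so one that
  vanishes at 0 and is constant on the nonzero vectors vanishes identically.\<close>

lemma cubic_family_trace:
  assumes L: "subgroup8 L"
    and tr: "\<And>l. l \<in> L - {0} \<Longrightarrow> tr ((p0 + p1 * l + e ^ 2 * l ^ 3) * (r0 + r1 * l + f ^ 2 * l ^ 3)) = 1"
  defines "c \<equiv> p0 * f ^ 2 + r0 * e ^ 2 + e * f"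
  shows "tr (p0 * r0) = 1" "\<And>x y. x \<in> L \<Longrightarrow> y \<in> L \<Longrightarrow> tr (c * (x ^ 2 * y + x * y ^ 2)) = 0"
proof -
  \<comment> \<open>T is the nonconstant part of the product with the sixth-degree term e^2 f^2 l^6
    traded for its root e f l^3, which has the same trace; this is the mixed term in c.\<close>
  define T where "T l = c * l ^ 3 + (p0 * r1 + p1 * r0) * l + p1 * r1 * l ^ 2 + (p1 * f ^ 2 + e ^ 2 * r1) * l ^ 4" for l
  have T: "tr (T l) = 1 + tr (p0 * r0)" if "l \<in> L - {0}" for l
  proof -
    have "(p0 + p1 * l + e ^ 2 * l ^ 3) * (r0 + r1 * l + f ^ 2 * l ^ 3)
      = p0 * r0 + (T l + e * f * l ^ 3) + (e * f * l ^ 3) ^ 2"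
      by (simp add: T_def c_def power_mult_distrib) (simp add: algebra_simps numeral_eq_Suc)
    then have "tr (p0 * r0 + (T l + e * f * l ^ 3) + (e * f * l ^ 3) ^ 2) = 1" using tr[OF that] by simp
    then have "tr (p0 * r0) + tr (T l) = 1" by (simp only: tr_add tr_power2 add.assoc add_self add_0_right)
    then show ?thesis by (simp add: add_eq_iff add_ac)
  qed
  obtain x y z where span: "L = span3 x y z" and ind: "x \<noteq> 0" "y \<notin> {0, x}" "z \<notin> {0, x, y, x + y}"
    using subgroup8_basis[OF L] by blast
  have mem: "x \<in> L - {0}" "y \<in> L - {0}" "z \<in> L - {0}" "x + y \<in> L - {0}" "x + z \<in> L - {0}"
      "y + z \<in> L - {0}" "x + y + z \<in> L - {0}"
    using ind by (auto simp: span span3_def add_eq_iff add_ac)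
  have "T x + T y + T z + T (x + y) + T (x + z) + T (y + z) + T (x + y + z) = 0"
    by (simp add: T_def power3_add power4_add) (simp add: algebra_simps)
  then have "tr (T x) + tr (T y) + tr (T z) + tr (T (x + y)) + tr (T (x + z)) + tr (T (y + z)) + tr (T (x + y + z)) = 0"
    by (metis tr_0 tr_add)
  then show 1: "tr (p0 * r0) = 1" unfolding T[OF mem(1)] T[OF mem(2)] T[OF mem(3)] T[OF mem(4)]
    T[OF mem(5)] T[OF mem(6)] T[OF mem(7)] by simp
  have T0: "tr (T l) = 0" if "l \<in> L" for l
    using T[of l] that 1 by (cases "l = 0") (simp_all add: T_def)
  fix u v assume uv: "u \<in> L" "v \<in> L"
  have "T (u + v) = T u + T v + c * (u ^ 2 * v + u * v ^ 2)"
    by (simp add: T_def power3_add power4_add) (simp add: algebra_simps)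
  then have "tr (T (u + v)) = tr (T u) + tr (T v) + tr (c * (u ^ 2 * v + u * v ^ 2))"
    by (simp only: tr_add)
  then show "tr (c * (u ^ 2 * v + u * v ^ 2)) = 0"
    using T0 uv subgroup8D(2)[OF L uv] by simp
qed

text \<open>The matrix comes from comparing coefficients for the new index D l. The cubic terms give
  D m11 = e and D m12 = f, the linear terms give the shifts of z, the constant terms of alpha give a
  quadratic equation for m21, and the determinant D gives m22. The remaining equation holds because
  D^3 = c.\<close>

lemma cubic_family_isomorphic_normal:
  assumes L: "subgroup8 L" and e: "e \<noteq> 0"
    and tr: "\<And>l. l \<in> L - {0} \<Longrightarrow> tr ((p0 + p1 * l + e ^ 2 * l ^ 3) * (r0 + r1 * l + f ^ 2 * l ^ 3)) = 1"
  shows "\<exists>L'\<in>isotropic. isomorphic_arcs (mathon_set (cubic_family L (p0, p1, e ^ 2) (r0, r1, f ^ 2))) (normal_arc L')"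
proof -
  define c where "c = p0 * f ^ 2 + r0 * e ^ 2 + e * f"
  have tr1: "tr (p0 * r0) = 1" by (rule cubic_family_trace(1)[OF L]) (rule tr)
  have iso: "tr (c * (x ^ 2 * y + x * y ^ 2)) = 0" if "x \<in> L" "y \<in> L" for x y
    unfolding c_def by (rule cubic_family_trace(2)[OF L _ that]) (rule tr)
  \<comment> \<open>This decides whether the quadratic equation for w = m21 / m11 is solvable, since
    D p0 / m11^2 = c p0 / e^2. The terms containing f have the shape u^2 + u, so the trace is that
    of p0 r0.\<close>
  have trc: "tr (c * p0 / e ^ 2) = 1"
  proof -
    have "c * p0 / e ^ 2 = (p0 * f / e) ^ 2 + p0 * f / e + p0 * r0"
      using e by (simp add: c_def field_simps power2_eq_square)
    then show ?thesis using tr1 by (simp only: tr_add tr_power2 add_self add_0_left)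
  qed
  then have c: "c \<noteq> 0" by auto
  obtain D where D: "D ^ 3 = c" using cube_root_exists by blast
  then have D0: "D \<noteq> 0" using c by auto
  have "tr (1 + c * p0 / e ^ 2) = 0" using trc by (simp add: tr_add)
  then obtain w where w: "w ^ 2 + w = 1 + c * p0 / e ^ 2" using artin_schreier by blast
  define m11 where "m11 = e / D"
  define m12 where "m12 = f / D"
  define m21 where "m21 = m11 * w"
  define m22 where "m22 = (D + m12 * m21) / m11"
  have m11: "m11 \<noteq> 0" using e D0 by (simp add: m11_def)
  then have det: "m11 * m22 + m12 * m21 = D" by (simp add: m22_def)
  have De: "D * m11 = e" "D * m12 = f" using D0 by (simp_all add: m11_def m12_def)
  have P: "m11 ^ 2 + m11 * m21 + m21 ^ 2 = D * p0"
  proof -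
    have "m11 ^ 2 + m11 * m21 + m21 ^ 2 = m11 ^ 2 * (1 + (w ^ 2 + w))"
      by (simp add: m21_def algebra_simps power2_eq_square)
    also have "\<dots> = m11 ^ 2 * (c * p0 / e ^ 2)" unfolding w by simp
    also have "\<dots> = D * p0" using e D0 by (simp add: m11_def D[symmetric] field_simps power2_eq_square power3_eq_cube)
    finally show ?thesis .
  qed
  \<comment> \<open>Multiplying by m11^2 and replacing m11 m22 by D + m12 m21 reduces the claim to
    \<open>P\<close> and D^3 = c.\<close>
  have R: "m12 ^ 2 + m12 * m22 + m22 ^ 2 = D * r0"
  proof -
    have m: "m11 * m22 = D + m12 * m21" using m11 by (simp add: m22_def)
    have "D * (m11 ^ 2 * (m12 ^ 2 + m12 * m22 + m22 ^ 2))
      = D * ((m11 * m12) ^ 2 + m12 * m11 * (m11 * m22) + (m11 * m22) ^ 2)"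
      by (simp add: algebra_simps power2_eq_square)
    also have "\<dots> = D * (m12 ^ 2 * (m11 ^ 2 + m11 * m21 + m21 ^ 2) + m12 * m11 * D + D ^ 2)"
      unfolding m by (simp add: algebra_simps power2_eq_square)
    also have "\<dots> = (D * m12) ^ 2 * p0 + (D * m12) * (D * m11) + D ^ 3"
      unfolding P by (simp add: algebra_simps power2_eq_square power3_eq_cube)
    also have "\<dots> = r0 * (D * m11) ^ 2" unfolding De D c_def by (simp add: algebra_simps)
    also have "\<dots> = D * (m11 ^ 2 * (D * r0))" by (simp add: algebra_simps power2_eq_square)
    finally show ?thesis using D0 m11 by (simp only: mult_cancel_left) simp
  qed
  define L' where "L' = (\<lambda>l. D * l) ` L"
  have "L' \<in> isotropic"
    unfolding isotropic_def
  proof (intro CollectI conjI ballI)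
    have "card L' = card L" unfolding L'_def by (rule card_image) (use D0 in \<open>simp add: inj_on_def\<close>)
    then show "subgroup8 L'"
      using subgroup8D[OF L] unfolding subgroup8_def L'_def by (auto simp flip: distrib_left)
    fix u v assume "u \<in> L'" "v \<in> L'"
    then obtain x y where xy: "x \<in> L" "y \<in> L" "u = D * x" "v = D * y" by (auto simp: L'_def)
    have "u ^ 2 * v + u * v ^ 2 = c * (x ^ 2 * y + x * y ^ 2)"
      unfolding xy D[symmetric] by (simp add: algebra_simps power2_eq_square power3_eq_cube)
    then show "polar u v = 0" using iso[OF xy(1,2)] by (simp add: polar_def)
  qed
  moreover have "cimg (block_map id m11 m12 m21 m22 (sq_root p1) (sq_root r1))
      (mathon_set (cubic_family L (p0, p1, e ^ 2) (r0, r1, f ^ 2))) = normal_arc L'"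
    unfolding normal_arc_def
  proof (rule cimg_block_map_mathon_set)
    show "field_aut (id :: 'a \<Rightarrow> 'a)" by (simp add: field_aut_def)
    show "m11 * m22 + m12 * m21 \<noteq> 0" using det D0 by simp
    have rel: "conic_rel id m11 m12 m21 m22 (sq_root p1) (sq_root r1)
      (p0 + p1 * l + e ^ 2 * l ^ 3, r0 + r1 * l + f ^ 2 * l ^ 3, l) (1 + (D * l) ^ 3, 1, D * l)" for l
    proof -
      have "(1 + (D * l) ^ 3) * m11 ^ 2 + m11 * m21 + m21 ^ 2 + D * l * p1
        = (m11 ^ 2 + m11 * m21 + m21 ^ 2) + D * (p1 * l) + D * ((D * m11) ^ 2 * l ^ 3)"
        by (simp add: algebra_simps power2_eq_square power3_eq_cube)
      moreover have "(1 + (D * l) ^ 3) * m12 ^ 2 + m12 * m22 + m22 ^ 2 + D * l * r1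
        = (m12 ^ 2 + m12 * m22 + m22 ^ 2) + D * (r1 * l) + D * ((D * m12) ^ 2 * l ^ 3)"
        by (simp add: algebra_simps power2_eq_square power3_eq_cube)
      ultimately show ?thesis
        unfolding conic_rel_def prod.case det P R De by (simp add: distrib_left)
    qed
    have mem: "D * l \<in> L' - {0}" if "l \<in> L - {0}" for l using that D0 by (auto simp: L'_def)
    show "\<exists>c'\<in>normal_family L'. conic_rel id m11 m12 m21 m22 (sq_root p1) (sq_root r1) x c'"
      if x: "x \<in> cubic_family L (p0, p1, e ^ 2) (r0, r1, f ^ 2)" for x
    proof -
      obtain l where "l \<in> L - {0}" "x = (p0 + p1 * l + e ^ 2 * l ^ 3, r0 + r1 * l + f ^ 2 * l ^ 3, l)"
        using x by (auto simp: cubic_family_def)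
      then show ?thesis using rel mem unfolding normal_family_def by blast
    qed
    show "\<exists>x\<in>cubic_family L (p0, p1, e ^ 2) (r0, r1, f ^ 2). conic_rel id m11 m12 m21 m22 (sq_root p1) (sq_root r1) x c'"
      if c': "c' \<in> normal_family L'" for c'
    proof -
      obtain l' where l': "l' \<in> L' - {0}" "c' = (1 + l' ^ 3, 1, l')"
        using c' unfolding normal_family_def by blast
      then obtain l where "l \<in> L" "l' = D * l" unfolding L'_def by blast
      then have l: "l \<in> L - {0}" "c' = (1 + (D * l) ^ 3, 1, D * l)" using l' by auto
      moreover have "(p0 + p1 * l + e ^ 2 * l ^ 3, r0 + r1 * l + f ^ 2 * l ^ 3, l) \<in> cubic_family L (p0, p1, e ^ 2) (r0, r1, f ^ 2)"
        using l(1) by (auto simp: cubic_family_def)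
      ultimately show ?thesis using rel by blast
    qed
  qed
  moreover have "semilinear (block_map id m11 m12 m21 m22 (sq_root p1) (sq_root r1))"
    by (rule semilinear_block_map) (use det D0 in \<open>simp_all add: field_aut_def\<close>)
  ultimately show ?thesis unfolding isomorphic_arcs_def by blast
qed

text \<open>Interchanging x and y reduces the case f nonzero to the case e nonzero, where division
  by e is possible.\<close>

lemma isomorphic_arcs_swap:
  "isomorphic_arcs (mathon_set (cubic_family L p r)) (mathon_set (cubic_family L r p))"
proof -
  have "cimg (block_map id 0 1 1 0 0 0) (mathon_set (cubic_family L p r)) = mathon_set (cubic_family L r p)"
  proof (rule cimg_block_map_mathon_set)
    have rel: "conic_rel id 0 1 1 0 0 0 (\<alpha>, \<beta>, l) (\<beta>, \<alpha>, l)" for \<alpha> \<beta> l :: 'a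
      by (simp add: conic_rel_def)
    show "\<exists>c'\<in>cubic_family L r p. conic_rel id 0 1 1 0 0 0 c c'" if "c \<in> cubic_family L p r" for c
      using that rel unfolding cubic_family_def by blast
    show "\<exists>c\<in>cubic_family L p r. conic_rel id 0 1 1 0 0 0 c c'" if "c' \<in> cubic_family L r p" for c'
      using that rel unfolding cubic_family_def by blast
  qed (simp_all add: field_aut_def)
  moreover have "semilinear (block_map id 0 1 1 0 0 (0 :: 'a))"
    by (rule semilinear_block_map) (simp_all add: field_aut_def)
  ultimately show ?thesis unfolding isomorphic_arcs_def by blast
qed

text \<open>Shifting z absorbs the terms linear in l, and scaling x by u and y by 1 / u with u^2 =
  r0 carries the constant pair (p0 r0, 1) to (p0, r0).\<close>

lemma linear_family_denniston:
  assumes L: "subgroup8 L" and tr: "tr (p0 * r0) = 1"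
  shows "denniston_type 7 (mathon_set (cubic_family L (p0, p1, 0) (r0, r1, 0)))"
proof -
  define C where "C = (\<lambda>l. (p0 * r0, 1 :: 'a, l)) ` (L - {0})"
  have r0: "r0 \<noteq> 0" using tr by auto
  define u where "u = sq_root r0"
  have u: "u ^ 2 = r0" "u \<noteq> 0" using r0 by (auto simp: u_def sq_root_def)
  have "mathon_family 7 C"
    unfolding mathon_family_def
  proof (intro conjI ballI impI)
    show "finite C" by simp
    show "inj_on (\<lambda>c. snd (snd c)) C" by (auto simp: inj_on_def C_def)
    show "case c of (\<alpha>, \<beta>, l) \<Rightarrow> tr (\<alpha> * \<beta>) = 1 \<and> l \<noteq> 0" if "c \<in> C" for c
      using that tr by (auto simp: C_def)
    fix c c' assume "c \<in> C" "c' \<in> C" "c \<noteq> c'"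
    then obtain l l' where l: "l \<in> L - {0}" "l' \<in> L - {0}" "l \<noteq> l'" "c = (p0 * r0, 1, l)" "c' = (p0 * r0, 1, l')"
      by (auto simp: C_def)
    have ne: "l + l' \<noteq> 0" using l(3) by simp
    then have "oplus c c' = (p0 * r0, 1, l + l')"
      unfolding l oplus.simps by (simp del: add_eq_0_iff_eq flip: distrib_left)
    moreover have "l + l' \<in> L - {0}" using l ne subgroup8D(2)[OF L] by blast
    ultimately show "oplus c c' \<in> C" unfolding C_def by blast
  qed
  moreover have "\<forall>c\<in>C. \<exists>l. c = (p0 * r0, 1, l)" by (auto simp: C_def)
  moreover have "isomorphic_arcs (mathon_set C) (mathon_set (cubic_family L (p0, p1, 0) (r0, r1, 0)))"
  proof -
    have id: "field_aut (id :: 'a \<Rightarrow> 'a)" by (simp add: field_aut_def)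
    have "cimg (block_map id u 0 0 (1 / u) (u * sq_root p1) (sq_root r1 / u)) (mathon_set C)
      = mathon_set (cubic_family L (p0, p1, 0) (r0, r1, 0))"
    proof (rule cimg_block_map_mathon_set[OF id])
      have rel: "conic_rel id u 0 0 (1 / u) (u * sq_root p1) (sq_root r1 / u) (p0 * r0, 1, l) (p0 + p1 * l, r0 + r1 * l, l)" for l
        using u(2) r0 by (simp add: conic_rel_def power_mult_distrib power_divide u(1)) (simp add: field_simps)
      show "\<exists>c'\<in>cubic_family L (p0, p1, 0) (r0, r1, 0).
          conic_rel id u 0 0 (1 / u) (u * sq_root p1) (sq_root r1 / u) c c'" if c: "c \<in> C" for c
      proof -
        obtain l where l: "l \<in> L - {0}" "c = (p0 * r0, 1, l)" using c by (auto simp: C_def)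
        moreover have "(p0 + p1 * l, r0 + r1 * l, l) \<in> cubic_family L (p0, p1, 0) (r0, r1, 0)"
          using l(1) by (auto simp: cubic_family_def)
        ultimately show ?thesis using rel by blast
      qed
      show "\<exists>c\<in>C. conic_rel id u 0 0 (1 / u) (u * sq_root p1) (sq_root r1 / u) c c'"
        if c': "c' \<in> cubic_family L (p0, p1, 0) (r0, r1, 0)" for c'
      proof -
        obtain l where "l \<in> L - {0}" "c' = (p0 + p1 * l, r0 + r1 * l, l)"
          using c' by (auto simp: cubic_family_def)
        then show ?thesis using rel unfolding C_def by blast
      qed
    qed (use u in simp)
    moreover have "semilinear (block_map id u 0 0 (1 / u) (u * sq_root p1) (sq_root r1 / u))"
      by (rule semilinear_block_map[OF id]) (use u in simp)
    ultimately show ?thesis unfolding isomorphic_arcs_def by blast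
  qed
  ultimately show ?thesis unfolding denniston_type_iff using tr by blast
qed

theorem proper_mathon_arc_isomorphic_normal:
  assumes K: "maximal_arc (K :: 'a vec3 set set) 8" "proper_mathon_type 7 K"
  shows "\<exists>L\<in>isotropic. isomorphic_arcs K (normal_arc L)"
proof -
  obtain C where C: "mathon_family 7 C" and iso: "isomorphic_arcs K (mathon_set C)"
    using K(2) isomorphic_arcs_sym unfolding proper_mathon_type_def mathon_type_iff by blast
  have "card C = 7" by (rule card_mathon_family[OF C maximal_arc_iso[OF iso K(1)]])
  then obtain L p r where L: "subgroup8 L" and Cpr: "C = cubic_family L p r"
    using mathon_family_cubic[OF C] by blast
  obtain p0 p1 p2 where p: "p = (p0, p1, p2)" by (cases p)
  obtain r0 r1 r2 where r: "r = (r0, r1, r2)" by (cases r)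
  define e where "e = sq_root p2"
  define f where "f = sq_root r2"
  have ef: "p = (p0, p1, e ^ 2)" "r = (r0, r1, f ^ 2)" by (simp_all add: p r e_def f_def)
  have tr: "tr ((p0 + p1 * l + e ^ 2 * l ^ 3) * (r0 + r1 * l + f ^ 2 * l ^ 3)) = 1" if "l \<in> L - {0}" for l
  proof -
    have "(p0 + p1 * l + e ^ 2 * l ^ 3, r0 + r1 * l + f ^ 2 * l ^ 3, l) \<in> C"
      unfolding Cpr ef cubic_family_def using that by (intro image_eqI[of _ _ l]) simp_all
    then show ?thesis using C unfolding mathon_family_def by blast
  qed
  have "\<exists>L'\<in>isotropic. isomorphic_arcs (mathon_set C) (normal_arc L')"
  proof -
    \<comment> \<open>If e or f is nonzero, the trace computation in the reduction already makes c
      nonzero; what remains is the Denniston case.\<close>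
    consider "e \<noteq> 0" | "f \<noteq> 0" | "e = 0" "f = 0" by blast
    then show ?thesis
    proof cases
      case 1
      then show ?thesis using cubic_family_isomorphic_normal[OF L 1 tr] unfolding Cpr ef by blast
    next
      case 2
      have "\<exists>L'\<in>isotropic. isomorphic_arcs (mathon_set (cubic_family L (r0, r1, f ^ 2) (p0, p1, e ^ 2))) (normal_arc L')"
        by (rule cubic_family_isomorphic_normal[OF L 2]) (subst mult.commute, rule tr)
      then show ?thesis unfolding Cpr ef
        using isomorphic_arcs_swap isomorphic_arcs_trans by blast
    next
      case 3
      have "tr (p0 * r0) = 1" by (rule cubic_family_trace(1)[OF L tr])
      then have "denniston_type 7 (mathon_set C)"
        using linear_family_denniston[OF L] unfolding Cpr ef 3 by simp
      then have "denniston_type 7 K" by (rule denniston_type_iso[OF isomorphic_arcs_sym[OF iso]])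
      then show ?thesis using K(2) by (simp add: proper_mathon_type_def)
    qed
  qed
  then show ?thesis using isomorphic_arcs_trans[OF iso] by blast
qed

section \<open>The classification\<close>

definition frob_orbit :: "'a set \<Rightarrow> 'a set set" where
  "frob_orbit L = range (\<lambda>i. ((`) (\<lambda>x. x ^ 2) ^^ i) L)"

lemma frob_period: "((`) (\<lambda>x. x ^ 2) ^^ 7) L = L" for L :: "'a set"
  unfolding funpow_image_power2 by simp

lemma frob_orbit_eq_iff: "frob_orbit L = frob_orbit L' \<longleftrightarrow> (\<exists>\<sigma>. field_aut \<sigma> \<and> L' = \<sigma> ` L)"
proof
  assume "frob_orbit L = frob_orbit L'"
  moreover have "L' \<in> frob_orbit L'" unfolding frob_orbit_def by (rule range_eqI[of _ _ 0]) simp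
  ultimately have "L' \<in> frob_orbit L" by simp
  then obtain i where "L' = (\<lambda>x. x ^ (2 ^ i)) ` L"
    unfolding frob_orbit_def funpow_image_power2 by blast
  then show "\<exists>\<sigma>. field_aut \<sigma> \<and> L' = \<sigma> ` L" using field_aut_frob by blast
next
  assume "\<exists>\<sigma>. field_aut \<sigma> \<and> L' = \<sigma> ` L"
  then obtain i where "L' = ((`) (\<lambda>x. x ^ 2) ^^ i) L"
    unfolding field_aut_iff funpow_image_power2 by blast
  then show "frob_orbit L = frob_orbit L'"
    using period_7_orbit(2)[OF frob_period, of L' L] unfolding frob_orbit_def by blast
qed

lemma frob_isotropic: assumes "L \<in> isotropic" shows "(\<lambda>x. x ^ 2) ` L \<in> isotropic"
proof -
  note sub = subgroup8D[OF isotropicD(1)[OF assms]]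
  have "card ((\<lambda>x. x ^ 2) ` L) = 8" using sub(3) by (subst card_image) (auto simp: inj_on_def)
  moreover have "polar (x ^ 2) (y ^ 2) = polar x y" for x y
  proof -
    have "(x ^ 2) ^ 2 * y ^ 2 + x ^ 2 * (y ^ 2) ^ 2 = (x ^ 2 * y + x * y ^ 2) ^ 2"
      by (simp add: power_mult_distrib)
    then show ?thesis unfolding polar_def by (simp only: tr_power2)
  qed
  ultimately show ?thesis
    using sub isotropicD(2)[OF assms] unfolding isotropic_def subgroup8_def
    by (auto simp flip: power2_add)
qed

lemma card_frob_orbits:
  "card (frob_orbit ` {L \<in> isotropic. (\<lambda>x. x ^ 2) ` L = L}) = 2"
  "card (frob_orbit ` {L \<in> isotropic. (\<lambda>x. x ^ 2) ` L \<noteq> L}) = 199"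
  "card (frob_orbit ` isotropic) = 201"
proof -
  let ?F = "{L \<in> isotropic. (\<lambda>x. x ^ 2) ` L = L}" and ?N = "{L \<in> isotropic. (\<lambda>x. x ^ 2) ` L \<noteq> L}"
  have "(`) (\<lambda>x. x ^ 2) ` isotropic \<subseteq> isotropic" using frob_isotropic by blast
  note orbits = card_orbits_7[OF finite this frob_period, folded frob_orbit_def[abs_def]]
  have "?F \<subseteq> {{x. x ^ 8 = x ^ 2 + x}, {x. x ^ 8 = x ^ 4 + x}}"
    using frob_invariant_subgroup8 isotropicD(1) by blast
  then have "card ?F \<le> card {{x :: 'a. x ^ 8 = x ^ 2 + x}, {x. x ^ 8 = x ^ 4 + x}}"
    by (rule card_mono[rotated]) simp
  also have "\<dots> \<le> 2" by (simp add: card_insert_if)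
  finally have "card ?F \<le> 2" .
  moreover have "1395 = card ?F + 7 * card (frob_orbit ` ?N)"
    using orbits(1) card_isotropic by simp
  \<comment> \<open>The number of invariant subgroups is at most 2 and congruent to 1395, hence to
    2, modulo 7; so both candidates are isotropic without having been tested.\<close>
  ultimately have F: "card ?F = 2" and N: "card (frob_orbit ` ?N) = 199" by presburger+
  show N': "card (frob_orbit ` ?N) = 199" by (rule N)
  show F': "card (frob_orbit ` ?F) = 2" using orbits(2) F by simp
  have "isotropic = ?F \<union> ?N" by blast
  then have "frob_orbit ` isotropic = frob_orbit ` ?F \<union> frob_orbit ` ?N" by (metis image_Un)
  then show "card (frob_orbit ` isotropic) = 201"
    using orbits(3) F' N' by (simp add: card_Un_disjoint)
qed

end

text \<open>Transfers the number of Frobenius orbits to the number of isomorphism classes, both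
  being images of the set of isotropic subgroups under maps that identify the same pairs.\<close>

lemma card_image_eq_if_same_kernel:
  assumes "\<And>x y. x \<in> S \<Longrightarrow> y \<in> S \<Longrightarrow> f x = f y \<longleftrightarrow> g x = g y"
  shows "card (f ` S) = card (g ` S)"
proof -
  have "bij_betw (\<lambda>u. g (inv_into S f u)) (f ` S) (g ` S)"
  proof (rule bij_betw_imageI)
    have inv: "inv_into S f (f x) \<in> S" "f (inv_into S f (f x)) = f x" if "x \<in> S" for x
      using that by (simp_all add: inv_into_into f_inv_into_f)
    show "inj_on (\<lambda>u. g (inv_into S f u)) (f ` S)"
    proof (rule inj_onI)
      fix u v assume "u \<in> f ` S" "v \<in> f ` S" "g (inv_into S f u) = g (inv_into S f v)"
      then show "u = v" using assms by (metis f_inv_into_f inv_into_into)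
    qed
    have "g (inv_into S f (f x)) = g x" if "x \<in> S" for x using inv[OF that] assms that by metis
    then show "(\<lambda>u. g (inv_into S f u)) ` f ` S = g ` S" by (simp add: image_image cong: image_cong)
  qed
  then show ?thesis by (rule bij_betw_same_card)
qed

theorem theorem4:
  assumes "card (UNIV :: 'a::{field,finite} set) = 2 ^ 7"
  shows "let A = {K :: 'a vec3 set set. maximal_arc K 8 \<and> proper_mathon_type 7 K};
             Cl = A // {(K, K'). K \<in> A \<and> K' \<in> A \<and> isomorphic_arcs K K'}
         in card Cl = 201 \<and>
            card {X \<in> Cl. \<exists>K \<in> X. card (aut_group K) = 14} = 2 \<and>
            card {X \<in> Cl. \<exists>K \<in> X. card (aut_group K) = 2} = 199"
proof -
  interpret gf128 "TYPE('a)" by unfold_locales (rule assms)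
  define A where "A = {K :: 'a vec3 set set. maximal_arc K 8 \<and> proper_mathon_type 7 K}"
  define r where "r = {(K, K'). K \<in> A \<and> K' \<in> A \<and> isomorphic_arcs K K'}"
  define cl where "cl L = r `` {normal_arc L}" for L
  have nA: "normal_arc L \<in> A" if "L \<in> isotropic" for L
    using that by (simp add: A_def maximal_arc_normal_arc proper_mathon_type_normal_arc)
  have "equiv A r"
  proof (rule equivI)
    show "r \<subseteq> A \<times> A" by (auto simp: r_def)
    show "refl_on A r" by (auto simp: refl_on_def r_def isomorphic_arcs_refl)
    show "sym r" by (auto simp: sym_def r_def isomorphic_arcs_sym)
    show "trans r" unfolding trans_def r_def using isomorphic_arcs_trans by blast
  qed
  note equiv = this
  have classes: "A // r = cl ` isotropic"
  proof (intro equalityI subsetI)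
    fix X assume "X \<in> A // r"
    then obtain K where K: "K \<in> A" "X = r `` {K}" by (auto elim: quotientE)
    then obtain L where L: "L \<in> isotropic" "isomorphic_arcs K (normal_arc L)"
      using proper_mathon_arc_isomorphic_normal unfolding A_def by blast
    then have "(K, normal_arc L) \<in> r" using K(1) nA by (simp add: r_def)
    then have "X = cl L" unfolding K(2) cl_def by (rule equiv_class_eq[OF equiv])
    then show "X \<in> cl ` isotropic" using L(1) by blast
  next
    fix X assume "X \<in> cl ` isotropic"
    then show "X \<in> A // r" unfolding cl_def using nA by (auto intro: quotientI)
  qed
  have kernel: "cl L = cl L' \<longleftrightarrow> frob_orbit L = frob_orbit L'" if "L \<in> isotropic" "L' \<in> isotropic" for L L'
  proof -
    have "cl L = cl L' \<longleftrightarrow> (normal_arc L, normal_arc L') \<in> r"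
      unfolding cl_def using nA that by (intro eq_equiv_class_iff[OF equiv])
    also have "\<dots> \<longleftrightarrow> isomorphic_arcs (normal_arc L) (normal_arc L')" using nA that by (simp add: r_def)
    also have "\<dots> \<longleftrightarrow> frob_orbit L = frob_orbit L'"
      unfolding frob_orbit_eq_iff using that by (intro isomorphic_normal_arcs_iff isotropicD(1))
    finally show ?thesis .
  qed
  \<comment> \<open>The order of the automorphism group is constant on a class, so it can be read
    off the normal arc in it.\<close>
  have aut: "(\<exists>K\<in>cl L. card (aut_group K) = n) \<longleftrightarrow> n = (if (\<lambda>x. x ^ 2) ` L = L then 14 else 2)"
    if L: "L \<in> isotropic" for L n
  proof -
    have "card (aut_group K) = card (aut_group (normal_arc L))" if "K \<in> cl L" for K
      using that card_aut_group_cimg unfolding cl_def r_def isomorphic_arcs_def by blast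
    moreover have "normal_arc L \<in> cl L"
      unfolding cl_def using nA[OF L] by (intro equiv_class_self[OF equiv])
    ultimately show ?thesis using card_aut_group_normal_arc[OF isotropicD(1)[OF L]] by metis
  qed
  have sel: "{X \<in> cl ` isotropic. P X} = cl ` {L \<in> isotropic. Q L}"
    if "\<And>L. L \<in> isotropic \<Longrightarrow> P (cl L) \<longleftrightarrow> Q L" for P Q
    using that by blast
  have card: "card (cl ` S) = card (frob_orbit ` S)" if "S \<subseteq> isotropic" for S
    using that kernel by (intro card_image_eq_if_same_kernel) blast
  have "card (A // r) = 201"
    unfolding classes using card[of isotropic] card_frob_orbits(3) by simp
  moreover have "{X \<in> A // r. \<exists>K\<in>X. card (aut_group K) = 14} = cl ` {L \<in> isotropic. (\<lambda>x. x ^ 2) ` L = L}"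
    unfolding classes by (rule sel) (simp only: aut, simp)
  then have "card {X \<in> A // r. \<exists>K\<in>X. card (aut_group K) = 14} = 2"
    using card[of "{L \<in> isotropic. (\<lambda>x. x ^ 2) ` L = L}"] card_frob_orbits(1) by (simp only: Collect_restrict)
  moreover have "{X \<in> A // r. \<exists>K\<in>X. card (aut_group K) = 2} = cl ` {L \<in> isotropic. (\<lambda>x. x ^ 2) ` L \<noteq> L}"
    unfolding classes by (rule sel) (simp only: aut, simp)
  then have "card {X \<in> A // r. \<exists>K\<in>X. card (aut_group K) = 2} = 199"
    using card[of "{L \<in> isotropic. (\<lambda>x. x ^ 2) ` L \<noteq> L}"] card_frob_orbits(2) by (simp only: Collect_restrict)
  ultimately show ?thesis
    unfolding Let_def A_def[symmetric] r_def[symmetric] by blast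
qed

end
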